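(* Let $\mu=\{\mu_j\}_{j\in\mathbb{Z}}$ and $\nu=\{\nu_j\}_{j\in\mathbb{Z}}$ be bounded real sequences with $\inf_j\mu_j>0$. There is a constant $\eta_0>0$ that depends only on $\|\mu\|_\infty$, $\|\mu^{-1}\|_\infty$ and $\|\nu\|_\infty$ (where $\mu^{-1}=\{\mu_j^{-1}\}_{j\in\mathbb{Z}}$) such that the following holds. If there exist positive integers $q_n$ and $q_n$-periodic real sequences $\mu^{(n)},\nu^{(n)}\in\ell^\infty(\mathbb{Z})$, $n\ge1$, with $$\lim_{n\to\infty}e^{\eta_0q_{n+1}}\|\mu-\mu^{(n)}\|_\infty=\lim_{n\to\infty}e^{\eta_0q_{n+1}}\|\nu-\nu^{(n)}\|_\infty=0,$$ then there exists $v_0>0$ such that, whenever $C,c,v>0$ are constants for which the Lieb--Robinson bound $$\left\|\left[\tau^\Lambda_t(A),B\right]\right\|\le C\|A\|\|B\|e^{-c(d-v|t|)}$$ holds for every finite interval $\Lambda=[m,n]\cap\mathbb{Z}$, all disjoint nonempty $S_1,S_2\subseteq\Lambda$, all $A\in\mathcal{A}_{S_1}$, $B\in\mathcal{A}_{S_2}$ and all $t\in\mathbb{R}$, where $d=\min\{|n_1-n_2|:n_1\in S_1,\,n_2\in S_2\}$, one has $v\ge v_0$.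
   Context: A sequence $x$ indexed by $\mathbb{Z}$ is $q$-periodic if $x_{j+q}=x_j$ for all $j$. Isotropic $XY$ spin chain. For a finite interval $\Lambda=[m,n]\cap\mathbb{Z}$ (with integers $m\le n$) let $\mathcal{H}_\Lambda=\bigotimes_{j\in\Lambda}\mathbb{C}^2$. For $S\subseteq\Lambda$, the algebra of observables on $S$ is $\mathcal{A}_S=\bigotimes_{j\in S}\mathcal{A}_j$, where $\mathcal{A}_j=\mathbb{C}^{2\times2}$ acts on the $j$th tensor factor; elements of $\mathcal{A}_S$ are regarded as operators on $\mathcal{H}_\Lambda$ acting as the identity on the factors outside $S$. For $A\in\mathbb{C}^{2\times2}$, $A_j$ denotes the operator on $\mathcal{H}_\Lambda$ acting by $A$ on the $j$th factor and by the identity on the others. With Pauli matrices $$\sigma^x=\begin{bmatrix}0&1\\1&0\end{bmatrix},\quad \sigma^y=\begin{bmatrix}0&-i\\i&0\end{bmatrix},\quad \sigma^z=\begin{bmatrix}1&0\\0&-1\end{bmatrix},$$ the local Hamiltonian is $$H_\Lambda=-\sum_{j=m}^{n-1}\mu_j\left(\sigma^x_j\sigma^x_{j+1}+\sigma^y_j\sigma^y_{j+1}\right)-\sum_{j=m}^n\nu_j\sigma^z_j,$$ and the Heisenberg evolution is $\tau^\Lambda_t(A)=e^{itH_\Lambda}Ae^{-itH_\Lambda}$ for $t\in\mathbb{R}$. Here $[S,T]=ST-TS$ and $\|\cdot\|$ is the operator norm. *)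

theory Defs
  imports Complex_Main "Jordan_Normal_Form.Matrix"
begin

section \<open>Sequences indexed by the integers\<close>

definition in_linf :: "(int \<Rightarrow> real) \<Rightarrow> bool" where
  "in_linf x \<longleftrightarrow> bdd_above (range (\<lambda>j. \<bar>x j\<bar>))"

definition linf_norm :: "(int \<Rightarrow> real) \<Rightarrow> real" where
  "linf_norm x = (SUP j. \<bar>x j\<bar>)"

definition periodic_seq :: "nat \<Rightarrow> (int \<Rightarrow> real) \<Rightarrow> bool" where
  "periodic_seq q x \<longleftrightarrow> (\<forall>j. x (j + int q) = x j)"

section \<open>Complex matrices\<close>

definition l2_vec_norm :: "complex vec \<Rightarrow> real" where
  "l2_vec_norm v = sqrt (\<Sum>i<dim_vec v. (cmod (v $ i))\<^sup>2)"

definition l2_op_norm :: "complex mat \<Rightarrow> real" where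
  "l2_op_norm A =
     (SUP v\<in>{v \<in> carrier_vec (dim_col A). l2_vec_norm v \<le> 1}. l2_vec_norm (A *\<^sub>v v))"

definition mat_commutator :: "complex mat \<Rightarrow> complex mat \<Rightarrow> complex mat" where
  "mat_commutator S T = S * T - T * S"

text \<open>The matrix type is not an instance of \<open>comm_monoid_add\<close> (there is no zero of unspecified
  dimension), so sums of \<open>d \<times> d\<close> matrices are formed entrywise; likewise the exponential series.\<close>

definition mat_fsum :: "nat \<Rightarrow> ('k \<Rightarrow> complex mat) \<Rightarrow> 'k set \<Rightarrow> complex mat" where
  "mat_fsum d F I = mat d d (\<lambda>rs. \<Sum>k\<in>I. F k $$ rs)"

definition mat_exp :: "complex mat \<Rightarrow> complex mat" where
  "mat_exp A = mat (dim_row A) (dim_row A) (\<lambda>rs. \<Sum>k. ((A ^\<^sub>m k) $$ rs) / fact k)"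

definition pauli_x :: "complex mat" where
  "pauli_x = mat_of_rows_list 2 [[0, 1], [1, 0]]"

definition pauli_y :: "complex mat" where
  "pauli_y = mat_of_rows_list 2 [[0, - \<i>], [\<i>, 0]]"

definition pauli_z :: "complex mat" where
  "pauli_z = mat_of_rows_list 2 [[1, 0], [0, - 1]]"

section \<open>The spin chain on the interval \<open>{m..n}\<close>\<close>

text \<open>The tensor product of one copy of \<open>\<complex>\<^sup>2\<close> per site is taken to be \<open>\<complex>\<^sup>d\<close> with
  \<open>d = spin_dim m n\<close>. Its basis vector number \<open>r < d\<close> is the elementary tensor whose factor at
  site \<open>j\<close> is the standard basis vector of \<open>\<complex>\<^sup>2\<close> (numbered 0, 1) given by the binary digit
  \<open>spin_digit m r j\<close> of \<open>r\<close>. Hence the entries of a tensor product of \<open>2 \<times> 2\<close> matrices are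
  products of their entries.\<close>

definition spin_dim :: "int \<Rightarrow> int \<Rightarrow> nat" where
  "spin_dim m n = 2 ^ card {m..n}"

definition spin_digit :: "int \<Rightarrow> nat \<Rightarrow> int \<Rightarrow> nat" where
  "spin_digit m r j = r div 2 ^ nat (j - m) mod 2"

definition spin_tensor :: "int \<Rightarrow> int \<Rightarrow> (int \<Rightarrow> complex mat) \<Rightarrow> complex mat" where
  "spin_tensor m n M = mat (spin_dim m n) (spin_dim m n)
     (\<lambda>(r, s). \<Prod>j\<in>{m..n}. M j $$ (spin_digit m r j, spin_digit m s j))"

definition spin_site :: "int \<Rightarrow> int \<Rightarrow> int \<Rightarrow> complex mat \<Rightarrow> complex mat" where
  "spin_site m n j A = spin_tensor m n (\<lambda>i. if i = j then A else 1\<^sub>m 2)"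

text \<open>The elements of the algebraic tensor product of the \<open>2 \<times> 2\<close> matrix algebras over \<open>S\<close> are
  the finite sums of elementary tensors (scalars can be absorbed into a factor when \<open>S\<close> is
  nonempty, which is the only case used).\<close>

definition spin_observables :: "int \<Rightarrow> int \<Rightarrow> int set \<Rightarrow> complex mat set" where
  "spin_observables m n S =
     {mat_fsum (spin_dim m n) (\<lambda>k. spin_tensor m n (\<lambda>j. if j \<in> S then M k j else 1\<^sub>m 2)) {..<p}
       | (p :: nat) M. \<forall>k<p. \<forall>j\<in>S. M k j \<in> carrier_mat 2 2}"

definition xy_hamiltonian ::
  "(int \<Rightarrow> real) \<Rightarrow> (int \<Rightarrow> real) \<Rightarrow> int \<Rightarrow> int \<Rightarrow> complex mat" where
  "xy_hamiltonian \<mu> \<nu> m n =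
     - mat_fsum (spin_dim m n)
         (\<lambda>j. complex_of_real (\<mu> j) \<cdot>\<^sub>m
            (spin_site m n j pauli_x * spin_site m n (j + 1) pauli_x
             + spin_site m n j pauli_y * spin_site m n (j + 1) pauli_y)) {m..n - 1}
     - mat_fsum (spin_dim m n)
         (\<lambda>j. complex_of_real (\<nu> j) \<cdot>\<^sub>m spin_site m n j pauli_z) {m..n}"

definition xy_evolution ::
  "(int \<Rightarrow> real) \<Rightarrow> (int \<Rightarrow> real) \<Rightarrow> int \<Rightarrow> int \<Rightarrow> real \<Rightarrow> complex mat \<Rightarrow> complex mat" where
  "xy_evolution \<mu> \<nu> m n t A =
     mat_exp ((\<i> * complex_of_real t) \<cdot>\<^sub>m xy_hamiltonian \<mu> \<nu> m n) * A
     * mat_exp ((- \<i> * complex_of_real t) \<cdot>\<^sub>m xy_hamiltonian \<mu> \<nu> m n)"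

definition site_dist :: "int set \<Rightarrow> int set \<Rightarrow> int" where
  "site_dist S\<^sub>1 S\<^sub>2 = Min {\<bar>n\<^sub>1 - n\<^sub>2\<bar> | n\<^sub>1 n\<^sub>2. n\<^sub>1 \<in> S\<^sub>1 \<and> n\<^sub>2 \<in> S\<^sub>2}"

definition lieb_robinson_bound ::
  "(int \<Rightarrow> real) \<Rightarrow> (int \<Rightarrow> real) \<Rightarrow> real \<Rightarrow> real \<Rightarrow> real \<Rightarrow> bool" where
  "lieb_robinson_bound \<mu> \<nu> C c v \<longleftrightarrow>
     (\<forall>m n S\<^sub>1 S\<^sub>2 A B t.
        m \<le> n \<longrightarrow> S\<^sub>1 \<subseteq> {m..n} \<longrightarrow> S\<^sub>2 \<subseteq> {m..n} \<longrightarrow> S\<^sub>1 \<noteq> {} \<longrightarrow> S\<^sub>2 \<noteq> {} \<longrightarrow> S\<^sub>1 \<inter> S\<^sub>2 = {} \<longrightarrow>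
        A \<in> spin_observables m n S\<^sub>1 \<longrightarrow> B \<in> spin_observables m n S\<^sub>2 \<longrightarrow>
        l2_op_norm (mat_commutator (xy_evolution \<mu> \<nu> m n t A) B)
          \<le> C * l2_op_norm A * l2_op_norm B
              * exp (- c * (real_of_int (site_dist S\<^sub>1 S\<^sub>2) - v * \<bar>t\<bar>)))"

end

theory Submission
  imports "HOL-Analysis.Analysis" "HOL-Real_Asymp.Real_Asymp"
    "HOL-Computational_Algebra.Fundamental_Theorem_Algebra" Defs
begin

text \<open>On the sector with one flipped spin the Hamiltonian acts, up to a constant, as minus the Jacobi matrix \<open>J\<close>
  with off-diagonal entries \<open>2 \<mu>\<^sub>j\<close> and diagonal entries \<open>- 2 \<nu>\<^sub>j\<close>, and the all-up vector is an eigenvector. Hence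
  the commutator of an evolved lowering operator at one end of the chain with a raising operator at the other
  end has the one-particle propagator as a matrix entry, and a Lieb--Robinson bound controls that propagator.
  Taking its Laplace transform at \<open>E - i \<epsilon>\<close> with \<open>\<epsilon> < c v\<close> shows that the Dirichlet polynomial \<open>u\<^sub>L\<close> of a
  chain of length \<open>L\<close> satisfies \<open>\<bar>u\<^sub>L(E - i \<epsilon>)\<bar> \<ge> const * exp (\<epsilon> (L - 1) / v)\<close> for all real \<open>E\<close>.
  As \<open>u\<^sub>L\<close> has only real zeros \<open>x\<^sub>i\<close>, the ratio \<open>\<bar>u\<^sub>L(E - i \<epsilon>) / u\<^sub>L(E)\<bar>\<close> has logarithm
  \<open>\<Sum>\<^sub>i ln (1 + \<epsilon>\<^sup>2 / (E - x\<^sub>i)\<^sup>2) / 2\<close>, whose integral over the real line is \<open>\<pi> \<epsilon> L\<close>.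
  If \<open>\<bar>u\<^sub>L\<bar>\<close> grows subexponentially on sets of measure at least \<open>z\<close>, this forces \<open>v \<ge> z / \<pi>\<close>.

  Such sets are the spectra \<open>{\<bar>D\<^sub>K\<bar> \<le> 2}\<close> of the periodic approximants, where \<open>D\<^sub>K\<close> is the trace of the transfer
  matrix over a period. On them the transfer matrices of the approximant grow only linearly, and by variation of
  constants a matrix exponentially close in the period inherits a bound up to an exponentially large length.
  The same bound for the next approximant gives \<open>\<bar>D\<^sub>K\<^sub>+\<^sub>1\<bar> \<le> 2 + \<tau>\<close> with exponentially small \<open>\<tau>\<close>;
  since \<open>D\<^sub>K\<^sub>+\<^sub>1\<close> has only real zeros, \<open>{2 < \<bar>D\<^sub>K\<^sub>+\<^sub>1\<bar> \<le> 2 + \<tau>}\<close> lies within order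
  \<open>sqrt \<tau>\<close> of the finitely many solutions of \<open>\<bar>D\<^sub>K\<^sub>+\<^sub>1\<bar> = 2\<close>. So the measures of these sets lose only a summable
  amount, which is smaller than the exponential lower bound for the measure of the first one.\<close>

unbundle no vec_syntax

section \<open>Jacobi recursions and transfer matrices\<close>

text \<open>The state at site \<open>k\<close> is \<open>(u\<^sub>k, a\<^sub>k\<^sub>-\<^sub>1 u\<^sub>k\<^sub>-\<^sub>1)\<close>; in this normalisation every step has determinant 1.\<close>

primrec jsol :: "(nat \<Rightarrow> real) \<Rightarrow> (nat \<Rightarrow> real) \<Rightarrow> complex \<Rightarrow> complex \<times> complex \<Rightarrow> nat \<Rightarrow> complex \<times> complex" where
  "jsol a b z v 0 = v"
| "jsol a b z v (Suc k) =
     (((z - of_real (b k)) * fst (jsol a b z v k) - snd (jsol a b z v k)) / of_real (a k),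
      of_real (a k) * fst (jsol a b z v k))"

text \<open>Trace of the transfer matrix over \<open>q\<close> sites, whose columns are the
  solutions started at \<open>(1, 0)\<close> and \<open>(0, 1)\<close>; for coefficients of period
  \<open>q\<close> it is the Floquet discriminant.\<close>

definition jtr :: "(nat \<Rightarrow> real) \<Rightarrow> (nat \<Rightarrow> real) \<Rightarrow> nat \<Rightarrow> complex \<Rightarrow> complex" where
  "jtr a b q z = fst (jsol a b z (1, 0) q) + snd (jsol a b z (0, 1) q)"

definition nrm1 :: "complex \<times> complex \<Rightarrow> real" where
  "nrm1 v = cmod (fst v) + cmod (snd v)"

lemma nrm1_nonneg: "0 \<le> nrm1 v"
  by (simp add: nrm1_def)

text \<open>A single constant \<open>G\<close> serves the limit operator and all its approximants,
  so that they share the growth rate \<open>20 * G\<^sup>2\<close> per site.\<close>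

definition jac_adm :: "real \<Rightarrow> (nat \<Rightarrow> real) \<Rightarrow> (nat \<Rightarrow> real) \<Rightarrow> bool" where
  "jac_adm G a b \<longleftrightarrow> 1 \<le> G \<and> (\<forall>k. 1 / G \<le> a k \<and> a k \<le> G \<and> \<bar>b k\<bar> \<le> G)"

lemma jac_admD:
  assumes "jac_adm G a b"
  shows "1 \<le> G" "0 < a k" "1 / G \<le> a k" "a k \<le> G" "\<bar>b k\<bar> \<le> G" "1 / a k \<le> G"
proof -
  show G: "1 \<le> G" and a: "1 / G \<le> a k" and "a k \<le> G" "\<bar>b k\<bar> \<le> G"
    using assms by (auto simp: jac_adm_def)
  have "0 < 1 / G" using G by simp
  then show "0 < a k" using a by linarith
  then show "1 / a k \<le> G" using a G by (simp add: field_simps)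
qed

lemma jsol_linear:
  "fst (jsol a b z v k) = fst v * fst (jsol a b z (1, 0) k) + snd v * fst (jsol a b z (0, 1) k)"
  "snd (jsol a b z v k) = fst v * snd (jsol a b z (1, 0) k) + snd v * snd (jsol a b z (0, 1) k)"
proof -
  have "fst (jsol a b z v k) = fst v * fst (jsol a b z (1, 0) k) + snd v * fst (jsol a b z (0, 1) k) \<and>
    snd (jsol a b z v k) = fst v * snd (jsol a b z (1, 0) k) + snd v * snd (jsol a b z (0, 1) k)"
  proof (induction k)
    case (Suc k)
    show ?case
      unfolding jsol.simps fst_conv snd_conv Suc[THEN conjunct1] Suc[THEN conjunct2]
      by (simp add: algebra_simps add_divide_distrib diff_divide_distrib)
  qed simp
  then show "fst (jsol a b z v k) = fst v * fst (jsol a b z (1, 0) k) + snd v * fst (jsol a b z (0, 1) k)"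
   "snd (jsol a b z v k) = fst v * snd (jsol a b z (1, 0) k) + snd v * snd (jsol a b z (0, 1) k)"
    by auto
qed

lemma jsol_det:
  assumes "\<And>k. a k \<noteq> 0"
  shows "fst (jsol a b z (1, 0) k) * snd (jsol a b z (0, 1) k)
       - fst (jsol a b z (0, 1) k) * snd (jsol a b z (1, 0) k) = 1"
proof (induction k)
  case (Suc k)
  have "fst (jsol a b z (1, 0) (Suc k)) * snd (jsol a b z (0, 1) (Suc k))
       - fst (jsol a b z (0, 1) (Suc k)) * snd (jsol a b z (1, 0) (Suc k))
     = fst (jsol a b z (1, 0) k) * snd (jsol a b z (0, 1) k)
       - fst (jsol a b z (0, 1) k) * snd (jsol a b z (1, 0) k)"
    using assms[of k] by (simp add: field_simps)
  with Suc show ?case by simp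
qed simp

section \<open>Periodic coefficients: monodromy matrix and discriminant\<close>

definition jac_per :: "nat \<Rightarrow> (nat \<Rightarrow> real) \<Rightarrow> (nat \<Rightarrow> real) \<Rightarrow> bool" where
  "jac_per q a b \<longleftrightarrow> (\<forall>k. a (k + q) = a k \<and> b (k + q) = b k)"

lemma jsol_add:
  assumes "jac_per q a b"
  shows "jsol a b z v (k + q) = jsol a b z (jsol a b z v q) k"
  using assms by (induction k) (simp_all add: jac_per_def)

text \<open>Cayley-Hamilton for the monodromy matrix, which has determinant 1: its square is the
  trace times the matrix minus the identity. \<open>f1\<close> and \<open>f2\<close> are this
  relation in components.\<close>

lemma jsol_period2:
  assumes "\<And>k. a k \<noteq> 0" "jac_per q a b"
  shows "fst (jsol a b z v (k + 2 * q)) = jtr a b q z * fst (jsol a b z v (k + q)) - fst (jsol a b z v k)"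
    "snd (jsol a b z v (k + 2 * q)) = jtr a b q z * snd (jsol a b z v (k + q)) - snd (jsol a b z v k)"
proof -
  let ?J = "jsol a b z"
  define c1 c2 s1 s2 where
    "c1 = fst (?J (1,0) q)" and "c2 = snd (?J (1,0) q)" and
    "s1 = fst (?J (0,1) q)" and "s2 = snd (?J (0,1) q)"
  note d = c1_def c2_def s1_def s2_def
  have det: "c1 * s2 = 1 + s1 * c2"
    using jsol_det[where a = a, OF assms(1), where b = b and z = z and k = q] unfolding d by (simp add: algebra_simps)
  have tr: "jtr a b q z = c1 + s2" by (simp add: jtr_def d)
  have lin: "fst (?J v q) = fst v * c1 + snd v * s1" "snd (?J v q) = fst v * c2 + snd v * s2" for v
    using jsol_linear[of a b z v q] by (simp_all add: d)
  have e1: "?J v (k + q) = ?J (?J v q) k" for v k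
    by (rule jsol_add) (use assms in auto)
  have e2: "?J v (k + 2 * q) = ?J (?J (?J v q) q) k"
    using e1[of v "k + q"] e1[of "?J v q" k] by (simp add: mult_2 add.assoc)
  define w1 w2 where "w1 = fst v" and "w2 = snd v"
  have f1: "fst (?J (?J v q) q) = (c1 + s2) * fst (?J v q) - w1"
  proof -
    have "fst (?J (?J v q) q) = (w1 * c1 + w2 * s1) * c1 + (w1 * c2 + w2 * s2) * s1"
      by (simp add: lin w1_def w2_def)
    also have "\<dots> = (c1 + s2) * (w1 * c1 + w2 * s1) - w1 * (c1 * s2) + w1 * (s1 * c2)"
      by (simp add: algebra_simps)
    also have "\<dots> = (c1 + s2) * (w1 * c1 + w2 * s1) - w1"
      unfolding det by (simp add: algebra_simps)
    finally show ?thesis by (simp add: lin w1_def w2_def)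
  qed
  have f2: "snd (?J (?J v q) q) = (c1 + s2) * snd (?J v q) - w2"
  proof -
    have "snd (?J (?J v q) q) = (w1 * c1 + w2 * s1) * c2 + (w1 * c2 + w2 * s2) * s2"
      by (simp add: lin w1_def w2_def)
    also have "\<dots> = (c1 + s2) * (w1 * c2 + w2 * s2) - w2 * (c1 * s2) + w2 * (s1 * c2)"
      by (simp add: algebra_simps)
    also have "\<dots> = (c1 + s2) * (w1 * c2 + w2 * s2) - w2"
      unfolding det by (simp add: algebra_simps)
    finally show ?thesis by (simp add: lin w1_def w2_def)
  qed
  show "fst (?J v (k + 2 * q)) = jtr a b q z * fst (?J v (k + q)) - fst (?J v k)"
    "snd (?J v (k + 2 * q)) = jtr a b q z * snd (?J v (k + q)) - snd (?J v k)"
    unfolding e1 e2 tr jsol_linear[of a b z _ k, where v = v]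
      jsol_linear[of a b z _ k, where v = "?J v q"] jsol_linear[of a b z _ k, where v = "?J (?J v q) q"]
      f1 f2 w1_def w2_def
    by (simp_all add: algebra_simps)
qed

text \<open>Adding the relations of \<open>jsol_period2\<close> for the two basis solutions gives
  the Chebyshev recursion for the traces of the powers of the monodromy matrix.\<close>

lemma jtr_mult:
  assumes "\<And>k. a k \<noteq> 0" "jac_per q a b"
  shows "jtr a b (Suc (Suc M) * q) z = jtr a b q z * jtr a b (Suc M * q) z - jtr a b (M * q) z"
proof -
  have idx: "Suc (Suc M) * q = M * q + 2 * q" "Suc M * q = M * q + q" by simp_all
  have eq: "x2 + y2 = D * (x1 + y1) - (x0 + y0)" if "x2 = D * x1 - x0" "y2 = D * y1 - y0"
    for x0 x1 x2 y0 y1 y2 D :: complex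
    using that by (simp add: algebra_simps)
  show ?thesis
    unfolding idx jtr_def[of a b "M * q + 2 * q"] jtr_def[of a b "M * q + q"] jtr_def[of a b "M * q"]
    by (rule eq) (rule jsol_period2[where a = a, OF assms])+
qed

lemma Im_jtr_real: "Im (jtr a b q (of_real E)) = 0"
proof -
  have "Im (fst (jsol a b (of_real E) (of_real x, of_real y) k)) = 0 \<and>
        Im (snd (jsol a b (of_real E) (of_real x, of_real y) k)) = 0" for k x y
    by (induction k) (simp_all)
  from this[of 1 0 q] this[of 0 1 q] show ?thesis by (simp add: jtr_def)
qed

section \<open>Growth and perturbation of solutions\<close>

text \<open>The radius \<open>3 * G + 1\<close> leaves a margin of 1 around the zeros of the
  discriminant, which satisfy \<open>cmod z \<le> 3 * G\<close> by \<open>jtr_root_bound\<close>.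
  The constant 20 is generous.\<close>

lemma nrm1_step:
  assumes adm: "jac_adm G a b" and z: "cmod z \<le> 3 * G + 1"
  shows "nrm1 (jsol a b z v (Suc k)) \<le> 20 * G\<^sup>2 * nrm1 (jsol a b z v k)"
proof -
  define x y where "x = fst (jsol a b z v k)" and "y = snd (jsol a b z v k)"
  note J = jac_admD(1)[OF adm] jac_admD(2-6)[OF adm, of k]
  have zb: "cmod (z - b k) \<le> 5 * G"
    using norm_triangle_ineq4[of z "of_real (b k)"] z J by simp
  have ia: "1 / a k \<le> G" by fact
  have "cmod (((z - b k) * x - y) / a k) = cmod ((z - b k) * x - y) * (1 / a k)"
    using J by (simp add: norm_divide)
  also have "\<dots> \<le> (5 * G * cmod x + cmod y) * G"
    using norm_triangle_ineq4[of "(z - b k) * x" y] mult_right_mono[OF zb, of "cmod x"] J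
    by (intro mult_mono) (auto simp: norm_mult)
  finally have 1: "cmod (((z - b k) * x - y) / a k) \<le> 5 * (G * G) * cmod x + G * cmod y"
    by (simp add: algebra_simps)
  have 2: "cmod (a k * x) \<le> G * cmod x"
    using J by (simp add: norm_mult mult_right_mono)
  have GG: "G \<le> G * G" using J by simp
  have "G * cmod x \<le> (G * G) * cmod x" "G * cmod y \<le> (G * G) * cmod y"
    by (intro mult_right_mono GG norm_ge_zero)+
  moreover have "0 \<le> (G * G) * cmod x" "0 \<le> (G * G) * cmod y" by auto
  ultimately have "cmod (((z - b k) * x - y) / a k) + cmod (a k * x) \<le> 20 * (G * G) * (cmod x + cmod y)"
    using 1 2 unfolding distrib_left by linarith
  then show ?thesis by (simp add: nrm1_def x_def y_def power2_eq_square)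
qed

lemma twenty_le_step_bound: "1 \<le> G \<Longrightarrow> 20 \<le> 20 * G\<^sup>2" for G :: real
  using one_le_power[of G 2] by simp

lemma nrm1_pow:
  assumes adm: "jac_adm G a b" and z: "cmod z \<le> 3 * G + 1"
  shows "nrm1 (jsol a b z v k) \<le> (20 * G\<^sup>2) ^ k * nrm1 v"
proof (induction k)
  case (Suc k)
  have "nrm1 (jsol a b z v (Suc k)) \<le> 20 * G\<^sup>2 * nrm1 (jsol a b z v k)"
    by (rule nrm1_step[OF adm z])
  also have "\<dots> \<le> 20 * G\<^sup>2 * ((20 * G\<^sup>2) ^ k * nrm1 v)"
    by (intro mult_left_mono Suc) simp
  finally show ?case by (simp add: mult_ac)
qed simp

text \<open>With \<open>\<lambda>\<close> a root of \<open>\<lambda>\<^sup>2 - D \<lambda> + 1\<close>, the differences \<open>X (n + 1) - \<lambda> X n\<close> have constant modulus.\<close>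

lemma elliptic_recurrence_bound:
  fixes X :: "nat \<Rightarrow> complex" and D :: real
  assumes D: "\<bar>D\<bar> \<le> 2" and rec: "\<And>n. X (Suc (Suc n)) = of_real D * X (Suc n) - X n"
  shows "cmod (X n) \<le> cmod (X 0) + n * (cmod (X 1) + cmod (X 0))"
proof -
  \<comment> \<open>The roots are \<open>l\<close> and \<open>cnj l\<close>; they lie on the unit
    circle because \<open>\<bar>D\<bar> \<le> 2\<close>. A double root, at
    \<open>\<bar>D\<bar> = 2\<close>, needs no separate treatment.\<close>
  define s where "s = sqrt (1 - (D/2)\<^sup>2)"
  define l where "l = Complex (D/2) s"
  have D2: "(D/2)\<^sup>2 \<le> 1" using D by (simp add: abs_square_le_1)
  then have s2: "s\<^sup>2 = 1 - (D/2)\<^sup>2" by (simp add: s_def)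
  have nl: "cmod l = 1"
    using s2 by (simp add: l_def cmod_def)
  have sum: "of_real D = l + cnj l" by (simp add: l_def complex_eq_iff)
  have prod: "l * cnj l = 1" using nl by (metis complex_norm_square mult_1_left of_real_1 power_one)
  define Y where "Y n = X (Suc n) - l * X n" for n
  have "Y (Suc n) = cnj l * Y n" for n
  proof -
    have "Y (Suc n) = (l + cnj l) * X (Suc n) - (l * cnj l) * X n - l * X (Suc n)"
      unfolding Y_def rec sum prod by simp
    also have "\<dots> = cnj l * Y n" by (simp add: Y_def algebra_simps)
    finally show ?thesis .
  qed
  then have "cmod (Y n) = cmod (Y 0)" for n
    by (induction n) (simp_all add: norm_mult nl)
  moreover have "cmod (Y 0) \<le> cmod (X 1) + cmod (X 0)"
    using norm_triangle_ineq4[of "X 1" "l * X 0"] by (simp add: Y_def norm_mult nl)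
  ultimately have Y: "cmod (Y n) \<le> cmod (X 1) + cmod (X 0)" for n by metis
  show ?thesis
  proof (induction n)
    case (Suc n)
    have "X (Suc n) = Y n + l * X n" by (simp add: Y_def)
    then have "cmod (X (Suc n)) \<le> cmod (Y n) + cmod (X n)"
      using norm_triangle_ineq[of "Y n" "l * X n"] by (simp add: norm_mult nl)
    then show ?case using Y[of n] Suc by (simp add: algebra_simps)
  qed simp
qed

text \<open>Along \<open>k = r + M * q\<close> with fixed remainder \<open>r\<close> both components
  satisfy the scalar recursion with coefficient \<open>D'\<close>, hence grow linearly in
  \<open>M\<close>. The power \<open>2 * q\<close> is the crude bound for the starting values in the
  first two periods.\<close>

lemma elliptic_growth:
  assumes adm: "jac_adm G a b" and E: "\<bar>E\<bar> \<le> 3 * G + 1" and q: "0 < q"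
    and per: "jac_per q a b"
    and D: "cmod (jtr a b q (of_real E)) \<le> 2" and k: "k \<le> L"
  shows "nrm1 (jsol a b (of_real E) v k) \<le> (20 * G\<^sup>2) ^ (2 * q) * (1 + 2 * real L) * nrm1 v"
proof -
  define A where "A = 20 * G\<^sup>2"
  let ?J = "jsol a b (of_real E) v"
  note J = jac_admD[OF adm]
  have A1: "1 \<le> A" using twenty_le_step_bound[OF J(1)] by (simp add: A_def)
  define r M where "r = k mod q" and "M = k div q"
  have k_eq: "k = r + M * q" by (simp add: r_def M_def)
  have rq: "r < q" using q by (simp add: r_def)
  have MleL: "M \<le> L" using k div_le_dividend[of k q] unfolding M_def by linarith
  have nz: "\<And>k. a k \<noteq> 0" using J(2) by (metis less_irrefl)
  define D' where "D' = Re (jtr a b q (of_real E))"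
  have D'_eq: "jtr a b q (of_real E) = of_real D'"
    using Im_jtr_real[of a b q E] by (simp add: D'_def complex_eq_iff)
  have D': "\<bar>D'\<bar> \<le> 2" using D unfolding D'_eq by simp
  have idx: "r + Suc (Suc n) * q = (r + n * q) + 2 * q" "r + Suc n * q = (r + n * q) + q" for n
    by simp_all
  have rec: "fst (?J (r + Suc (Suc n) * q)) = D' * fst (?J (r + Suc n * q)) - fst (?J (r + n * q))"
    "snd (?J (r + Suc (Suc n) * q)) = D' * snd (?J (r + Suc n * q)) - snd (?J (r + n * q))" for n
    using jsol_period2[where a = a and b = b and z = "of_real E" and v = v and k = "r + n * q", OF nz per]
    unfolding idx(1) idx(2)[of n] D'_eq by simp_all
  note 1 = elliptic_recurrence_bound[OF D', of "\<lambda>n. fst (?J (r + n * q))", OF rec(1), of M]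
  note 2 = elliptic_recurrence_bound[OF D', of "\<lambda>n. snd (?J (r + n * q))", OF rec(2), of M]
  have "nrm1 (?J k) \<le> nrm1 (?J r) + M * (nrm1 (?J (r + q)) + nrm1 (?J r))"
    using 1 2 unfolding nrm1_def k_eq by (simp add: algebra_simps)
  moreover have B: "nrm1 (?J i) \<le> A ^ (2 * q) * nrm1 v" if "i \<le> 2 * q" for i
  proof -
    have "nrm1 (?J i) \<le> A ^ i * nrm1 v"
      unfolding A_def by (rule nrm1_pow[OF adm]) (use E in simp)
    also have "\<dots> \<le> A ^ (2 * q) * nrm1 v"
      by (intro mult_right_mono power_increasing that A1 nrm1_nonneg)
    finally show ?thesis .
  qed
  moreover have "real M * (nrm1 (?J (r + q)) + nrm1 (?J r)) \<le> L * (2 * (A ^ (2 * q) * nrm1 v))"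
    using B[of r] B[of "r + q"] rq MleL nrm1_nonneg by (intro mult_mono add_nonneg_nonneg) auto
  ultimately have "nrm1 (?J k) \<le> A ^ (2 * q) * nrm1 v + L * (2 * (A ^ (2 * q) * nrm1 v))"
    using B[of r] rq by linarith
  then show ?thesis by (simp add: A_def algebra_simps)
qed

text \<open>The quantities \<open>Q\<close> are the coefficients in variation of constants, constant if the two recursions agree.\<close>

lemma perturbed_wronskian:
  fixes v w :: "complex \<times> complex"
  assumes adm: "jac_adm G a b" and adm': "jac_adm G a' b'" and z: "cmod z \<le> 3 * G + 1"
    and d: "\<bar>a k - a' k\<bar> \<le> d" "\<bar>b k - b' k\<bar> \<le> d"
  defines "Q \<equiv> \<lambda>k. fst (jsol a' b' z v k) * snd (jsol a b z w k) - snd (jsol a' b' z v k) * fst (jsol a b z w k)"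
  shows "cmod (Q (Suc k)) \<le> cmod (Q k) + 20 * G\<^sup>2 * d * nrm1 (jsol a' b' z v k) * nrm1 (jsol a b z w k)"
proof -
  note J = jac_admD(1)[OF adm] jac_admD(2-6)[OF adm, of k] and J' = jac_admD(1)[OF adm'] jac_admD(2-6)[OF adm', of k]
  define x y where "x = fst (jsol a' b' z v k)" and "y = snd (jsol a' b' z v k)"
  define X Y where "X = fst (jsol a b z w k)" and "Y = snd (jsol a b z w k)"
  define al al' be be' where "al = complex_of_real (a k)" and "al' = complex_of_real (a' k)"
    and "be = complex_of_real (b k)" and "be' = complex_of_real (b' k)"
  have nz: "al \<noteq> 0" "al' \<noteq> 0" using J(2) J'(2) by (auto simp: al_def al'_def)
  \<comment> \<open>The increment of \<open>Q\<close> is a bilinear form in the two states; these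
    are its coefficients, and they vanish when the two pairs of Jacobi coefficients agree at
    \<open>k\<close>.\<close>
  define c1 c2 c3 where "c1 = (z - be') * (al / al' - al' / al) + (be - be') * (al' / al)"
    and "c2 = al / al' - 1" and "c3 = al' / al - 1"
  have eq: "Q (Suc k) - Q k = x * X * c1 - y * X * c2 + x * Y * c3"
    using nz by (simp add: Q_def x_def[symmetric] y_def[symmetric] X_def[symmetric] Y_def[symmetric]
       al_def[symmetric] al'_def[symmetric] be_def[symmetric] be'_def[symmetric] c1_def c2_def c3_def field_simps)
  have d0: "0 \<le> d" using d by linarith
  have c2: "cmod c2 \<le> d * G"
  proof -
    have "c2 = of_real ((a k - a' k) * (1 / a' k))" using J'(2) by (simp add: c2_def al_def al'_def field_simps)
    then have "cmod c2 = \<bar>a k - a' k\<bar> * (1 / a' k)" using J'(2) by (simp only: norm_of_real abs_mult) simp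
    also have "\<dots> \<le> d * G" using d d0 J' by (intro mult_mono) auto
    finally show ?thesis .
  qed
  have c3: "cmod c3 \<le> d * G"
  proof -
    have "c3 = of_real ((a' k - a k) * (1 / a k))" using J(2) by (simp add: c3_def al_def al'_def field_simps)
    then have "cmod c3 = \<bar>a k - a' k\<bar> * (1 / a k)" using J(2) by (simp only: norm_of_real abs_mult) (simp add: abs_minus_commute)
    also have "\<dots> \<le> d * G" using d d0 J by (intro mult_mono) auto
    finally show ?thesis .
  qed
  have zb: "cmod (z - be') \<le> 5 * G"
    using norm_triangle_ineq4[of z "of_real (b' k)"] z J'(1,5) by (simp add: be'_def)
  have "cmod c1 \<le> cmod (z - be') * cmod (al / al' - al' / al) + cmod (be - be') * cmod (al' / al)"
    unfolding c1_def by (rule order_trans[OF norm_triangle_ineq]) (simp add: norm_mult norm_divide)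
  also have "\<dots> \<le> 5 * G * (2 * (d * G)) + d * (G * G)"
  proof (intro add_mono mult_mono zb)
    have "al / al' - al' / al = c2 - c3" by (simp add: c2_def c3_def)
    then show "cmod (al / al' - al' / al) \<le> 2 * (d * G)"
      using norm_triangle_ineq4[of c2 c3] c2 c3 by simp
    show "cmod (be - be') \<le> d" using d(2) by (simp add: be_def be'_def flip: of_real_diff)
    have "cmod (al' / al) = a' k * (1 / a k)" using J(2) J'(2) by (simp add: al_def al'_def norm_divide)
    also have "\<dots> \<le> G * G" using J J' by (intro mult_mono) auto
    finally show "cmod (al' / al) \<le> G * G" .
  qed (use d0 J(1) in auto)
  also have "\<dots> = 11 * (G * G * d)" by (simp add: algebra_simps)
  finally have c1: "cmod c1 \<le> 11 * (G * G * d)" .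
  have "d * G \<le> d * (G * G)" using J(1) d0 by (intro mult_left_mono) auto
  then have c23: "cmod c2 \<le> 11 * (G * G * d)" "cmod c3 \<le> 11 * (G * G * d)"
    using c2 c3 J(1) d0 by (auto simp: mult_ac intro: order_trans[of _ "d * G"])
  let ?c = "11 * (G * G * d)"
  have "cmod (Q (Suc k) - Q k) \<le> cmod (x * X) * cmod c1 + cmod (y * X) * cmod c2 + cmod (x * Y) * cmod c3"
    unfolding eq using norm_triangle_ineq[of "x * X * c1 - y * X * c2" "x * Y * c3"]
      norm_triangle_ineq4[of "x * X * c1" "y * X * c2"] by (simp add: norm_mult)
  also have "\<dots> \<le> cmod (x * X) * ?c + cmod (y * X) * ?c + cmod (x * Y) * ?c"
    by (intro add_mono mult_left_mono c1 c23 norm_ge_zero)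
  also have "\<dots> \<le> ?c * ((cmod x + cmod y) * (cmod X + cmod Y))"
  proof -
    have "0 \<le> ?c * (cmod y * cmod Y)" using d0 J(1) by simp
    then show ?thesis unfolding norm_mult distrib_left distrib_right by (simp add: mult_ac)
  qed
  also have "\<dots> \<le> 20 * G\<^sup>2 * d * nrm1 (jsol a' b' z v k) * nrm1 (jsol a b z w k)"
  proof -
    have "11 * (G * G * d) * ((cmod x + cmod y) * (cmod X + cmod Y))
        \<le> 20 * (G * G * d) * ((cmod x + cmod y) * (cmod X + cmod Y))"
      using d0 J(1) by (intro mult_right_mono) auto
    then show ?thesis
      unfolding nrm1_def x_def[symmetric] y_def[symmetric] X_def[symmetric] Y_def[symmetric] power2_eq_square
      by (simp only: mult_ac)
  qed
  finally show ?thesis using norm_triangle_ineq2[of "Q (Suc k)" "Q k"] by linarith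
qed

text \<open>A discrete Gronwall argument: the coefficients of the perturbed solution in the
  unperturbed basis grow by a factor of at most \<open>1 + e\<close> per step, and
  \<open>small\<close> says \<open>L * e \<le> 1\<close>, so the total factor is at most
  \<open>exp 1 \<le> 3\<close>.\<close>

lemma jsol_perturb:
  assumes adm: "jac_adm G a b" and adm': "jac_adm G a' b'" and z: "cmod z \<le> 3 * G + 1"
    and d: "\<And>k. \<bar>a k - a' k\<bar> \<le> d" "\<And>k. \<bar>b k - b' k\<bar> \<le> d"
    and B: "\<And>k. k \<le> L \<Longrightarrow> nrm1 (jsol a b z (1, 0) k) \<le> B"
       "\<And>k. k \<le> L \<Longrightarrow> nrm1 (jsol a b z (0, 1) k) \<le> B"
    and small: "2 * (20 * G\<^sup>2) * d * B\<^sup>2 * L \<le> 1" and k: "k \<le> L"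
  shows "nrm1 (jsol a' b' z v k) \<le> 3 * B * nrm1 v"
proof -
  define e where "e = 2 * (20 * G\<^sup>2) * d * B\<^sup>2"
  have d0: "0 \<le> d" using d(1)[of 0] by linarith
  have B0: "0 \<le> B" using B(1)[of 0] nrm1_nonneg order_trans by blast
  have e0: "0 \<le> e" using d0 by (simp add: e_def)
  let ?P = "jsol a' b' z v" and ?c = "jsol a b z (1,0)" and ?s = "jsol a b z (0,1)"
  define al where "al k = fst (?P k) * snd (?s k) - snd (?P k) * fst (?s k)" for k
  define be where "be k = fst (?P k) * snd (?c k) - snd (?P k) * fst (?c k)" for k
  have nz: "\<And>k. a k \<noteq> 0" using jac_admD(2)[OF adm] by (metis less_irrefl)
  have P: "nrm1 (?P k) \<le> (cmod (al k) + cmod (be k)) * B" if "k \<le> L" for k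
  proof -
    note det = jsol_det[where a = a, OF nz, where b = b and z = z and k = k]
    \<comment> \<open>Cramer's rule: as the basis has determinant 1, \<open>al\<close> and
      \<open>- be\<close> are the coordinates of the perturbed solution.\<close>
    have f: "al k * fst (?c k) - be k * fst (?s k) = fst (?P k) * (fst (?c k) * snd (?s k) - fst (?s k) * snd (?c k))"
      "al k * snd (?c k) - be k * snd (?s k) = snd (?P k) * (fst (?c k) * snd (?s k) - fst (?s k) * snd (?c k))"
      by (simp_all add: al_def be_def algebra_simps)
    have f1: "fst (?P k) = al k * fst (?c k) - be k * fst (?s k)"
      and f2: "snd (?P k) = al k * snd (?c k) - be k * snd (?s k)"
      using f unfolding det by simp_all
    have "nrm1 (?P k) \<le> cmod (al k) * nrm1 (?c k) + cmod (be k) * nrm1 (?s k)"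
      unfolding nrm1_def f1 f2
      using norm_triangle_ineq4[of "al k * fst (?c k)" "be k * fst (?s k)"]
        norm_triangle_ineq4[of "al k * snd (?c k)" "be k * snd (?s k)"]
      by (simp add: norm_mult distrib_left)
    also have "\<dots> \<le> cmod (al k) * B + cmod (be k) * B"
      by (intro add_mono mult_left_mono B that norm_ge_zero)
    finally show ?thesis by (simp add: algebra_simps)
  qed
  have step: "cmod (al (Suc k)) + cmod (be (Suc k)) \<le> (1 + e) * (cmod (al k) + cmod (be k))" if "k \<le> L" for k
  proof -
    let ?N = "20 * G\<^sup>2 * d * nrm1 (?P k)"
    have N0: "0 \<le> ?N" using d0 nrm1_nonneg by simp
    have "cmod (al (Suc k)) \<le> cmod (al k) + ?N * nrm1 (?s k)"
      unfolding al_def by (rule perturbed_wronskian[OF adm adm' z d])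
    moreover have "cmod (be (Suc k)) \<le> cmod (be k) + ?N * nrm1 (?c k)"
      unfolding be_def by (rule perturbed_wronskian[OF adm adm' z d])
    moreover have "?N * nrm1 (?s k) \<le> ?N * B" "?N * nrm1 (?c k) \<le> ?N * B"
      by (intro mult_left_mono B that N0)+
    moreover have "2 * (?N * B) \<le> e * (cmod (al k) + cmod (be k))"
    proof -
      have "2 * (?N * B) = 2 * (20 * G\<^sup>2 * d) * B * nrm1 (?P k)" by simp
      also have "\<dots> \<le> 2 * (20 * G\<^sup>2 * d) * B * ((cmod (al k) + cmod (be k)) * B)"
        using d0 B0 by (intro mult_left_mono P that) auto
      also have "\<dots> = e * (cmod (al k) + cmod (be k))" by (simp add: e_def power2_eq_square algebra_simps)
      finally show ?thesis .
    qed
    ultimately show ?thesis by (simp add: algebra_simps)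
  qed
  have S: "cmod (al k) + cmod (be k) \<le> (1 + e) ^ k * nrm1 v" if "k \<le> L" for k
    using that
  proof (induction k)
    case 0
    show ?case by (simp add: al_def be_def nrm1_def)
  next
    case (Suc k)
    have "cmod (al (Suc k)) + cmod (be (Suc k)) \<le> (1 + e) * (cmod (al k) + cmod (be k))"
      using Suc.prems by (intro step) auto
    also have "\<dots> \<le> (1 + e) * ((1 + e) ^ k * nrm1 v)"
      using Suc e0 by (intro mult_left_mono Suc.IH) auto
    finally show ?case by (simp add: mult_ac)
  qed
  have "(1 + e) ^ k \<le> exp e ^ k" using e0 by (intro power_mono) auto
  also have "\<dots> = exp (k * e)" by (simp add: exp_of_nat_mult)
  also have "\<dots> \<le> exp 1"
  proof -
    have "k * e \<le> L * e" using k e0 by (intro mult_right_mono) auto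
    also have "\<dots> \<le> 1" using small by (simp add: e_def mult_ac)
    finally show ?thesis by simp
  qed
  also have "\<dots> \<le> 3" by (rule exp_le)
  finally have "(1 + e) ^ k \<le> 3" .
  have "nrm1 (?P k) \<le> (cmod (al k) + cmod (be k)) * B" by (rule P[OF k])
  also have "\<dots> \<le> ((1 + e) ^ k * nrm1 v) * B" by (intro mult_right_mono S k B0)
  also have "\<dots> \<le> (3 * nrm1 v) * B"
    by (intro mult_right_mono B0 nrm1_nonneg \<open>(1 + e) ^ k \<le> 3\<close>)
  finally show ?thesis by (simp add: mult_ac)
qed

section \<open>Reality and location of the zeros\<close>

text \<open>Lagrange's identity for a solution and its complex conjugate. Whenever the two boundary
  terms agree, the positive sum forces \<open>Im z = 0\<close>; this covers zeros of Dirichlet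
  solutions and of the discriminant.\<close>

lemma Im_jsol_Wronskian:
  "Im (cnj (fst (jsol a b z v k)) * snd (jsol a b z v k))
     = Im (cnj (fst v) * snd v) - Im z * (\<Sum>i<k. (cmod (fst (jsol a b z v i)))\<^sup>2)"
  if nz: "\<And>k. a k \<noteq> 0"
proof (induction k)
  case (Suc k)
  define x y where "x = fst (jsol a b z v k)" and "y = snd (jsol a b z v k)"
  have "cnj ((z - b k) * x - y) * x = (cnj z - b k) * (x * cnj x) - cnj y * x"
    by (simp add: algebra_simps)
  also have "x * cnj x = of_real ((cmod x)\<^sup>2)" by (simp only: complex_norm_square)
  finally have e: "cnj ((z - b k) * x - y) * x = (cnj z - b k) * of_real ((cmod x)\<^sup>2) - cnj y * x" .
  have "cnj (fst (jsol a b z v (Suc k))) * snd (jsol a b z v (Suc k)) = cnj ((z - b k) * x - y) * x"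
    unfolding jsol.simps fst_conv snd_conv x_def[symmetric] y_def[symmetric] using nz[of k] by simp
  then have "Im (cnj (fst (jsol a b z v (Suc k))) * snd (jsol a b z v (Suc k)))
      = Im ((cnj z - b k) * of_real ((cmod x)\<^sup>2) - cnj y * x)"
    unfolding e by (rule arg_cong)
  also have "\<dots> = Im (cnj x * y) - Im z * (cmod x)\<^sup>2" by (simp add: algebra_simps)
  also have "Im (cnj x * y) = Im (cnj (fst v) * snd v) - Im z * (\<Sum>i<k. (cmod (fst (jsol a b z v i)))\<^sup>2)"
    using Suc unfolding x_def y_def .
  finally show ?case by (simp add: x_def algebra_simps)
qed simp

lemma sum_jsol_pos:
  assumes "0 < k"
  shows "0 < (\<Sum>i<k. (cmod (fst (jsol a b z (1, 0) i)))\<^sup>2)"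
proof -
  have "(cmod (fst (jsol a b z (1, 0) 0)))\<^sup>2 \<le> (\<Sum>i<k. (cmod (fst (jsol a b z (1, 0) i)))\<^sup>2)"
    using assms by (intro member_le_sum) auto
  then show ?thesis by simp
qed

lemma dirichlet_root_real:
  assumes "\<And>k. a k \<noteq> 0" "0 < L" "fst (jsol a b z (1, 0) L) = 0"
  shows "Im z = 0"
  using Im_jsol_Wronskian[where a = a and b = b and z = z and v = "(1, 0)" and k = L, OF assms(1)]
    sum_jsol_pos[OF assms(2), of a b z] assms(3) by auto

text \<open>A matrix of trace 0 and determinant 1 squares to minus the identity, so solutions change
  sign over two periods.\<close>

lemma jtr_root_period2:
  assumes "\<And>k. a k \<noteq> 0" "jac_per q a b" "jtr a b q z = 0"
  shows "jsol a b z v (k + 2 * q) = - jsol a b z v k"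
  using jsol_period2[where a = a and b = b and q = q and z = z and v = v and k = k, OF assms(1,2)] assms(3)
  by (simp add: prod_eq_iff)

lemma jtr_root_real:
  assumes "\<And>k. a k \<noteq> 0" "jac_per q a b" "0 < q" "jtr a b q z = 0"
  shows "Im z = 0"
proof -
  have "jsol a b z (1, 0) (2 * q) = - (1, 0)"
    using jtr_root_period2[where a = a and k = 0, OF assms(1,2,4)] by simp
  then show ?thesis
    using Im_jsol_Wronskian[where a = a and b = b and z = z and v = "(1, 0)" and k = "2 * q", OF assms(1)]
      sum_jsol_pos[of "2 * q" a b z] assms(3) by auto
qed

text \<open>A Gershgorin argument: the modulus of a solution has period \<open>2 * q\<close>, so it
  attains a maximum, and the three-term recursion at the maximising site gives
  \<open>cmod (z - b k) \<le> 2 * G\<close>.\<close>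

lemma jtr_root_bound:
  assumes adm: "jac_adm G a b" and per: "jac_per q a b" and q: "0 < q" and z: "jtr a b q z = 0"
  shows "cmod z \<le> 3 * G"
proof -
  have nz: "\<And>k. a k \<noteq> 0" using jac_admD(2)[OF adm] by (metis less_irrefl)
  let ?x = "\<lambda>k. fst (jsol a b z (1, 0) k)"
  have p: "cmod (?x (k + 2 * q)) = cmod (?x k)" for k
    using jtr_root_period2[where a = a and v = "(1,0)" and k = k, OF nz per z] by simp
  define m where "m = Max ((\<lambda>k. cmod (?x k)) ` {1..2 * q})"
  have "m \<in> (\<lambda>k. cmod (?x k)) ` {1..2 * q}" unfolding m_def using q by (intro Max_in) auto
  then obtain k where k: "1 \<le> k" "k \<le> 2 * q" "cmod (?x k) = m" by auto
  \<comment> \<open>The range up to \<open>2 * q + 1\<close> includes both neighbours of the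
    maximising site, which lies between 1 and \<open>2 * q\<close>.\<close>
  have le: "cmod (?x i) \<le> m" if "i \<le> 2 * q + 1" for i
  proof -
    have "i = 0 \<or> (1 \<le> i \<and> i \<le> 2 * q) \<or> i = 1 + 2 * q" using that by linarith
    then consider "i = 0" | "1 \<le> i" "i \<le> 2 * q" | "i = 1 + 2 * q" by blast
    then have "\<exists>j\<in>{1..2 * q}. cmod (?x i) = cmod (?x j)"
    proof cases
      case 1
      then show ?thesis using p[of 0] q by (intro bexI[of _ "2 * q"]) auto
    next
      case 3
      then show ?thesis using p[of 1] q by (intro bexI[of _ 1]) auto
    qed auto
    then show ?thesis unfolding m_def by (auto intro!: Max_ge)
  qed
  have m: "0 < m" using le[of 0] by simp
  obtain j where j: "k = Suc j" using k(1) by (cases k) auto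
  have "a k * ?x (Suc k) = (z - b k) * ?x k - a j * ?x j"
    using nz[of k] nz[of j] unfolding j by simp
  then have "(z - b k) * ?x k = a k * ?x (Suc k) + a j * ?x j" by simp
  then have "cmod (z - b k) * m \<le> a k * cmod (?x (Suc k)) + a j * cmod (?x j)"
    using norm_triangle_ineq[of "a k * ?x (Suc k)" "a j * ?x j"] k(3) jac_admD(2)[OF adm]
    by (metis abs_of_pos norm_mult norm_of_real)
  also have "\<dots> \<le> G * m + G * m"
    using k(2) j jac_admD(1)[OF adm] by (intro add_mono mult_mono jac_admD(4)[OF adm] le) simp_all
  finally have "cmod (z - b k) * m \<le> (2 * G) * m" by simp
  then have "cmod (z - b k) \<le> 2 * G" using m by simp
  then show ?thesis
    using norm_triangle_ineq2[of z "of_real (b k)"] jac_admD(5)[OF adm, of k] by simp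
qed

section \<open>Polynomial dependence on the energy\<close>

lemma degree_step:
  fixes p r :: "complex poly"
  assumes "c \<noteq> 0" "degree p = k" "p \<noteq> 0" "degree r \<le> k"
  shows "degree (Polynomial.smult c ([:- e, 1:] * p - r)) = Suc k" "Polynomial.smult c ([:- e, 1:] * p - r) \<noteq> 0"
proof -
  have "degree ([:- e, 1:] * p) = Suc k"
    using assms by (subst degree_mult_eq) auto
  then have "degree ([:- e, 1:] * p + - r) = Suc k"
    using assms by (subst degree_add_eq_left) auto
  then show 1: "degree (Polynomial.smult c ([:- e, 1:] * p - r)) = Suc k"
    using assms by simp
  then show "Polynomial.smult c ([:- e, 1:] * p - r) \<noteq> 0" by (metis degree_0 nat.distinct(1))
qed

lemma jsol_poly_cos:
  assumes "\<And>k. a k \<noteq> 0"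
  shows "\<exists>p r. (\<forall>z. poly p z = fst (jsol a b z (1, 0) k) \<and> poly r z = snd (jsol a b z (1, 0) k))
     \<and> degree p = k \<and> p \<noteq> 0 \<and> degree r \<le> k \<and> (0 < k \<longrightarrow> degree r < k)"
proof (induction k)
  case 0
  show ?case by (intro exI[of _ 1] exI[of _ 0]) auto
next
  case (Suc k)
  then obtain p r where pr: "\<And>z. poly p z = fst (jsol a b z (1, 0) k)"
     "\<And>z. poly r z = snd (jsol a b z (1, 0) k)" "degree p = k" "p \<noteq> 0" "degree r \<le> k" by auto
  define p' where "p' = Polynomial.smult (1 / of_real (a k)) ([:- of_real (b k), 1:] * p - r)"
  have c: "1 / complex_of_real (a k) \<noteq> 0" using assms[of k] by simp
  have "degree p' = Suc k" "p' \<noteq> 0"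
    unfolding p'_def using degree_step[OF c pr(3,4,5)] by auto
  moreover have "degree (Polynomial.smult (of_real (a k)) p) \<le> k" using pr by (intro order_trans[OF degree_smult_le]) auto
  moreover have "poly p' z = fst (jsol a b z (1, 0) (Suc k))" for z
    by (simp add: p'_def pr left_diff_distrib)
  ultimately show ?case
    by (intro exI[of _ p'] exI[of _ "Polynomial.smult (of_real (a k)) p"]) (auto simp: pr less_Suc_eq_le)
qed

text \<open>Starting from \<open>(0, 1)\<close> costs one degree, so in the trace this solution
  cannot cancel the leading term of the one started at \<open>(1, 0)\<close>.\<close>

lemma jsol_poly_sin:
  "\<exists>p r. (\<forall>z. poly p z = fst (jsol a b z (0, 1) (Suc k)) \<and> poly r z = snd (jsol a b z (0, 1) (Suc k)))
     \<and> degree p \<le> k \<and> degree r \<le> k"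
proof (induction k)
  case 0
  show ?case by (intro exI[of _ "[:- 1 / of_real (a 0):]"] exI[of _ 0]) auto
next
  case (Suc k)
  then obtain p r where pr: "\<And>z. poly p z = fst (jsol a b z (0, 1) (Suc k))"
     "\<And>z. poly r z = snd (jsol a b z (0, 1) (Suc k))" "degree p \<le> k" "degree r \<le> k" by auto
  define p' where "p' = Polynomial.smult (1 / of_real (a (Suc k))) ([:- of_real (b (Suc k)), 1:] * p - r)"
  have "degree ([:- complex_of_real (b (Suc k)), 1:] * p) \<le> Suc k"
    using pr by (intro order_trans[OF degree_mult_le]) auto
  then have "degree p' \<le> Suc k"
    unfolding p'_def using pr by (intro order_trans[OF degree_smult_le] degree_diff_le) auto
  moreover have "degree (Polynomial.smult (of_real (a (Suc k))) p) \<le> Suc k"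
    using pr by (intro order_trans[OF degree_smult_le]) auto
  moreover have "poly p' z = fst (jsol a b z (0, 1) (Suc (Suc k)))" for z
    unfolding jsol.simps(2)[of a b z _ "Suc k"] fst_conv p'_def poly_smult poly_diff poly_mult pr by simp
  moreover have "poly (Polynomial.smult (of_real (a (Suc k))) p) z = snd (jsol a b z (0, 1) (Suc (Suc k)))" for z
    unfolding jsol.simps(2)[of a b z _ "Suc k"] snd_conv poly_smult pr(1) ..
  ultimately show ?case
    by (intro exI[of _ p'] exI[of _ "Polynomial.smult (of_real (a (Suc k))) p"]) blast
qed

lemma jtr_poly:
  assumes "\<And>k. a k \<noteq> 0" "0 < q"
  obtains p where "\<And>z. poly p z = jtr a b q z" "degree p = q"
proof -
  obtain k where k: "q = Suc k" using assms(2) by (cases q) auto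
  obtain p r where p: "\<And>z. poly p z = fst (jsol a b z (1, 0) q)" "degree p = q"
    using jsol_poly_cos[where a = a and b = b and k = q, OF assms(1)] by blast
  obtain p' r' where r: "\<And>z. poly r' z = snd (jsol a b z (0, 1) q)" "degree r' \<le> k"
    using jsol_poly_sin[of a b k] unfolding k by blast
  have "degree (p + r') = q" using p r k by (subst degree_add_eq_left) auto
  then show ?thesis by (intro that[of "p + r'"]) (simp_all add: p r jtr_def)
qed

lemma poly_real_factorization:
  fixes p :: "complex poly"
  assumes "0 < degree p" "\<And>z. poly p z = 0 \<Longrightarrow> Im z = 0"
  obtains k x where "0 < k" "\<And>z. cmod (poly p z) = k * (\<Prod>i<degree p. cmod (z - of_real (x i)))"
    "\<And>i. i < degree p \<Longrightarrow> poly p (of_real (x i)) = 0"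
proof -
  obtain root where root: "Polynomial.smult (lead_coeff p) (\<Prod>i<degree p. [:- root i, 1:]) = p"
    using complex_poly_decompose' .
  have val: "poly p z = lead_coeff p * (\<Prod>i<degree p. (z - root i))" for z
    by (subst root[symmetric]) (simp add: poly_prod)
  have r0: "poly p (root i) = 0" if "i < degree p" for i
    using that unfolding val by auto
  have re: "complex_of_real (Re (root i)) = root i" if "i < degree p" for i
    using assms(2)[OF r0[OF that]] by (simp add: complex_eq_iff)
  have "cmod (poly p z) = cmod (lead_coeff p) * (\<Prod>i<degree p. cmod (z - of_real (Re (root i))))" for z
    unfolding val norm_mult prod_norm[symmetric]
    by (intro arg_cong[where f = "\<lambda>x. _ * x"] prod.cong refl) (simp add: re)
  moreover have "lead_coeff p \<noteq> 0" using assms(1) by auto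
  ultimately show ?thesis
    using r0 re by (intro that[of "cmod (lead_coeff p)" "\<lambda>i. Re (root i)"]) auto
qed

text \<open>If \<open>F = 2\<close> had no solution within \<open>\<rho>\<close> of \<open>E\<close>, then \<open>F > 2\<close> there, so all zeros of \<open>F\<close> have distance
  greater than \<open>\<rho>\<close> from \<open>E\<close>, and \<open>F (E - \<rho>) F (E + \<rho>) / F(E)\<^sup>2\<close> is a product of factors in \<open>[0, 1]\<close>.\<close>

lemma near_level_crossing:
  fixes F :: "real \<Rightarrow> real" and q :: nat
  assumes F: "\<And>E. F E = k * (\<Prod>i<q. \<bar>E - x i\<bar>)" and k: "0 < k" and q: "0 < q"
    and x: "\<And>i. i < q \<Longrightarrow> \<bar>E - x i\<bar> \<le> 2 * R"
    and E: "2 < F E" "F E \<le> 2 + t" and t: "t \<le> 4"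
    and rho: "0 < \<rho>" "8 * R\<^sup>2 * t \<le> \<rho>\<^sup>2"
  shows "\<exists>e. \<bar>e - E\<bar> \<le> \<rho> \<and> F e = 2"
proof (rule ccontr)
  assume neg: "\<not> (\<exists>e. \<bar>e - E\<bar> \<le> \<rho> \<and> F e = 2)"
  have cont: "continuous_on S F" for S
    unfolding F by (intro continuous_intros)
  have big: "2 < F e" if "\<bar>e - E\<bar> \<le> \<rho>" for e
  proof (rule ccontr)
    assume "\<not> 2 < F e"
    then have le: "F e \<le> 2" by simp
    show False
    proof (cases "e \<le> E")
      case True
      then obtain y where "e \<le> y" "y \<le> E" "F y = 2"
        using IVT'[of F e 2 E] le E cont by auto
      then show False using neg that by (metis abs_le_iff abs_minus_commute diff_left_mono diff_right_mono order_trans abs_of_nonneg diff_ge_0_iff_ge)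
    next
      case False
      then obtain y where "E \<le> y" "y \<le> e" "F y = 2"
        using IVT2'[of F e 2 E] le E cont by auto
      then show False using neg that by auto
    qed
  qed
  have far: "\<rho> < \<bar>E - x i\<bar>" if "i < q" for i
  proof (rule ccontr)
    assume "\<not> \<rho> < \<bar>E - x i\<bar>"
    then have "2 < F (x i)" by (intro big) (simp add: abs_minus_commute)
    moreover have "(\<Prod>j<q. \<bar>x i - x j\<bar>) = 0" using that by (intro prod_zero) auto
    then have "F (x i) = 0" unfolding F by simp
    ultimately show False by simp
  qed
  \<comment> \<open>Since all zeros are within \<open>2 * R\<close> of \<open>E\<close>,
    \<open>s\<close> bounds every quotient \<open>\<rho>\<^sup>2 / (E - x i)\<^sup>2\<close> from
    below.\<close>
  define s where "s = \<rho>\<^sup>2 / (2 * R)\<^sup>2"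
  define w where "w i = 1 - \<rho>\<^sup>2 / (E - x i)\<^sup>2" for i
  have w: "0 \<le> w i" "w i \<le> 1 - s" if "i < q" for i
  proof -
    have pos: "0 < (E - x i)\<^sup>2" using far[OF that] rho by auto
    have "\<rho>\<^sup>2 \<le> \<bar>E - x i\<bar>\<^sup>2" using far[OF that] rho by (intro power_mono) auto
    then have "\<rho>\<^sup>2 \<le> (E - x i)\<^sup>2" by simp
    then show "0 \<le> w i" using pos by (simp add: w_def)
    have "(E - x i)\<^sup>2 \<le> (2 * R)\<^sup>2"
      using x[OF that] by (intro iffD1[OF abs_le_square_iff]) simp
    then have "s \<le> \<rho>\<^sup>2 / (E - x i)\<^sup>2"
      unfolding s_def using pos by (intro divide_left_mono mult_pos_pos) (linarith | simp)+
    then show "w i \<le> 1 - s" by (simp add: w_def)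
  qed
  have s0: "0 \<le> s" by (simp add: s_def)
  \<comment> \<open>A single factor already supplies the gain \<open>1 - s\<close>; the others are
    merely bounded by 1. This needs \<open>0 < q\<close>.\<close>
  have prod_le: "(\<Prod>i<q. w i) \<le> 1 - s"
  proof -
    have "(\<Prod>i<q. w i) = w 0 * (\<Prod>i\<in>{..<q} - {0}. w i)"
      using q by (subst prod.remove[of _ 0]) auto
    also have "\<dots> \<le> (1 - s) * 1"
    proof (intro mult_mono prod_le_1 prod_nonneg conjI w(2) q)
      show "0 \<le> 1 - s" using w[OF q] by linarith
      show "w i \<le> 1" if "i \<in> {..<q} - {0}" for i using w(2)[of i] that s0 by simp
    qed (use w(1) in auto)
    finally show ?thesis by simp
  qed
  have "F (E - \<rho>) * F (E + \<rho>) = k * k * (\<Prod>i<q. \<bar>E - \<rho> - x i\<bar> * \<bar>E + \<rho> - x i\<bar>)"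
    unfolding F by (simp add: prod.distrib)
  also have "(\<Prod>i<q. \<bar>E - \<rho> - x i\<bar> * \<bar>E + \<rho> - x i\<bar>) = (\<Prod>i<q. \<bar>E - x i\<bar> * \<bar>E - x i\<bar> * w i)"
  proof (intro prod.cong refl)
    fix i assume "i \<in> {..<q}"
    then have i: "i < q" by simp
    have nz: "(E - x i)\<^sup>2 \<noteq> 0" using far[OF i] rho by auto
    have "\<bar>E - \<rho> - x i\<bar> * \<bar>E + \<rho> - x i\<bar> = \<bar>(E - x i)\<^sup>2 - \<rho>\<^sup>2\<bar>"
      unfolding abs_mult[symmetric] by (rule arg_cong[where f = abs]) (simp add: power2_eq_square algebra_simps)
    also have "(E - x i)\<^sup>2 - \<rho>\<^sup>2 = (E - x i)\<^sup>2 * w i" using nz by (simp add: w_def algebra_simps)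
    also have "\<bar>\<dots>\<bar> = (E - x i)\<^sup>2 * w i" using w[OF i] by simp
    also have "(E - x i)\<^sup>2 = \<bar>E - x i\<bar> * \<bar>E - x i\<bar>" by (simp add: power2_eq_square flip: abs_mult)
    finally show "\<bar>E - \<rho> - x i\<bar> * \<bar>E + \<rho> - x i\<bar> = \<bar>E - x i\<bar> * \<bar>E - x i\<bar> * w i" .
  qed
  also have "k * k * \<dots> = (F E)\<^sup>2 * (\<Prod>i<q. w i)"
    unfolding F prod.distrib power2_eq_square by (simp only: mult_ac)
  also have "\<dots> \<le> (F E)\<^sup>2 * (1 - s)" by (intro mult_left_mono prod_le) simp
  finally have 1: "F (E - \<rho>) * F (E + \<rho>) \<le> (F E)\<^sup>2 * (1 - s)" .
  have "2 * 2 < F (E - \<rho>) * F (E + \<rho>)"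
    using big[of "E - \<rho>"] big[of "E + \<rho>"] rho by (intro mult_strict_mono) auto
  with 1 have lt: "4 < (F E)\<^sup>2 * (1 - s)" by simp
  have s1: "0 \<le> 1 - s" using w[OF q] by linarith
  have R: "0 < R" using far[OF q] x[OF q] rho by simp
  have t0: "0 < t" using E by simp
  \<comment> \<open>The condition on \<open>\<rho>\<close> is made for this inequality: with
    \<open>(2 + t)\<^sup>2 \<le> 4 + 8 * t\<close>, which uses \<open>t \<le> 4\<close>, the product
    falls to \<open>4 - 16 * t\<^sup>2\<close>, against the strict lower bound 4.\<close>
  have "s \<ge> 2 * t" using rho R unfolding s_def by (simp add: field_simps power2_eq_square)
  have "(F E)\<^sup>2 \<le> (2 + t)\<^sup>2" using E by (intro power_mono) auto
  also have "\<dots> \<le> 4 + 8 * t"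
  proof -
    have "t * t \<le> 4 * t" using t t0 by (intro mult_right_mono) auto
    then show ?thesis by (simp add: power2_eq_square algebra_simps)
  qed
  finally have "(F E)\<^sup>2 * (1 - s) \<le> (4 + 8 * t) * (1 - s)" by (intro mult_right_mono s1)
  also have "\<dots> \<le> (4 + 8 * t) * (1 - 2 * t)" using \<open>s \<ge> 2 * t\<close> t0 by (intro mult_left_mono) auto
  also have "\<dots> \<le> 4" by (simp add: algebra_simps)
  finally show False using lt by simp
qed

section \<open>Spectra of periodic approximants\<close>

text \<open>The bands of the periodic operator, cut to the energies for which the step bound
  \<open>nrm1_step\<close> holds; the cut also makes the measure finite.\<close>

definition spec_set :: "real \<Rightarrow> (nat \<Rightarrow> real) \<Rightarrow> (nat \<Rightarrow> real) \<Rightarrow> nat \<Rightarrow> real set" where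
  "spec_set G a b q = {E. \<bar>E\<bar> \<le> 3 * G + 1 \<and> cmod (jtr a b q (of_real E)) \<le> 2}"

lemma spec_set_fmeasurable:
  assumes "\<And>k. a k \<noteq> 0" "0 < q"
  shows "spec_set G a b q \<in> fmeasurable lborel"
proof -
  obtain p where p: "\<And>z. poly p z = jtr a b q z" using jtr_poly[where a = a, OF assms] by metis
  have "continuous_on UNIV (\<lambda>E::real. cmod (poly p (of_real E)))"
    by (intro continuous_intros)
  then have "closed {E::real. cmod (poly p (of_real E)) \<le> 2}"
    by (intro closed_Collect_le continuous_intros)
  then have "closed ({- (3 * G + 1)..3 * G + 1} \<inter> {E::real. cmod (poly p (of_real E)) \<le> 2})"
    by (intro closed_Int) auto
  also have "{- (3 * G + 1)..3 * G + 1} \<inter> {E::real. cmod (poly p (of_real E)) \<le> 2} = spec_set G a b q"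
    by (auto simp: spec_set_def p)
  finally have "spec_set G a b q \<in> sets lborel" by auto
  moreover have "spec_set G a b q \<subseteq> {- (3 * G + 1)..3 * G + 1}" by (auto simp: spec_set_def)
  ultimately show ?thesis
    using fmeasurableI2[OF fmeasurable_compact[OF compact_Icc]] by blast
qed

text \<open>The difference of the two solutions obeys the recursion at \<open>z\<close> with the
  source \<open>(z - w) * x / a k\<close>; the \<open>k\<close> sources accumulate linearly on top
  of the exponential step growth.\<close>

lemma jsol_energy_perturb:
  assumes adm: "jac_adm G a b" and z: "cmod z \<le> 3 * G + 1" "cmod w \<le> 3 * G + 1" and r: "cmod (z - w) \<le> r"
  shows "nrm1 (jsol a b z v k - jsol a b w v k) \<le> real k * r * (20 * G\<^sup>2) ^ k * nrm1 v"
proof (induction k)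
  case 0
  show ?case by (simp add: nrm1_def)
next
  case (Suc k)
  define A where "A = 20 * G\<^sup>2"
  note J = jac_admD(1)[OF adm] jac_admD(2-6)[OF adm, of k]
  have A: "G \<le> A" using J(1) by (simp add: A_def power2_eq_square)
  define u x where "u = jsol a b z v k - jsol a b w v k" and "x = fst (jsol a b w v k)"
  define y where "y = (((z - b k) * fst u - snd u) / a k, a k * fst u)"
  have dec: "jsol a b z v (Suc k) - jsol a b w v (Suc k) = y + ((z - w) * x / a k, 0)"
    by (simp add: y_def u_def x_def algebra_simps diff_divide_distrib add_divide_distrib)
  \<comment> \<open>Freezing the coefficients at site \<open>k\<close> turns \<open>y\<close> into
    the first step of a constant recursion, to which \<open>nrm1_step\<close> applies.\<close>
  have "y = jsol (\<lambda>_. a k) (\<lambda>_. b k) z u (Suc 0)" by (simp add: y_def)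
  moreover have "jac_adm G (\<lambda>_. a k) (\<lambda>_. b k)" using J by (simp add: jac_adm_def)
  ultimately have "nrm1 y \<le> A * nrm1 u"
    using nrm1_step[of G "\<lambda>_. a k" "\<lambda>_. b k" z u 0] z by (simp add: A_def)
  moreover have "cmod ((z - w) * x / a k) \<le> r * A ^ Suc k * nrm1 v"
  proof -
    have "cmod ((z - w) * x / a k) = cmod (z - w) * (cmod x * (1 / a k))" using J by (simp add: norm_mult norm_divide)
    also have "\<dots> \<le> r * ((A ^ k * nrm1 v) * A)"
    proof (intro mult_mono r)
      have "cmod x \<le> nrm1 (jsol a b w v k)" by (simp add: nrm1_def x_def)
      then show "cmod x \<le> A ^ k * nrm1 v" using nrm1_pow[OF adm z(2), of v k] unfolding A_def by linarith
      show "1 / a k \<le> A" using J(6) A by simp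
      show "0 \<le> r" using r norm_ge_zero order_trans by blast
    qed (use J nrm1_nonneg A in \<open>auto intro!: mult_nonneg_nonneg\<close>)
    finally show ?thesis by (simp add: mult_ac)
  qed
  moreover have "nrm1 (y + ((z - w) * x / a k, 0)) \<le> nrm1 y + cmod ((z - w) * x / a k)"
    using norm_triangle_ineq[of "fst y" "(z - w) * x / a k"] by (simp add: nrm1_def)
  moreover have "A * nrm1 u \<le> A * (real k * r * A ^ k * nrm1 v)"
    using Suc A J(1) unfolding u_def A_def by (intro mult_left_mono) auto
  ultimately show ?case
    unfolding dec A_def[symmetric] by (simp add: algebra_simps)
qed

text \<open>The discriminant has a zero \<open>E0\<close>, which is real and at most
  \<open>3 * G\<close> in modulus. By the energy perturbation bound it stays below 2 in modulus on
  an interval around \<open>E0\<close>.\<close>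

lemma measure_spec_set_ge:
  assumes adm: "jac_adm G a b" and per: "jac_per q a b" and q: "0 < q"
  shows "1 / (20 * G\<^sup>2) ^ (2 * q) \<le> measure lborel (spec_set G a b q)"
proof -
  define A where "A = 20 * G\<^sup>2"
  note J = jac_admD[OF adm]
  have A: "20 \<le> A" using twenty_le_step_bound[OF J(1)] by (simp add: A_def)
  have nz: "\<And>k. a k \<noteq> 0" using J(2) by (metis less_irrefl)
  obtain p where p: "\<And>z. poly p z = jtr a b q z" "degree p = q" using jtr_poly[where a = a, OF nz q] by metis
  have "\<not> constant (poly p)" using p(2) q by (simp add: constant_degree)
  then obtain z where z: "jtr a b q z = 0" using fundamental_theorem_of_algebra p(1) by metis
  define E0 where "E0 = Re z"
  have zE: "z = of_real E0" using jtr_root_real[where a = a, OF nz per q z] by (simp add: E0_def complex_eq_iff)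
  have E0: "\<bar>E0\<bar> \<le> 3 * G" using jtr_root_bound[OF adm per q z] unfolding zE by simp
  \<comment> \<open>The solutions over one period change by at most
    \<open>real q * r * A ^ q\<close>, which this radius turns into
    \<open>real q / A ^ q \<le> 1\<close>; the trace collects two such terms.\<close>
  define r where "r = 1 / A ^ (2 * q)"
  have r: "0 \<le> r" "r \<le> 1" using A by (auto simp: r_def one_le_power)
  have "E \<in> spec_set G a b q" if "\<bar>E - E0\<bar> \<le> r" for E
  proof -
    have E: "\<bar>E\<bar> \<le> 3 * G + 1" using that E0 r by linarith
    let ?d = "\<lambda>v. jsol a b (of_real E) v q - jsol a b (of_real E0) v q"
    have d: "nrm1 (?d v) \<le> nrm1 v" for v
    proof -
      have "nrm1 (?d v) \<le> real q * r * A ^ q * nrm1 v"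
        unfolding A_def using E E0 that by (intro jsol_energy_perturb[OF adm]) (auto simp flip: of_real_diff)
      also have "real q * r * A ^ q \<le> 1"
      proof -
        have "real q \<le> 2 ^ q" using less_exp[of q] by (metis of_nat_less_iff less_imp_le of_nat_numeral of_nat_power)
        also have "\<dots> \<le> A ^ q" using A by (intro power_mono) auto
        finally have "real q / A ^ q \<le> 1" using A by simp
        moreover have "A ^ (2 * q) = A ^ q * A ^ q" by (simp add: mult_2 power_add)
        then have "real q * r * A ^ q = real q / A ^ q" using A by (simp add: r_def)
        ultimately show ?thesis by simp
      qed
      finally show ?thesis using nrm1_nonneg[of v] by (simp add: mult_left_le_one_le mult_right_mono)
    qed
    have "jtr a b q (of_real E) = jtr a b q (of_real E) - jtr a b q (of_real E0)" using z zE by simp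
    also have "\<dots> = fst (?d (1, 0)) + snd (?d (0, 1))" by (simp add: jtr_def)
    also have "cmod \<dots> \<le> nrm1 (?d (1, 0)) + nrm1 (?d (0, 1))"
      using norm_triangle_ineq[of "fst (?d (1, 0))" "snd (?d (0, 1))"]
      unfolding nrm1_def by (smt (verit) norm_ge_zero)
    also have "\<dots> \<le> 1 + 1" using d[of "(1,0)"] d[of "(0,1)"] by (simp add: nrm1_def)
    finally show ?thesis using E by (simp add: spec_set_def)
  qed
  then have "{E0 - r..E0 + r} \<subseteq> spec_set G a b q" by (auto simp: abs_le_iff)
  then have "measure lborel {E0 - r..E0 + r} \<le> measure lborel (spec_set G a b q)"
    by (intro measure_mono_fmeasurable spec_set_fmeasurable nz q) auto
  then have "2 * r \<le> measure lborel (spec_set G a b q)" using r by simp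
  then show ?thesis unfolding A_def[symmetric] r_def[symmetric] using r by linarith
qed

text \<open>At real energies the discriminant is real, so modulus 2 means one of the values 2 and
  -2, and a polynomial of degree \<open>q\<close> takes each at most \<open>q\<close> times.\<close>

lemma jtr_level_set:
  assumes nz: "\<And>k. a k \<noteq> 0" and q: "0 < q"
  shows "finite {e::real. cmod (jtr a b q (of_real e)) = 2}"
    "card {e::real. cmod (jtr a b q (of_real e)) = 2} \<le> 2 * q"
proof -
  obtain p where p: "\<And>z. poly p z = jtr a b q z" "degree p = q" using jtr_poly[where a = a, OF nz q] by metis
  have deg: "degree (p - [:c:]) = q" for c
    using p(2) q degree_add_eq_left[of "- [:c:]" p] by (simp only: diff_conv_add_uminus) simp
  have ne: "p - [:c:] \<noteq> 0" for c using deg[of c] q by (metis degree_0 less_irrefl)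
  define T where "T c = {z. poly (p - [:c:]) z = 0}" for c
  have T: "finite (T c)" "card (T c) \<le> q" for c
    using poly_roots_finite[OF ne[of c]] card_poly_roots_bound[OF ne[of c]] deg[of c] by (auto simp: T_def)
  let ?S = "{e::real. cmod (jtr a b q (of_real e)) = 2}"
  have sub: "complex_of_real ` ?S \<subseteq> T 2 \<union> T (-2)"
  proof clarsimp
    fix e :: real
    assume *: "cmod (jtr a b q (of_real e)) = 2" and "of_real e \<notin> T (- 2)"
    have "jtr a b q (of_real e) = of_real (Re (jtr a b q (of_real e)))"
      using Im_jtr_real[of a b q e] by (simp add: complex_eq_iff)
    with * have "\<bar>Re (jtr a b q (of_real e))\<bar> = 2" by (metis norm_of_real)
    then have "jtr a b q (of_real e) = 2 \<or> jtr a b q (of_real e) = -2"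
      using Im_jtr_real[of a b q e] by (auto simp: complex_eq_iff)
    then show "of_real e \<in> T 2" using \<open>of_real e \<notin> T (- 2)\<close> by (auto simp: T_def p)
  qed
  have inj: "inj_on complex_of_real ?S" by (auto simp: inj_on_def)
  have fin: "finite (T 2 \<union> T (-2))" using T by auto
  have "finite (complex_of_real ` ?S)" by (rule finite_subset[OF sub fin])
  then show "finite ?S" by (rule finite_imageD[OF _ inj])
  have "card ?S = card (complex_of_real ` ?S)" by (rule card_image[OF inj, symmetric])
  also have "\<dots> \<le> card (T 2 \<union> T (-2))" by (rule card_mono[OF fin sub])
  also have "\<dots> \<le> 2 * q" using card_Un_le[of "T 2" "T (-2)"] T(2)[of 2] T(2)[of "-2"] by linarith
  finally show "card ?S \<le> 2 * q" .
qed

lemma jtr_near_level: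
  assumes adm: "jac_adm G a b" and per: "jac_per q a b" and q: "0 < q" and E: "\<bar>E\<bar> \<le> 3 * G + 1"
    and D: "2 < cmod (jtr a b q (of_real E))" "cmod (jtr a b q (of_real E)) \<le> 2 + t" and t: "t \<le> 4"
    and rho: "0 < \<rho>" "8 * (3 * G + 1)\<^sup>2 * t \<le> \<rho>\<^sup>2"
  shows "\<exists>e. \<bar>e - E\<bar> \<le> \<rho> \<and> cmod (jtr a b q (of_real e)) = 2"
proof -
  have nz: "\<And>k. a k \<noteq> 0" using jac_admD(2)[OF adm] by (metis less_irrefl)
  obtain p where p: "\<And>z. poly p z = jtr a b q z" "degree p = q" using jtr_poly[where a = a, OF nz q] by metis
  obtain k x where k: "0 < k" and F: "\<And>z. cmod (poly p z) = k * (\<Prod>i<degree p. cmod (z - of_real (x i)))"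
    and x: "\<And>i. i < degree p \<Longrightarrow> poly p (of_real (x i)) = 0"
    using poly_real_factorization[of p] jtr_root_real[where a = a, OF nz per q] p q by metis
  have "\<bar>E - x i\<bar> \<le> 2 * (3 * G + 1)" if "i < q" for i
  proof -
    have "cmod (of_real (x i)) \<le> 3 * G" using x p that by (intro jtr_root_bound[OF adm per q]) simp
    then show ?thesis using E by simp
  qed
  moreover have "cmod (jtr a b q (of_real e)) = k * (\<Prod>i<q. \<bar>e - x i\<bar>)" for e
    using F[of "of_real e"] unfolding p by (simp flip: of_real_diff)
  ultimately show ?thesis
    using near_level_crossing[of "\<lambda>e. cmod (jtr a b q (of_real e))" k x q E "3 * G + 1" t \<rho>] k q D t rho by blast
qed

section \<open>Persistence of the bands from one approximant to the next\<close>

text \<open>The model is \<open>2 * cosh (M * \<theta>)\<close>. Growth quadratic in the number of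
  periods turns a bound at large length into a small bound for the excess \<open>\<tau>\<close> over
  one period.\<close>

lemma hyperbolic_trace_growth:
  fixes T :: "nat \<Rightarrow> complex"
  assumes T: "cmod (T 0) = 2" "cmod (T 1) = 2 + \<tau>" and t: "0 \<le> \<tau>"
    and rec: "\<And>M. T (Suc (Suc M)) = T 1 * T (Suc M) - T M"
  shows "2 + \<tau> * (real M)\<^sup>2 \<le> cmod (T M)"
proof -
  \<comment> \<open>The induction has to carry the increments as well; the lower bounds
    \<open>\<tau> * (2 * M + 1)\<close> add up to \<open>\<tau> * M\<^sup>2\<close>.\<close>
  have "2 + \<tau> * (real M)\<^sup>2 \<le> cmod (T M) \<and> \<tau> * (2 * real M + 1) \<le> cmod (T (Suc M)) - cmod (T M)"
  proof (induction M)
    case 0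
    show ?case using T by simp
  next
    case (Suc M)
    then have 1: "2 + \<tau> * (real M)\<^sup>2 \<le> cmod (T M)" and 2: "\<tau> * (2 * real M + 1) \<le> cmod (T (Suc M)) - cmod (T M)"
      by auto
    have 3: "2 + \<tau> * (real (Suc M))\<^sup>2 \<le> cmod (T (Suc M))"
      using 1 2 by (simp add: power2_eq_square algebra_simps)
    have "(2 + \<tau>) * cmod (T (Suc M)) - cmod (T M) \<le> cmod (T (Suc (Suc M)))"
      using norm_triangle_ineq2[of "T 1 * T (Suc M)" "T M"] T(2) unfolding rec norm_mult by simp
    moreover have "\<tau> * 2 \<le> \<tau> * cmod (T (Suc M))"
    proof (rule mult_left_mono[OF _ t])
      have "0 \<le> \<tau> * (real (Suc M))\<^sup>2" using t by simp
      then show "2 \<le> cmod (T (Suc M))" using 3 by linarith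
    qed
    ultimately have "\<tau> * (2 * real (Suc M) + 1) \<le> cmod (T (Suc (Suc M))) - cmod (T (Suc M))"
      using 2 by (simp add: algebra_simps)
    with 3 show ?case by simp
  qed
  then show ?thesis by simp
qed

text \<open>Up to length \<open>X ^ 20\<close> the periodic solutions are at most
  \<open>X ^ 23\<close>: \<open>X ^ 2\<close> from two periods and \<open>X ^ 21\<close> from the
  linear growth. The smallness condition of \<open>jsol_perturb\<close> then needs
  \<open>68 = 2 * 23 + 20 + 2\<close>, where the last two powers beat the constant
  \<open>8 * A\<close>. The factor 3 is absorbed into \<open>X ^ 24\<close>.\<close>

lemma elliptic_persistence:
  fixes X :: nat
  assumes adm: "jac_adm G a b" and adm': "jac_adm G a' b'" and per: "jac_per q a b"
    and q: "0 < q" "q \<le> n" and X: "real X = (20 * G\<^sup>2) ^ n"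
    and d: "\<And>k. \<bar>a k - a' k\<bar> \<le> 4 / real X ^ 68" "\<And>k. \<bar>b k - b' k\<bar> \<le> 4 / real X ^ 68"
    and E: "E \<in> spec_set G a b q" and k: "k \<le> X ^ 20"
  shows "nrm1 (jsol a' b' (of_real E) v k) \<le> real X ^ 24 * nrm1 v"
proof -
  define A where "A = 20 * G\<^sup>2"
  note J = jac_admD[OF adm]
  have A: "20 \<le> A" using twenty_le_step_bound[OF J(1)] by (simp add: A_def)
  have AX: "A \<le> X" unfolding X A_def[symmetric] using A q by (intro self_le_power) auto
  then have X20: "20 \<le> real X" using A by linarith
  have E': "\<bar>E\<bar> \<le> 3 * G + 1" "cmod (jtr a b q (of_real E)) \<le> 2" using E by (auto simp: spec_set_def)
  have B: "nrm1 (jsol a b (of_real E) w k) \<le> real X ^ 23" if "k \<le> X ^ 20" "nrm1 w = 1" for k w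
  proof -
    have "nrm1 (jsol a b (of_real E) w k) \<le> A ^ (2 * q) * (1 + 2 * real (X ^ 20)) * nrm1 w"
      unfolding A_def by (rule elliptic_growth[OF adm E'(1) q(1) per E'(2) that(1)])
    also have "\<dots> \<le> real X ^ 2 * (real X * real X ^ 20)"
    proof -
      have "A ^ (2 * q) \<le> A ^ (n * 2)" using A q by (intro power_increasing) auto
      then have "A ^ (2 * q) \<le> real X ^ 2" by (simp add: X A_def power_mult)
      moreover have "1 + 2 * real (X ^ 20) \<le> real X * real X ^ 20"
      proof -
        have "1 \<le> real X ^ 20" using X20 by (intro one_le_power) auto
        moreover have "3 * real X ^ 20 \<le> real X * real X ^ 20" using X20 by (intro mult_right_mono) auto
        ultimately show ?thesis by simp
      qed
      ultimately show ?thesis unfolding that(2) using A by (simp add: mult_mono)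
    qed
    also have "\<dots> = real X ^ 23" by (simp flip: power_add power_Suc)
    finally show ?thesis .
  qed
  have "nrm1 (jsol a' b' (of_real E) v k) \<le> 3 * real X ^ 23 * nrm1 v"
  proof (rule jsol_perturb[OF adm adm' _ d _ _ _ k])
    show "2 * (20 * G\<^sup>2) * (4 / real X ^ 68) * (real X ^ 23)\<^sup>2 * real (X ^ 20) \<le> 1"
    proof -
      have "2 * A * (4 / real X ^ 68) * (real X ^ 23)\<^sup>2 * real (X ^ 20) = 8 * A * (real X ^ 66 / real X ^ 68)"
        by (simp flip: power_mult power_add)
      also have "\<dots> = 8 * A / (real X * real X)" using X20 by (simp add: field_simps eval_nat_numeral)
      also have "\<dots> \<le> 1"
      proof -
        have "8 * A \<le> real X * real X" using X20 AX A by (intro mult_mono) auto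
        then show ?thesis using X20 by simp
      qed
      finally show ?thesis by (simp add: A_def)
    qed
  qed (use E' B in \<open>auto simp: nrm1_def\<close>)
  also have "\<dots> \<le> real X * real X ^ 23 * nrm1 v"
    using X20 nrm1_nonneg[of v] by (intro mult_right_mono) auto
  finally show ?thesis by (simp flip: power_Suc)
qed

text \<open>On the old bands the new discriminant is at most \<open>2 + t\<close> with
  \<open>t = 1 / X ^ 13\<close>, so outside the new bands such energies lie within
  \<open>\<rho> = 1 / X ^ 5\<close> of one of at most \<open>2 * q'\<close> level points. These
  intervals have total length at most \<open>X ^ 2 * \<rho> = 1 / X ^ 3\<close>.\<close>

lemma spec_set_persistence:
  fixes X :: nat
  assumes adm: "jac_adm G a b" and adm': "jac_adm G a' b'" and per: "jac_per q a b" and per': "jac_per q' a' b'"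
    and q: "0 < q" "q \<le> n" and q': "0 < q'" "q' \<le> n" and X: "real X = (20 * G\<^sup>2) ^ n"
    and d: "\<And>k. \<bar>a k - a' k\<bar> \<le> 4 / real X ^ 68" "\<And>k. \<bar>b k - b' k\<bar> \<le> 4 / real X ^ 68"
  shows "measure lborel (spec_set G a b q) \<le> measure lborel (spec_set G a' b' q') + 1 / real X ^ 3"
proof -
  define A where "A = 20 * G\<^sup>2"
  note J = jac_admD[OF adm]
  have nz: "\<And>k. a k \<noteq> 0" using J(2) by (metis less_irrefl)
  have nz': "\<And>k. a' k \<noteq> 0" using jac_admD(2)[OF adm'] by (metis less_irrefl)
  have A: "20 \<le> A" using twenty_le_step_bound[OF J(1)] by (simp add: A_def)
  have AX: "A \<le> X" unfolding X A_def[symmetric] using A q by (intro self_le_power) auto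
  then have X20: "20 \<le> real X" using A by linarith
  have nX: "real n \<le> real X"
  proof -
    have "real n \<le> 2 ^ n" using less_exp[of n] by (metis of_nat_less_iff less_imp_le of_nat_numeral of_nat_power)
    also have "\<dots> \<le> A ^ n" using A by (intro power_mono) auto
    finally show ?thesis by (simp add: X A_def)
  qed
  define \<rho> where "\<rho> = 1 / real X ^ 5"
  define t where "t = 1 / real X ^ 13"
  have rho: "0 < \<rho>" using X20 by (simp add: \<rho>_def)
  let ?D = "\<lambda>E. cmod (jtr a' b' q' (complex_of_real E))"
  define T where "T = {e. ?D e = 2}"
  have T: "finite T" "card T \<le> 2 * q'"
    using jtr_level_set[where a = a' and b = b', OF nz' q'(1)] by (auto simp: T_def)
  have Dle: "?D E \<le> 2 + t" if E: "E \<in> spec_set G a b q" for E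
  proof (rule ccontr)
    assume "\<not> ?D E \<le> 2 + t"
    then have Dt: "t < ?D E - 2" by simp
    \<comment> \<open>As \<open>q' \<le> n \<le> X\<close>, \<open>M\<close> periods stay within the
      length \<open>X ^ 20\<close>. An excess above \<open>t\<close> would make the trace exceed
      \<open>X ^ 25\<close>, while persistence allows only \<open>2 * X ^ 24\<close>.\<close>
    define M where "M = X ^ 19"
    have "real M * real q' \<le> real X ^ 19 * real X"
      using q' nX by (simp add: M_def mult_left_mono)
    then have MX: "M * q' \<le> X ^ 20"
      by (simp flip: power_Suc2 of_nat_power of_nat_mult del: of_nat_mult of_nat_power)
    have t0: "0 < t" using X20 by (simp add: t_def)
    have "2 + (?D E - 2) * (real M)\<^sup>2 \<le> cmod (jtr a' b' (M * q') (of_real E))"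
    proof (rule hyperbolic_trace_growth[of "\<lambda>M. jtr a' b' (M * q') (of_real E)"])
      show "0 \<le> ?D E - 2" using Dt t0 by linarith
    qed (use jtr_mult[where a = a' and b = b', OF nz' per'] in \<open>simp_all add: jtr_def[of _ _ 0]\<close>)
    moreover have "cmod (jtr a' b' (M * q') (of_real E)) \<le> nrm1 (jsol a' b' (of_real E) (1, 0) (M * q'))
        + nrm1 (jsol a' b' (of_real E) (0, 1) (M * q'))"
      unfolding jtr_def nrm1_def
      by (smt (verit) norm_ge_zero norm_triangle_ineq)
    moreover have "nrm1 (jsol a' b' (of_real E) (1, 0) (M * q')) \<le> real X ^ 24"
      "nrm1 (jsol a' b' (of_real E) (0, 1) (M * q')) \<le> real X ^ 24"
      using elliptic_persistence[OF adm adm' per q X d E MX, of "(1,0)"]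
        elliptic_persistence[OF adm adm' per q X d E MX, of "(0,1)"] by (simp_all add: nrm1_def)
    ultimately have le: "(?D E - 2) * (real M)\<^sup>2 \<le> 2 * real X ^ 24" by linarith
    have "real X ^ 25 = t * (real M)\<^sup>2"
      using X20 by (simp add: t_def M_def field_simps flip: power_mult power_add)
    also have "\<dots> \<le> (?D E - 2) * (real M)\<^sup>2" using Dt by (intro mult_right_mono) auto
    also have "\<dots> \<le> 2 * real X ^ 24" by (rule le)
    also have "\<dots> < real X * real X ^ 24" using X20 by (intro mult_strict_right_mono) auto
    finally show False by (simp flip: power_Suc)
  qed
  have cover: "spec_set G a b q \<subseteq> spec_set G a' b' q' \<union> (\<Union>e\<in>T. {e - \<rho>..e + \<rho>})"
  proof
    fix E assume E: "E \<in> spec_set G a b q"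
    show "E \<in> spec_set G a' b' q' \<union> (\<Union>e\<in>T. {e - \<rho>..e + \<rho>})"
    proof (cases "?D E \<le> 2")
      case True
      then show ?thesis using E by (simp add: spec_set_def)
    next
      case False
      have "\<exists>e. \<bar>e - E\<bar> \<le> \<rho> \<and> ?D e = 2"
      proof (rule jtr_near_level[OF adm' per' q'(1) _ _ Dle[OF E] _ rho])
        show "\<bar>E\<bar> \<le> 3 * G + 1" using E by (simp add: spec_set_def)
        have "1 \<le> real X ^ 13" using X20 by (intro one_le_power) auto
        then show "t \<le> 4" by (simp add: t_def divide_le_eq)
        have "(3 * G + 1)\<^sup>2 \<le> (4 * G)\<^sup>2" using J(1) by (intro power_mono) auto
        also have "\<dots> \<le> A" using J(1) by (simp add: A_def power2_eq_square)
        finally have "8 * (3 * G + 1)\<^sup>2 \<le> real X * real X" using AX X20 by (intro mult_mono) auto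
        then have "8 * (3 * G + 1)\<^sup>2 * t \<le> real X * real X * t" using X20 by (intro mult_right_mono) (auto simp: t_def)
        also have "\<dots> = 1 / real X ^ 11" using X20 by (simp add: t_def field_simps eval_nat_numeral)
        also have "\<dots> \<le> 1 / real X ^ 10" using X20 by (intro divide_left_mono power_increasing) auto
        also have "\<dots> = \<rho>\<^sup>2" by (simp add: \<rho>_def power_divide flip: power_mult)
        finally show "8 * (3 * G + 1)\<^sup>2 * t \<le> \<rho>\<^sup>2" .
      qed (use False in auto)
      then show ?thesis by (auto simp: T_def abs_le_iff)
    qed
  qed
  have f: "spec_set G a b q \<in> fmeasurable lborel" "spec_set G a' b' q' \<in> fmeasurable lborel"
    using spec_set_fmeasurable[where a = a, OF nz q(1)] spec_set_fmeasurable[where a = a', OF nz' q'(1)] by auto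
  have fU: "(\<Union>e\<in>T. {e - \<rho>..e + \<rho>}) \<in> fmeasurable lborel"
    using T(1) by (rule fmeasurable.finite_UN) (intro fmeasurable_compact compact_Icc)
  have "measure lborel (spec_set G a b q) \<le> measure lborel (spec_set G a' b' q' \<union> (\<Union>e\<in>T. {e - \<rho>..e + \<rho>}))"
    using f fU by (intro measure_mono_fmeasurable cover) auto
  also have "\<dots> \<le> measure lborel (spec_set G a' b' q') + measure lborel (\<Union>e\<in>T. {e - \<rho>..e + \<rho>})"
    using f fU by (intro measure_Un_le) auto
  also have "measure lborel (\<Union>e\<in>T. {e - \<rho>..e + \<rho>}) \<le> (\<Sum>e\<in>T. measure lborel {e - \<rho>..e + \<rho>})"
    using T by (intro measure_UNION_le) auto
  also have "\<dots> = card T * (2 * \<rho>)" using rho by simp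
  also have "\<dots> \<le> real (2 * q') * (2 * \<rho>)" using T rho by (intro mult_right_mono) auto
  also have "\<dots> \<le> (real X * real X) * \<rho>"
  proof -
    have "4 * real q' \<le> real X * real X" using X20 nX q' by (intro mult_mono) auto
    then have "4 * real q' * \<rho> \<le> real X * real X * \<rho>" using rho by (intro mult_right_mono) auto
    then show ?thesis by simp
  qed
  also have "\<dots> = 1 / real X ^ 3" using X20 by (simp add: \<rho>_def field_simps eval_nat_numeral)
  finally show ?thesis by simp
qed

text \<open>The exponents are not optimised. With \<open>A = 20 * G\<^sup>2\<close> bounding the growth in one step, at stage \<open>K\<close> everything is
  measured in powers of \<open>A ^ (K + 1)\<close>: the error allowed is its power \<open>-68\<close>, the length its power 20, and the
  loss of measure its power \<open>-3\<close>, against an initial measure \<open>A ^ (- 2 * N)\<close>.\<close>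

lemma spec_set_chain:
  fixes a b :: "nat \<Rightarrow> nat \<Rightarrow> real" and q :: "nat \<Rightarrow> nat" and G :: nat
  assumes adm: "\<And>K. N \<le> K \<Longrightarrow> jac_adm G (a K) (b K)" and per: "\<And>K. N \<le> K \<Longrightarrow> jac_per (q K) (a K) (b K)"
    and q: "\<And>K. N \<le> K \<Longrightarrow> 0 < q K \<and> q K \<le> K"
    and d: "\<And>K k. N \<le> K \<Longrightarrow> \<bar>a K k - a (Suc K) k\<bar> \<le> 4 / (20 * real G ^ 2) ^ (68 * Suc K)"
       "\<And>K k. N \<le> K \<Longrightarrow> \<bar>b K k - b (Suc K) k\<bar> \<le> 4 / (20 * real G ^ 2) ^ (68 * Suc K)"
    and K: "N \<le> K"
  shows "1 / (2 * (20 * real G ^ 2) ^ (2 * N)) \<le> measure lborel (spec_set G (a K) (b K) (q K))"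
proof -
  define A where "A = 20 * real G ^ 2"
  have A: "20 \<le> A" using twenty_le_step_bound[OF jac_admD(1)[OF adm[of N]]] by (simp add: A_def)
  \<comment> \<open>The second term is the budget for the losses still to come: at stage
    \<open>K\<close> it shrinks by enough to pay for the loss \<open>1 / A ^ (3 * Suc K)\<close>.
    Initially the two terms split \<open>1 / A ^ (2 * N)\<close> into halves.\<close>
  have "1 / (2 * A ^ (2 * N)) + 1 / (2 * A ^ (2 * K)) \<le> measure lborel (spec_set G (a K) (b K) (q K))"
    using K
  proof (induction K rule: dec_induct)
    case base
    have "1 / A ^ (2 * N) \<le> 1 / A ^ (2 * q N)"
      using A q[of N] by (intro divide_left_mono power_increasing) auto
    also have "\<dots> \<le> measure lborel (spec_set G (a N) (b N) (q N))"
      unfolding A_def using q[of N] by (intro measure_spec_set_ge adm per) auto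
    finally show ?case by simp
  next
    case (step K)
    define X where "X = (20 * G ^ 2) ^ Suc K"
    have X: "real X = A ^ Suc K" by (simp add: X_def A_def)
    have X68: "real X ^ 68 = A ^ (68 * Suc K)" unfolding X by (metis mult.commute power_mult)
    have "measure lborel (spec_set G (a K) (b K) (q K))
        \<le> measure lborel (spec_set G (a (Suc K)) (b (Suc K)) (q (Suc K))) + 1 / real X ^ 3"
    proof (rule spec_set_persistence[where n = "Suc K"])
      show "real X = (20 * (real G)\<^sup>2) ^ Suc K" by (simp add: X A_def)
      show "\<bar>a K k - a (Suc K) k\<bar> \<le> 4 / real X ^ 68" "\<bar>b K k - b (Suc K) k\<bar> \<le> 4 / real X ^ 68" for k
        unfolding X68 A_def by (rule d[OF step(1)])+
      have "q K \<le> K" using q[of K] step(1) by auto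
      then show "q K \<le> Suc K" by simp
    qed (use step(1) q[of K] q[of "Suc K"] in \<open>auto intro!: adm per\<close>)
    moreover have "1 / (2 * A ^ (2 * Suc K)) + 1 / real X ^ 3 \<le> 1 / (2 * A ^ (2 * K))"
    proof -
      define Y where "Y = A ^ (2 * Suc K)"
      have Y: "0 < Y" using A by (simp add: Y_def)
      have "real X ^ 3 = A ^ (3 * Suc K)" unfolding X by (metis mult.commute power_mult)
      have "A ^ (2 * Suc K) \<le> A ^ (3 * Suc K)" using A by (intro power_increasing) auto
      then have "1 / real X ^ 3 \<le> 1 / Y" unfolding Y_def \<open>real X ^ 3 = A ^ (3 * Suc K)\<close>
        using A by (intro frac_le) auto
      moreover have "1 / (2 * A ^ (2 * K)) = A\<^sup>2 / (2 * Y)" using A by (simp add: Y_def power2_eq_square)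
      moreover have "3 / (2 * Y) \<le> A\<^sup>2 / (2 * Y)"
      proof (rule divide_right_mono)
        show "3 \<le> A\<^sup>2" using A mult_mono[of 3 A 1 A] by (simp add: power2_eq_square)
      qed (use Y in simp)
      moreover have "3 / (2 * Y) = 1 / (2 * Y) + 1 / Y" by (simp add: field_simps)
      ultimately show ?thesis by (simp add: Y_def)
    qed
    ultimately show ?case using step by linarith
  qed
  moreover have "0 \<le> 1 / (2 * A ^ (2 * K))" using A by simp
  ultimately show ?thesis unfolding A_def[symmetric] by linarith
qed

section \<open>Logarithmic averages and one-particle propagation\<close>

lemma nn_integral_log_kernel_pos:
  "(\<integral>\<^sup>+x. ennreal (ln (1 + 1 / x\<^sup>2) / 2) * indicator {0<..} x \<partial>lborel) = ennreal (pi / 2)"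
proof -
  define f where "f x = ln (1 + 1 / x\<^sup>2) / 2" for x :: real
  \<comment> \<open>The antiderivative found by integration by parts; its logarithmic term vanishes
    both at 0 and at infinity, so only \<open>arctan\<close> contributes.\<close>
  define F where "F x = x / 2 * ln (1 + 1 / x\<^sup>2) + arctan x" for x :: real
  have f0: "0 \<le> f x" for x by (simp add: f_def)
  have ei: "einterval 0 \<infinity> = {0<..}" by (auto simp: einterval_def zero_ereal_def)
  have "(F has_real_derivative f x) (at x)" if "0 < x" for x
  proof -
    have p: "0 < 1 + 1 / x\<^sup>2" by (simp add: add_pos_nonneg)
    have d1: "((\<lambda>x. 1 + 1 / x\<^sup>2) has_real_derivative - 2 / x ^ 3) (at x)"
      using that by (auto intro!: derivative_eq_intros simp: power2_eq_square power3_eq_cube)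
    have d2: "((\<lambda>x. ln (1 + 1 / x\<^sup>2)) has_real_derivative 1 / (1 + 1 / x\<^sup>2) * (- 2 / x ^ 3)) (at x)"
      by (rule DERIV_chain2[OF DERIV_ln_divide[OF p] d1])
    have d3: "((\<lambda>x. x / 2) has_real_derivative 1 / 2) (at x)"
      by (auto intro!: derivative_eq_intros)
    have "0 < 1 + x\<^sup>2" by (simp add: add_pos_nonneg)
    then have "x / 2 * (1 / (1 + 1 / x\<^sup>2) * (- 2 / x ^ 3)) = - inverse (1 + x\<^sup>2)"
      using that p by (simp add: divide_simps) (simp add: power2_eq_square power3_eq_cube algebra_simps)
    then show ?thesis
      unfolding F_def f_def using DERIV_add[OF DERIV_mult[OF d3 d2] DERIV_arctan[of x]] by (simp add: mult.commute)
  qed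
  moreover have "isCont f x" if "0 < x" for x
  proof -
    have "0 < 1 + 1 / x\<^sup>2" by (simp add: add_pos_nonneg)
    then show ?thesis unfolding f_def using that by (intro continuous_intros) auto
  qed
  moreover have "((F \<circ> real_of_ereal) \<longlongrightarrow> 0) (at_right 0)"
    unfolding zero_ereal_def ereal_tendsto_simps F_def by real_asymp
  moreover have "((F \<circ> real_of_ereal) \<longlongrightarrow> pi / 2) (at_left \<infinity>)"
    unfolding ereal_tendsto_simps F_def by real_asymp
  ultimately have FTC: "set_integrable lborel {0<..} f" "(LBINT x=0..\<infinity>. f x) = pi / 2 - 0"
    using interval_integral_FTC_nonneg[of 0 \<infinity> F f 0 "pi / 2"] f0 unfolding ei by auto
  have "(LBINT x=0..\<infinity>. f x) = (LBINT x:{0<..}. f x)"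
    by (simp add: interval_lebesgue_integral_def ei)
  with FTC have I: "(LBINT x:{0<..}. f x) = pi / 2" by simp
  have "(\<integral>\<^sup>+x. ennreal (f x) * indicator {0<..} x \<partial>lborel) = (\<integral>\<^sup>+x. ennreal (indicator {0<..} x *\<^sub>R f x) \<partial>lborel)"
    by (intro nn_integral_cong) (simp split: split_indicator)
  also have "\<dots> = ennreal (LBINT x:{0<..}. f x)"
    unfolding set_lebesgue_integral_def using FTC(1) f0
    by (intro nn_integral_eq_integral) (auto simp: set_integrable_def)
  finally show ?thesis unfolding f_def I[unfolded f_def] .
qed

lemma nn_integral_log_kernel:
  "(\<integral>\<^sup>+x. ennreal (ln (1 + 1 / x\<^sup>2) / 2) \<partial>lborel) = ennreal pi"
proof -
  define f where "f x = ennreal (ln (1 + 1 / x\<^sup>2) / 2)" for x :: real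
  have m[measurable]: "f \<in> borel_measurable borel" unfolding f_def by measurable
  have "(\<integral>\<^sup>+x. f x \<partial>lborel) = (\<integral>\<^sup>+x. (f x * indicator {0<..} x + f x * indicator {..<0} x) \<partial>lborel)"
  proof (rule nn_integral_cong_AE)
    show "AE x in lborel. f x = f x * indicator {0<..} x + f x * indicator {..<0} x"
      using AE_lborel_singleton[of 0] by eventually_elim (auto split: split_indicator)
  qed
  also have "\<dots> = (\<integral>\<^sup>+x. f x * indicator {0<..} x \<partial>lborel) + (\<integral>\<^sup>+x. f x * indicator {..<0} x \<partial>lborel)"
    by (intro nn_integral_add) auto
  also have "(\<integral>\<^sup>+x. f x * indicator {..<0} x \<partial>lborel) = (\<integral>\<^sup>+x. f x * indicator {0<..} x \<partial>lborel)"
    by (subst nn_integral_real_affine[where c = "-1" and t = 0])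
       (auto intro!: nn_integral_cong simp: f_def split: split_indicator)
  also have "(\<integral>\<^sup>+x. f x * indicator {0<..} x \<partial>lborel) = ennreal (pi / 2)"
    unfolding f_def by (rule nn_integral_log_kernel_pos)
  also have "ennreal (pi / 2) + ennreal (pi / 2) = ennreal pi"
    by (simp flip: ennreal_plus)
  finally show ?thesis by (simp add: f_def)
qed

text \<open>After translation and scaling every summand has integral \<open>pi * \<epsilon>\<close>
  over the whole line, so only the number of the points \<open>x i\<close> matters, not their
  position. \<open>N\<close> allows for excluding those points, where the quotient takes the default
  value 0.\<close>

lemma log_kernel_average:
  fixes S :: "real set" and x :: "nat \<Rightarrow> real"
  assumes S: "S \<in> fmeasurable lborel" and N: "finite N" and eps: "0 < \<epsilon>"
    and le: "\<And>E. E \<in> S \<Longrightarrow> E \<notin> N \<Longrightarrow> Y \<le> (\<Sum>i<L. ln (1 + \<epsilon>\<^sup>2 / (E - x i)\<^sup>2) / 2)"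
  shows "Y * measure lborel S \<le> L * (pi * \<epsilon>)"
proof (cases "0 \<le> Y")
  case False
  then have "Y * measure lborel S \<le> 0" by (simp add: mult_nonpos_nonneg)
  also have "0 \<le> L * (pi * \<epsilon>)" using eps by simp
  finally show ?thesis .
next
  case True
  define g where "g y E = ln (1 + \<epsilon>\<^sup>2 / (E - y)\<^sup>2) / 2" for y E :: real
  have [measurable]: "g y \<in> borel_measurable borel" for y unfolding g_def by measurable
  have g0: "0 \<le> g y E" for y E by (simp add: g_def)
  have gI: "(\<integral>\<^sup>+E. ennreal (g y E) \<partial>lborel) = ennreal (pi * \<epsilon>)" for y
  proof -
    have "(\<integral>\<^sup>+E. ennreal (g y E) \<partial>lborel) = ennreal \<bar>\<epsilon>\<bar> * (\<integral>\<^sup>+E. ennreal (g y (y + \<epsilon> * E)) \<partial>lborel)"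
      using eps by (intro nn_integral_real_affine) auto
    also have "(\<lambda>E. g y (y + \<epsilon> * E)) = (\<lambda>E. ln (1 + 1 / E\<^sup>2) / 2)"
      using eps by (auto simp: g_def fun_eq_iff power_mult_distrib)
    also have "ennreal \<bar>\<epsilon>\<bar> * (\<integral>\<^sup>+E. ennreal (ln (1 + 1 / E\<^sup>2) / 2) \<partial>lborel) = ennreal (pi * \<epsilon>)"
      unfolding nn_integral_log_kernel using eps by (simp add: mult.commute flip: ennreal_mult)
    finally show ?thesis .
  qed
  have "AE E in lborel. E \<notin> N"
    using N by (intro AE_not_in finite_imp_null_set_lborel)
  then have "AE E in lborel. ennreal Y * indicator S E \<le> (\<Sum>i<L. ennreal (g (x i) E))"
  proof eventually_elim
    case (elim E)
    have "(\<Sum>i<L. ennreal (g (x i) E)) = ennreal (\<Sum>i<L. g (x i) E)"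
      using g0 by (intro sum_ennreal) auto
    then show ?case using le[of E] elim by (auto simp: g_def ennreal_leI split: split_indicator)
  qed
  then have "(\<integral>\<^sup>+E. ennreal Y * indicator S E \<partial>lborel) \<le> (\<integral>\<^sup>+E. (\<Sum>i<L. ennreal (g (x i) E)) \<partial>lborel)"
    by (rule nn_integral_mono_AE)
  also have "\<dots> = (\<Sum>i<L. (\<integral>\<^sup>+E. ennreal (g (x i) E) \<partial>lborel))"
    by (intro nn_integral_sum) auto
  also have "\<dots> = ennreal (L * (pi * \<epsilon>))" using eps by (simp add: gI ennreal_mult' ennreal_of_nat_eq_real_of_nat)
  also have "(\<integral>\<^sup>+E. ennreal Y * indicator S E \<partial>lborel) = ennreal Y * emeasure lborel S"
    using S by (intro nn_integral_cmult_indicator) auto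
  also have "\<dots> = ennreal (Y * measure lborel S)"
    using S True by (simp add: emeasure_eq_measure2 ennreal_mult')
  finally show ?thesis using eps by (simp add: ennreal_le_iff)
qed

section \<open>The one-particle flow and its Laplace transform\<close>

lemma hermitian_flow_norm:
  fixes \<psi> :: "nat \<Rightarrow> real \<Rightarrow> complex" and h :: "nat \<Rightarrow> nat \<Rightarrow> real"
  assumes sym: "\<And>i j. h i j = h j i"
    and ode: "\<And>j t. j < L \<Longrightarrow> (\<psi> j has_vector_derivative (- \<i> * (\<Sum>i<L. of_real (h i j) * \<psi> i t))) (at t)"
  shows "(\<Sum>j<L. (cmod (\<psi> j t))\<^sup>2) = (\<Sum>j<L. (cmod (\<psi> j 0))\<^sup>2)"
proof -
  define N where "N t = (\<Sum>j<L. \<psi> j t * cnj (\<psi> j t))" for t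
  have "(N has_vector_derivative 0) (at t)" for t
  proof -
    define d where "d j = - \<i> * (\<Sum>i<L. of_real (h i j) * \<psi> i t)" for j
    have "(N has_vector_derivative (\<Sum>j<L. \<psi> j t * cnj (d j) + d j * cnj (\<psi> j t))) (at t)"
      unfolding N_def d_def
      by (intro has_vector_derivative_sum has_vector_derivative_mult ode has_vector_derivative_cnj) auto
    also have "(\<Sum>j<L. \<psi> j t * cnj (d j) + d j * cnj (\<psi> j t))
      = \<i> * ((\<Sum>j<L. \<Sum>i<L. of_real (h i j) * (\<psi> j t * cnj (\<psi> i t)))
           - (\<Sum>j<L. \<Sum>i<L. of_real (h i j) * (\<psi> i t * cnj (\<psi> j t))))"
      by (simp add: d_def sum_distrib_left sum_distrib_right sum.distrib sum_negf sum_subtractf algebra_simps)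
    also have "(\<Sum>j<L. \<Sum>i<L. of_real (h i j) * (\<psi> j t * cnj (\<psi> i t)))
      = (\<Sum>j<L. \<Sum>i<L. of_real (h i j) * (\<psi> i t * cnj (\<psi> j t)))"
      by (subst sum.swap) (simp add: sym)
    finally show ?thesis by simp
  qed
  then obtain c where "N t = c" for t
    using has_vector_derivative_zero_constant[of UNIV N] by (auto simp: convex_UNIV)
  then have "N t = N 0" by simp
  moreover have "N t = of_real (\<Sum>j<L. (cmod (\<psi> j t))\<^sup>2)" for t
    unfolding N_def of_real_sum by (intro sum.cong refl) (rule complex_norm_square[symmetric])
  ultimately show ?thesis by (metis of_real_eq_iff)
qed

text \<open>\<open>u\<close> is an eigenvector of \<open>h\<close> except for a defect
  \<open>\<kappa>\<close> at the last site. In the pairing with the flow everything cancels but the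
  last amplitude, which yields its Laplace transform without inverting a matrix.\<close>

lemma flow_boundary_identity:
  fixes \<psi> :: "nat \<Rightarrow> real \<Rightarrow> complex" and h :: "nat \<Rightarrow> nat \<Rightarrow> real" and u :: "nat \<Rightarrow> complex"
  assumes L: "0 < L"
    and ode: "\<And>j t. j < L \<Longrightarrow> (\<psi> j has_vector_derivative (- \<i> * (\<Sum>i<L. of_real (h i j) * \<psi> i t))) (at t)"
    and u: "\<And>i. i < L \<Longrightarrow> (\<Sum>j<L. of_real (h i j) * u j) = w * u i - (if i = L - 1 then \<kappa> else 0)"
  shows "((\<lambda>t. exp (\<i> * w * of_real t) * (\<Sum>j<L. \<psi> j t * u j)) has_vector_derivative
      \<i> * \<kappa> * exp (\<i> * w * of_real t) * \<psi> (L - 1) t) (at t)"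
proof -
  define e where "e t = exp (\<i> * w * of_real t)" for t :: real
  have e: "(e has_vector_derivative (\<i> * w) * e t) (at t)"
  proof -
    have "((\<lambda>z. exp (\<i> * w * z)) has_field_derivative exp (\<i> * w * of_real t) * (\<i> * w)) (at (of_real t))"
      by (auto intro!: derivative_eq_intros)
    from has_vector_derivative_real_field[OF this] show ?thesis by (simp add: e_def[abs_def] mult_ac)
  qed
  have s: "((\<lambda>t. \<Sum>j<L. \<psi> j t * u j) has_vector_derivative
      (\<Sum>j<L. (- \<i> * (\<Sum>i<L. of_real (h i j) * \<psi> i t)) * u j)) (at t)"
    by (intro has_vector_derivative_sum has_vector_derivative_mult_left ode) auto
  have "(\<Sum>j<L. (- \<i> * (\<Sum>i<L. of_real (h i j) * \<psi> i t)) * u j)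
     = - \<i> * (\<Sum>j<L. \<Sum>i<L. \<psi> i t * (of_real (h i j) * u j))"
    by (simp add: sum_distrib_left sum_distrib_right sum_negf mult_ac)
  also have "(\<Sum>j<L. \<Sum>i<L. \<psi> i t * (of_real (h i j) * u j)) = (\<Sum>i<L. \<psi> i t * (\<Sum>j<L. of_real (h i j) * u j))"
    by (subst sum.swap) (simp add: sum_distrib_left)
  also have "\<dots> = (\<Sum>i<L. \<psi> i t * (w * u i) - (if i = L - 1 then \<psi> i t * \<kappa> else 0))"
  proof (intro sum.cong refl)
    fix i assume "i \<in> {..<L}"
    then have e: "(\<Sum>j<L. of_real (h i j) * u j) = w * u i - (if i = L - 1 then \<kappa> else 0)" by (intro u) simp
    show "\<psi> i t * (\<Sum>j<L. of_real (h i j) * u j) = \<psi> i t * (w * u i) - (if i = L - 1 then \<psi> i t * \<kappa> else 0)"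
      unfolding e by (simp add: right_diff_distrib)
  qed
  also have "\<dots> = w * (\<Sum>i<L. \<psi> i t * u i) - \<psi> (L - 1) t * \<kappa>"
    using L by (simp add: sum_subtractf sum_distrib_left mult_ac)
  finally have s2: "(\<Sum>j<L. (- \<i> * (\<Sum>i<L. of_real (h i j) * \<psi> i t)) * u j)
     = - \<i> * (w * (\<Sum>i<L. \<psi> i t * u i) - \<psi> (L - 1) t * \<kappa>)" .
  show ?thesis
    using has_vector_derivative_mult[OF e s] unfolding s2 e_def[symmetric] by (simp add: algebra_simps)
qed

text \<open>The Lieb--Robinson bound is used up to time \<open>D / v\<close> and the trivial bound afterwards.\<close>

lemma flow_amplitude_bound:
  fixes \<psi> :: "nat \<Rightarrow> real \<Rightarrow> complex" and h :: "nat \<Rightarrow> nat \<Rightarrow> real" and u :: "nat \<Rightarrow> complex"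
  assumes L: "0 < L" and sym: "\<And>i j. h i j = h j i"
    and ode: "\<And>j t. j < L \<Longrightarrow> (\<psi> j has_vector_derivative (- \<i> * (\<Sum>i<L. of_real (h i j) * \<psi> i t))) (at t)"
    and init: "\<And>j. j < L \<Longrightarrow> \<psi> j 0 = (if j = 0 then 1 else 0)"
    and u: "\<And>i. i < L \<Longrightarrow> (\<Sum>j<L. of_real (h i j) * u j) = w * u i - (if i = L - 1 then \<kappa> else 0)"
    and u0: "u 0 = 1" and w: "Im w = \<epsilon>" and eps: "0 < \<epsilon>" "\<epsilon> < c * v" and v: "0 < v" and D: "0 < D" and C: "0 < C"
    and LR: "\<And>t. 0 \<le> t \<Longrightarrow> cmod (\<psi> (L - 1) t) \<le> C * exp (- c * (D - v * t))"
  shows "1 \<le> cmod \<kappa> * (C / (c * v - \<epsilon>) + 1 / \<epsilon>) * exp (- (\<epsilon> * D / v))"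
proof -
  define g where "g t = exp (\<i> * w * of_real t) * (\<Sum>j<L. \<psi> j t * u j)" for t :: real
  define g' where "g' t = \<i> * \<kappa> * exp (\<i> * w * of_real t) * \<psi> (L - 1) t" for t :: real
  have gd: "(g has_vector_derivative g' t) (at t)" for t
    unfolding g_def[abs_def] g'_def by (rule flow_boundary_identity[OF L ode u])
  have gc: "continuous_on A g" for A
    using gd by (intro continuous_at_imp_continuous_on ballI) (blast intro: has_vector_derivative_continuous)
  have ne: "cmod (exp (\<i> * w * of_real t)) = exp (- \<epsilon> * t)" for t :: real
    using w by (simp add: norm_exp_eq_Re)
  have ng': "cmod (g' t) = cmod \<kappa> * exp (- \<epsilon> * t) * cmod (\<psi> (L - 1) t)" for t
    unfolding g'_def norm_mult ne by simp
  have nsum: "(\<Sum>j<L. (cmod (\<psi> j t))\<^sup>2) = 1" for t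
  proof -
    have "(\<Sum>j<L. (cmod (\<psi> j 0))\<^sup>2) = (\<Sum>j<L. if j = 0 then 1 else 0)"
      by (intro sum.cong refl) (simp add: init)
    then show ?thesis using hermitian_flow_norm[OF sym ode, of t] L by simp
  qed
  have psi1: "cmod (\<psi> j t) \<le> 1" if "j < L" for j t
  proof -
    have "(cmod (\<psi> j t))\<^sup>2 \<le> (\<Sum>j<L. (cmod (\<psi> j t))\<^sup>2)"
      using that by (intro member_le_sum) auto
    then show ?thesis unfolding nsum by (simp add: abs_square_le_1)
  qed
  \<comment> \<open>\<open>\<phi>\<close> and \<open>\<theta>\<close> are antiderivatives of the two
    majorants of \<open>g'\<close>, before and after time \<open>T\<close>; at \<open>T\<close> both
    produce the factor \<open>exp (- (\<epsilon> * D / v))\<close>.\<close>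
  define T where "T = D / v"
  have T: "0 < T" using D v by (simp add: T_def)
  define \<phi> where "\<phi> t = cmod \<kappa> * C * exp (- c * D) / (c * v - \<epsilon>) * exp ((c * v - \<epsilon>) * t)" for t :: real
  define \<theta> where "\<theta> t = - cmod \<kappa> / \<epsilon> * exp (- \<epsilon> * t)" for t :: real
  have "norm (g T - g 0) \<le> \<phi> T - \<phi> 0"
  proof (rule differentiable_bound_general[OF T gc])
    show "continuous_on {0..T} \<phi>" unfolding \<phi>_def by (intro continuous_intros)
    fix t assume t: "0 < t" "t < T"
    show "(g has_vector_derivative g' t) (at t)" by (rule gd)
    show "(\<phi> has_vector_derivative cmod \<kappa> * C * exp (- c * D) * exp ((c * v - \<epsilon>) * t)) (at t)"
      unfolding \<phi>_def has_real_derivative_iff_has_vector_derivative[symmetric]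
      using eps by (auto intro!: derivative_eq_intros)
    have "cmod (g' t) \<le> cmod \<kappa> * exp (- \<epsilon> * t) * (C * exp (- c * (D - v * t)))"
      unfolding ng' using LR[of t] t by (intro mult_left_mono) auto
    also have "\<dots> = cmod \<kappa> * C * (exp (- \<epsilon> * t) * exp (- c * (D - v * t)))" by simp
    also have "exp (- \<epsilon> * t) * exp (- c * (D - v * t)) = exp (- c * D) * exp ((c * v - \<epsilon>) * t)"
      unfolding exp_add[symmetric] by (simp add: algebra_simps)
    finally show "norm (g' t) \<le> cmod \<kappa> * C * exp (- c * D) * exp ((c * v - \<epsilon>) * t)" by simp
  qed
  also have "\<dots> \<le> \<phi> T" using C eps by (simp add: \<phi>_def)
  also have "\<phi> T = cmod \<kappa> * (C / (c * v - \<epsilon>)) * (exp (- c * D) * exp ((c * v - \<epsilon>) * T))"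
    by (simp add: \<phi>_def)
  also have "exp (- c * D) * exp ((c * v - \<epsilon>) * T) = exp (- (\<epsilon> * D / v))"
    unfolding exp_add[symmetric] T_def using v by (simp add: field_simps)
  finally have 1: "norm (g T - g 0) \<le> cmod \<kappa> * (C / (c * v - \<epsilon>)) * exp (- (\<epsilon> * D / v))" .
  have 2: "norm (g s - g T) \<le> cmod \<kappa> * (1 / \<epsilon>) * exp (- (\<epsilon> * D / v))" if "T < s" for s
  proof -
    have "norm (g s - g T) \<le> \<theta> s - \<theta> T"
    proof (rule differentiable_bound_general[OF that gc])
      show "continuous_on {T..s} \<theta>" unfolding \<theta>_def by (intro continuous_intros)
      fix t assume t: "T < t" "t < s"
      show "(g has_vector_derivative g' t) (at t)" by (rule gd)
      show "(\<theta> has_vector_derivative cmod \<kappa> * exp (- \<epsilon> * t)) (at t)"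
        unfolding \<theta>_def has_real_derivative_iff_has_vector_derivative[symmetric]
        using eps by (auto intro!: derivative_eq_intros)
      show "norm (g' t) \<le> cmod \<kappa> * exp (- \<epsilon> * t)"
        unfolding ng' using psi1[of "L - 1" t] L mult_left_mono[of "cmod (\<psi> (L - 1) t)" 1 "cmod \<kappa> * exp (- \<epsilon> * t)"] by simp
    qed
    also have "\<dots> \<le> - \<theta> T" using eps by (simp add: \<theta>_def)
    finally show ?thesis by (simp add: \<theta>_def T_def)
  qed
  let ?B = "cmod \<kappa> * (C / (c * v - \<epsilon>) + 1 / \<epsilon>) * exp (- (\<epsilon> * D / v))"
  have g0: "g 0 = 1"
  proof -
    have "(\<Sum>j<L. \<psi> j 0 * u j) = (\<Sum>j<L. if j = 0 then u j else 0)"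
      by (intro sum.cong refl) (simp add: init)
    then show ?thesis using L u0 by (simp add: g_def)
  qed
  \<comment> \<open>The amplitudes are bounded by 1 and \<open>Im w\<close> is positive, so
    \<open>g s\<close> tends to 0 as \<open>s\<close> grows; hence \<open>g 0 = 1\<close> is bounded
    by the total change of \<open>g\<close>.\<close>
  define U where "U = (\<Sum>j<L. cmod (u j))"
  have "1 - exp (- \<epsilon> * s) * U \<le> ?B" if "T < s" for s
  proof -
    have "cmod (\<Sum>j<L. \<psi> j s * u j) \<le> (\<Sum>j<L. cmod (\<psi> j s) * cmod (u j))"
      by (rule order_trans[OF norm_sum]) (simp add: norm_mult)
    also have "\<dots> \<le> U"
      unfolding U_def using mult_right_mono[OF psi1 norm_ge_zero] by (intro sum_mono) force
    finally have "cmod (g s) \<le> exp (- \<epsilon> * s) * U" unfolding g_def norm_mult ne by simp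
    moreover have "1 \<le> cmod (g s) + (norm (g s - g T) + norm (g T - g 0))"
      using norm_triangle_ineq[of "g s - g T" "g T - g 0"] norm_triangle_ineq4[of "g s" "g s - g 0"] by (simp add: g0)
    ultimately show ?thesis using 1 2[OF that] by (simp add: algebra_simps)
  qed
  then have "eventually (\<lambda>s. 1 - exp (- \<epsilon> * s) * U \<le> ?B) at_top"
    by (intro eventually_mono[OF eventually_gt_at_top[of T]])
  moreover have "((\<lambda>s. 1 - exp (- \<epsilon> * s) * U) \<longlongrightarrow> 1 - 0 * U) at_top"
    using eps by (intro tendsto_intros) real_asymp
  ultimately show ?thesis
    using tendsto_upperbound[of "\<lambda>s. 1 - exp (- \<epsilon> * s) * U" 1 at_top ?B] by simp
qed

section \<open>The one-flip sector of the spin chain\<close>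

lemma spin_dim_nat: "0 < L \<Longrightarrow> spin_dim 0 (int L - 1) = 2 ^ L"
  by (simp add: spin_dim_def)

text \<open>On a chain that starts at site 0, \<open>spin_digit\<close> reads off a bit, so all
  questions about basis states become questions about bits below \<open>L\<close>.\<close>

lemma nat_less_exp_iff_bit: "r < 2 ^ L \<longleftrightarrow> (\<forall>i\<ge>L. \<not> bit r i)" for r :: nat
proof
  assume "r < 2 ^ L"
  then have "take_bit L r = r" by (simp add: take_bit_nat_eq_self_iff)
  then show "\<forall>i\<ge>L. \<not> bit r i" by (metis bit_take_bit_iff not_less)
next
  assume "\<forall>i\<ge>L. \<not> bit r i"
  then have "take_bit L r = r" by (intro bit_eqI) (metis bit_take_bit_iff not_less)
  then show "r < 2 ^ L" by (simp add: take_bit_nat_eq_self_iff)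
qed

lemma nat_eq_iff_bits: "r < 2 ^ L \<Longrightarrow> s < 2 ^ L \<Longrightarrow> r = s \<longleftrightarrow> (\<forall>i<L. bit r i = bit s i)" for r s :: nat
  unfolding nat_less_exp_iff_bit bit_eq_iff by simp (metis leI)

lemma spin_site_dim [simp]:
  "dim_row (spin_site m n j A) = spin_dim m n" "dim_col (spin_site m n j A) = spin_dim m n"
  by (simp_all add: spin_site_def spin_tensor_def)

lemma int_interval_image: "{0..int L - 1} = int ` {..<L}"
  by (auto simp: image_iff intro!: bexI[of _ "nat _"])

lemma spin_site_entry:
  assumes r: "r < 2 ^ L" and s: "s < 2 ^ L" and j: "j < L"
  shows "spin_site 0 (int L - 1) (int j) A $$ (r, s) =
    (if \<forall>i<L. i \<noteq> j \<longrightarrow> bit r i = bit s i then A $$ (of_bool (bit r j), of_bool (bit s j)) else 0)"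
proof -
  have dig: "spin_digit 0 r (int i) = of_bool (bit r i)" for r i
    by (simp add: spin_digit_def bit_iff_odd mod_2_eq_odd)
  have "spin_site 0 (int L - 1) (int j) A $$ (r, s) =
      (\<Prod>i<L. (if i = j then A else 1\<^sub>m 2) $$ (of_bool (bit r i), of_bool (bit s i)))"
    using r s j by (simp add: spin_site_def spin_tensor_def spin_dim_nat int_interval_image prod.reindex dig)
  also have "\<dots> = (\<Prod>i<L. if i = j then A $$ (of_bool (bit r j), of_bool (bit s j)) else of_bool (bit r i = bit s i))"
    by (intro prod.cong refl) (auto simp: one_mat_def)
  also have "\<dots> = A $$ (of_bool (bit r j), of_bool (bit s j)) * (\<Prod>i\<in>{..<L} - {j}. of_bool (bit r i = bit s i))"
    using j by (subst prod.remove[of _ j]) (auto intro!: arg_cong2[where f = "(*)"] prod.cong)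
  also have "(\<Prod>i\<in>{..<L} - {j}. of_bool (bit r i = bit s i)) = (of_bool (\<forall>i<L. i \<noteq> j \<longrightarrow> bit r i = bit s i) :: complex)"
    by (auto intro!: prod.neutral prod_zero)
  finally show ?thesis by simp
qed

lemma index_mult_single:
  fixes M N :: "complex mat"
  assumes M: "dim_col M = d" and N: "dim_row N = d" and "r < dim_row M" "s < dim_col N" "p0 < d"
    and z: "\<And>p. p < d \<Longrightarrow> p \<noteq> p0 \<Longrightarrow> M $$ (r, p) * N $$ (p, s) = 0"
  shows "(M * N) $$ (r, s) = M $$ (r, p0) * N $$ (p0, s)"
proof -
  have "(M * N) $$ (r, s) = (\<Sum>p<d. M $$ (r, p) * N $$ (p, s))"
    using assms by (simp add: scalar_prod_def atLeast0LessThan)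
  also have "\<dots> = (\<Sum>p\<in>{p0}. M $$ (r, p) * N $$ (p, s))"
    using assms by (intro sum.mono_neutral_right) auto
  finally show ?thesis by simp
qed

lemma spin_site_mult_entry:
  assumes r: "r < 2 ^ L" and s: "s < 2 ^ L" and j: "j < L" and k: "k < L" and jk: "j \<noteq> k"
  shows "(spin_site 0 (int L - 1) (int j) A * spin_site 0 (int L - 1) (int k) B) $$ (r, s) =
    (if \<forall>i<L. i \<noteq> j \<longrightarrow> i \<noteq> k \<longrightarrow> bit r i = bit s i
     then A $$ (of_bool (bit r j), of_bool (bit s j)) * B $$ (of_bool (bit r k), of_bool (bit s k)) else 0)"
proof -
  \<comment> \<open>The only possible intermediate state: the left factor changes site
    \<open>j\<close> alone and the right factor site \<open>k\<close> alone, so it agrees with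
    \<open>s\<close> at \<open>j\<close> and with \<open>r\<close> elsewhere.\<close>
  define p0 where "p0 = (if bit s j then set_bit j r else unset_bit j r)"
  have bp: "bit p0 i = (if i = j then bit s i else bit r i)" for i
    by (auto simp: p0_def bit_set_bit_iff bit_unset_bit_iff)
  have p0: "p0 < 2 ^ L"
    using r s unfolding nat_less_exp_iff_bit bp by auto
  have L: "0 < L" using j by simp
  note [simp] = spin_dim_nat[OF L]
  have "(spin_site 0 (int L - 1) (int j) A * spin_site 0 (int L - 1) (int k) B) $$ (r, s)
     = spin_site 0 (int L - 1) (int j) A $$ (r, p0) * spin_site 0 (int L - 1) (int k) B $$ (p0, s)"
  proof (rule index_mult_single[where d = "2 ^ L"])
    fix p assume p: "p < 2 ^ L" "p \<noteq> p0"
    show "spin_site 0 (int L - 1) (int j) A $$ (r, p) * spin_site 0 (int L - 1) (int k) B $$ (p, s) = 0"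
    proof (rule ccontr)
      assume "\<not> ?thesis"
      then have "\<forall>i<L. i \<noteq> j \<longrightarrow> bit r i = bit p i" "\<forall>i<L. i \<noteq> k \<longrightarrow> bit p i = bit s i"
        using spin_site_entry[OF r p(1) j, of A] spin_site_entry[OF p(1) s k, of B] by (metis mult_zero_left mult_zero_right)+
      then have "\<forall>i<L. bit p i = bit p0 i" unfolding bp using jk j by auto
      then show False using p nat_eq_iff_bits[OF p(1) p0] by simp
    qed
  qed (use r s p0 in auto)
  also have "\<dots> = (if \<forall>i<L. i \<noteq> j \<longrightarrow> i \<noteq> k \<longrightarrow> bit r i = bit s i
     then A $$ (of_bool (bit r j), of_bool (bit s j)) * B $$ (of_bool (bit r k), of_bool (bit s k)) else 0)"
    unfolding spin_site_entry[OF r p0 j] spin_site_entry[OF p0 s k] bp using jk by auto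
  finally show ?thesis .
qed

lemma pauli_entries:
  "pauli_x $$ (of_bool p, of_bool q) = of_bool (p \<noteq> q)"
  "pauli_y $$ (of_bool p, of_bool q) = (if p = q then 0 else if p then \<i> else - \<i>)"
  "pauli_z $$ (of_bool p, of_bool q) = (if p = q then if p then - 1 else 1 else 0)"
  by (cases p; cases q; simp add: pauli_x_def pauli_y_def pauli_z_def mat_of_rows_list_def)+

text \<open>When both spins of a bond flip, the x and y terms add up to 2 if the spins are
  antiparallel and cancel if they are parallel. Hence the number of flipped spins is
  conserved.\<close>

lemma xy_bond_entry:
  assumes r: "r < 2 ^ L" and s: "s < 2 ^ L" and j: "Suc j < L"
  shows "(spin_site 0 (int L - 1) (int j) pauli_x * spin_site 0 (int L - 1) (int j + 1) pauli_x
        + spin_site 0 (int L - 1) (int j) pauli_y * spin_site 0 (int L - 1) (int j + 1) pauli_y) $$ (r, s) =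
    (if (\<forall>i<L. i \<noteq> j \<longrightarrow> i \<noteq> Suc j \<longrightarrow> bit r i = bit s i)
        \<and> bit r j \<noteq> bit s j \<and> bit r (Suc j) \<noteq> bit s (Suc j) \<and> bit r j \<noteq> bit r (Suc j) then 2 else 0)"
proof -
  have L: "0 < L" using j by simp
  have Sj: "int j + 1 = int (Suc j)" by simp
  have jL: "j < L" "j \<noteq> Suc j" using j by auto
  have add: "(P + Q) $$ (r, s) = P $$ (r, s) + Q $$ (r, s)"
    if "dim_row Q = spin_dim 0 (int L - 1)" "dim_col Q = spin_dim 0 (int L - 1)" for P Q :: "complex mat"
    using that r s by (intro index_add_mat(1)) (simp_all add: spin_dim_nat[OF L])
  show ?thesis
    unfolding Sj
    by (subst add, simp, simp)
       (unfold spin_site_mult_entry[OF r s jL(1) j jL(2)] pauli_entries, auto)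
qed

lemma xy_hamiltonian_dim [simp]:
  "dim_row (xy_hamiltonian \<mu> \<nu> m n) = spin_dim m n" "dim_col (xy_hamiltonian \<mu> \<nu> m n) = spin_dim m n"
  by (simp_all add: xy_hamiltonian_def mat_fsum_def)

lemma xy_hamiltonian_entry:
  assumes r: "r < 2 ^ L" and s: "s < 2 ^ L" and L: "0 < L"
  shows "xy_hamiltonian \<mu> \<nu> 0 (int L - 1) $$ (r, s) =
    - (\<Sum>j<L - 1. of_real (\<mu> (int j)) * (if (\<forall>i<L. i \<noteq> j \<longrightarrow> i \<noteq> Suc j \<longrightarrow> bit r i = bit s i)
        \<and> bit r j \<noteq> bit s j \<and> bit r (Suc j) \<noteq> bit s (Suc j) \<and> bit r j \<noteq> bit r (Suc j) then 2 else 0))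
    - (if r = s then of_real (\<Sum>j<L. \<nu> (int j) * (if bit r j then - 1 else 1)) else 0)"
proof -
  note [simp] = spin_dim_nat[OF L]
  have int2: "{0..int L - 1 - 1} = int ` {..<L - 1}"
    using int_interval_image[of "L - 1"] L by (simp add: of_nat_diff)
  have "xy_hamiltonian \<mu> \<nu> 0 (int L - 1) $$ (r, s) =
     - (\<Sum>j<L - 1. (complex_of_real (\<mu> (int j)) \<cdot>\<^sub>m
            (spin_site 0 (int L - 1) (int j) pauli_x * spin_site 0 (int L - 1) (int j + 1) pauli_x
             + spin_site 0 (int L - 1) (int j) pauli_y * spin_site 0 (int L - 1) (int j + 1) pauli_y)) $$ (r, s))
     - (\<Sum>j<L. (complex_of_real (\<nu> (int j)) \<cdot>\<^sub>m spin_site 0 (int L - 1) (int j) pauli_z) $$ (r, s))"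
    using r s unfolding xy_hamiltonian_def mat_fsum_def int2
    by (subst index_minus_mat) (auto simp: int_interval_image sum.reindex)
  also have "(\<Sum>j<L - 1. (complex_of_real (\<mu> (int j)) \<cdot>\<^sub>m
            (spin_site 0 (int L - 1) (int j) pauli_x * spin_site 0 (int L - 1) (int j + 1) pauli_x
             + spin_site 0 (int L - 1) (int j) pauli_y * spin_site 0 (int L - 1) (int j + 1) pauli_y)) $$ (r, s))
     = (\<Sum>j<L - 1. of_real (\<mu> (int j)) * (if (\<forall>i<L. i \<noteq> j \<longrightarrow> i \<noteq> Suc j \<longrightarrow> bit r i = bit s i)
        \<and> bit r j \<noteq> bit s j \<and> bit r (Suc j) \<noteq> bit s (Suc j) \<and> bit r j \<noteq> bit r (Suc j) then 2 else 0))"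
  proof (intro sum.cong refl)
    fix j assume "j \<in> {..<L - 1}"
    then have j: "Suc j < L" by auto
    show "(complex_of_real (\<mu> (int j)) \<cdot>\<^sub>m
            (spin_site 0 (int L - 1) (int j) pauli_x * spin_site 0 (int L - 1) (int j + 1) pauli_x
             + spin_site 0 (int L - 1) (int j) pauli_y * spin_site 0 (int L - 1) (int j + 1) pauli_y)) $$ (r, s)
     = of_real (\<mu> (int j)) * (if (\<forall>i<L. i \<noteq> j \<longrightarrow> i \<noteq> Suc j \<longrightarrow> bit r i = bit s i)
        \<and> bit r j \<noteq> bit s j \<and> bit r (Suc j) \<noteq> bit s (Suc j) \<and> bit r j \<noteq> bit r (Suc j) then 2 else 0)"
      unfolding xy_bond_entry[OF r s j, symmetric] using r s by (intro index_smult_mat(1)) auto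
  qed
  also have "(\<Sum>j<L. (complex_of_real (\<nu> (int j)) \<cdot>\<^sub>m spin_site 0 (int L - 1) (int j) pauli_z) $$ (r, s))
     = (if r = s then of_real (\<Sum>j<L. \<nu> (int j) * (if bit r j then - 1 else 1)) else 0)"
  proof (cases "r = s")
    case True
    then show ?thesis using r s by (simp add: spin_site_entry pauli_entries cong: if_cong) (intro sum.cong refl, simp)
  next
    case False
    then obtain i where i: "i < L" "bit r i \<noteq> bit s i" using nat_eq_iff_bits[OF r s] by auto
    have "(complex_of_real (\<nu> (int j)) \<cdot>\<^sub>m spin_site 0 (int L - 1) (int j) pauli_z) $$ (r, s) = 0" if "j < L" for j
      using that r s i by (auto simp: spin_site_entry pauli_entries)
    then show ?thesis using False by simp
  qed
  finally show ?thesis .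
qed

text \<open>The basis vector with exactly one flipped spin, at site \<open>k\<close>, has number \<open>2 ^ k\<close>; the one without flips has
  number 0 and energy minus the sum of the \<open>\<nu>\<close> values.\<close>

definition hop :: "(int \<Rightarrow> real) \<Rightarrow> (int \<Rightarrow> real) \<Rightarrow> nat \<Rightarrow> nat \<Rightarrow> nat \<Rightarrow> real" where
  "hop \<mu> \<nu> L k i =
     (if k = Suc i then - 2 * \<mu> (int i) else if i = Suc k then - 2 * \<mu> (int k)
      else if i = k then 2 * \<nu> (int i) - (\<Sum>j<L. \<nu> (int j)) else 0)"

lemma xy_hamiltonian_one_flip:
  assumes i: "i < L"
  shows "r < 2 ^ L \<Longrightarrow> (\<And>k. k < L \<Longrightarrow> r \<noteq> 2 ^ k) \<Longrightarrow> xy_hamiltonian \<mu> \<nu> 0 (int L - 1) $$ (r, 2 ^ i) = 0"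
    and "k < L \<Longrightarrow> xy_hamiltonian \<mu> \<nu> 0 (int L - 1) $$ (2 ^ k, 2 ^ i) = of_real (hop \<mu> \<nu> L k i)"
proof -
  have L: "0 < L" using i by simp
  have s: "(2::nat) ^ i < 2 ^ L" using i by simp
  \<comment> \<open>Bond \<open>j\<close> acts on a one-flip state only if the flip sits at one of
    its ends, and then moves it to the other end.\<close>
  have cond: "(\<forall>l<L. l \<noteq> j \<longrightarrow> l \<noteq> Suc j \<longrightarrow> bit r l = bit ((2::nat) ^ i) l)
        \<and> bit r j \<noteq> bit ((2::nat) ^ i) j \<and> bit r (Suc j) \<noteq> bit ((2::nat) ^ i) (Suc j) \<and> bit r j \<noteq> bit r (Suc j)
     \<longleftrightarrow> (i = j \<and> r = 2 ^ Suc j) \<or> (i = Suc j \<and> r = 2 ^ j)"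
    if r: "r < 2 ^ L" and j: "j < L - 1" for r j :: nat
  proof -
    have j': "Suc j < L" "j < L" using j by auto
    have p: "(2::nat) ^ Suc j < 2 ^ L" "(2::nat) ^ j < 2 ^ L" using j' by (intro power_strict_increasing; simp)+
    show ?thesis
      unfolding nat_eq_iff_bits[OF r p(1)] nat_eq_iff_bits[OF r p(2)] bit_exp_iff
      using j' i by (auto simp: )
  qed
  show "xy_hamiltonian \<mu> \<nu> 0 (int L - 1) $$ (r, 2 ^ i) = 0" if r: "r < 2 ^ L" and ne: "\<And>k. k < L \<Longrightarrow> r \<noteq> 2 ^ k"
  proof -
    have "(if (\<forall>l<L. l \<noteq> j \<longrightarrow> l \<noteq> Suc j \<longrightarrow> bit r l = bit ((2::nat) ^ i) l)
        \<and> bit r j \<noteq> bit ((2::nat) ^ i) j \<and> bit r (Suc j) \<noteq> bit ((2::nat) ^ i) (Suc j) \<and> bit r j \<noteq> bit r (Suc j) then 2 else 0)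
      = (0 :: complex)" if j: "j < L - 1" for j
      unfolding cond[OF r j] using ne[of j] ne[of "Suc j"] j by auto
    then show ?thesis
      unfolding xy_hamiltonian_entry[OF r s L] using ne[of i] i by simp
  qed
  show "xy_hamiltonian \<mu> \<nu> 0 (int L - 1) $$ (2 ^ k, 2 ^ i) = of_real (hop \<mu> \<nu> L k i)" if k: "k < L"
  proof -
    have r: "(2::nat) ^ k < 2 ^ L" using k by simp
    have "(\<Sum>j<L - 1. of_real (\<mu> (int j)) * (if (\<forall>l<L. l \<noteq> j \<longrightarrow> l \<noteq> Suc j \<longrightarrow> bit ((2::nat) ^ k) l = bit ((2::nat) ^ i) l)
        \<and> bit ((2::nat) ^ k) j \<noteq> bit ((2::nat) ^ i) j \<and> bit ((2::nat) ^ k) (Suc j) \<noteq> bit ((2::nat) ^ i) (Suc j)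
        \<and> bit ((2::nat) ^ k) j \<noteq> bit ((2::nat) ^ k) (Suc j) then 2 else 0))
      = (\<Sum>j<L - 1. of_real (if j = i \<and> k = Suc i then 2 * \<mu> (int j) else 0) + complex_of_real (if j = k \<and> i = Suc k then 2 * \<mu> (int j) else 0))"
    proof (intro sum.cong refl)
      fix j assume "j \<in> {..<L - 1}"
      then have j: "j < L - 1" by simp
      show "of_real (\<mu> (int j)) * (if (\<forall>l<L. l \<noteq> j \<longrightarrow> l \<noteq> Suc j \<longrightarrow> bit ((2::nat) ^ k) l = bit ((2::nat) ^ i) l)
        \<and> bit ((2::nat) ^ k) j \<noteq> bit ((2::nat) ^ i) j \<and> bit ((2::nat) ^ k) (Suc j) \<noteq> bit ((2::nat) ^ i) (Suc j)
        \<and> bit ((2::nat) ^ k) j \<noteq> bit ((2::nat) ^ k) (Suc j) then 2 else 0)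
        = of_real (if j = i \<and> k = Suc i then 2 * \<mu> (int j) else 0) + complex_of_real (if j = k \<and> i = Suc k then 2 * \<mu> (int j) else 0)"
        unfolding cond[OF r j] by (auto simp del: power_Suc)
    qed
    also have "\<dots> = of_real ((if k = Suc i then 2 * \<mu> (int i) else 0) + (if i = Suc k then 2 * \<mu> (int k) else 0))"
    proof -
      have "(\<Sum>j<L - 1. if j = i \<and> k = Suc i then 2 * \<mu> (int j) else 0) = (if k = Suc i then 2 * \<mu> (int i) else 0)"
        using k by (auto simp: if_distrib sum.delta)
      moreover have "(\<Sum>j<L - 1. if j = k \<and> i = Suc k then 2 * \<mu> (int j) else 0) = (if i = Suc k then 2 * \<mu> (int k) else 0)"
        using i by auto
      ultimately show ?thesis by (simp add: sum.distrib flip: of_real_sum)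
    qed
    finally have e1: "(\<Sum>j<L - 1. of_real (\<mu> (int j)) * (if (\<forall>l<L. l \<noteq> j \<longrightarrow> l \<noteq> Suc j \<longrightarrow> bit ((2::nat) ^ k) l = bit ((2::nat) ^ i) l)
        \<and> bit ((2::nat) ^ k) j \<noteq> bit ((2::nat) ^ i) j \<and> bit ((2::nat) ^ k) (Suc j) \<noteq> bit ((2::nat) ^ i) (Suc j)
        \<and> bit ((2::nat) ^ k) j \<noteq> bit ((2::nat) ^ k) (Suc j) then 2 else 0))
      = complex_of_real ((if k = Suc i then 2 * \<mu> (int i) else 0) + (if i = Suc k then 2 * \<mu> (int k) else 0))" .
    have e2: "(\<Sum>j<L. \<nu> (int j) * (if bit ((2::nat) ^ k) j then - 1 else 1)) = (\<Sum>j<L. \<nu> (int j)) - 2 * \<nu> (int k)"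
    proof -
      have "(\<Sum>j<L. \<nu> (int j) * (if bit ((2::nat) ^ k) j then - 1 else 1)) = (\<Sum>j<L. \<nu> (int j) - (if j = k then 2 * \<nu> (int k) else 0))"
        by (intro sum.cong refl) (auto simp: bit_exp_iff)
      then show ?thesis using k by (simp add: sum_subtractf)
    qed
    show ?thesis
      unfolding xy_hamiltonian_entry[OF r s L] e1 e2 hop_def by auto
  qed
qed

text \<open>In the state without flips all neighbours are parallel, so every bond vanishes and only
  the field term remains.\<close>

lemma xy_hamiltonian_vacuum:
  assumes L: "0 < L" and p: "p < 2 ^ L"
  shows "xy_hamiltonian \<mu> \<nu> 0 (int L - 1) $$ (0, p) = (if p = 0 then - of_real (\<Sum>j<L. \<nu> (int j)) else 0)"
proof -
  have r: "(0::nat) < 2 ^ L" by simp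
  show ?thesis unfolding xy_hamiltonian_entry[OF r p L] by auto
qed

section \<open>Powers and exponential of the Hamiltonian on states with at most one flip\<close>

lemma pow_mat_Suc_entry:
  fixes A :: "complex mat"
  assumes "A \<in> carrier_mat d d" "r < d" "s < d"
  shows "(A ^\<^sub>m Suc k) $$ (r, s) = (\<Sum>p<d. (A ^\<^sub>m k) $$ (r, p) * A $$ (p, s))"
  using assms by (simp add: scalar_prod_def atLeast0LessThan)

lemma one_less_two_power: "0 < L \<Longrightarrow> (1::nat) < 2 ^ L"
  by (rule one_less_power) auto

text \<open>Row 0 of the \<open>k\<close>-th power of \<open>h\<close> restricted to
  \<open>L\<close> sites: the one-particle state starts at site 0, so no other row is
  needed.\<close>

primrec hop_pow :: "(nat \<Rightarrow> nat \<Rightarrow> real) \<Rightarrow> nat \<Rightarrow> nat \<Rightarrow> nat \<Rightarrow> real" where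
  "hop_pow h L 0 j = of_bool (j = 0)"
| "hop_pow h L (Suc k) j = (\<Sum>i<L. hop_pow h L k i * h i j)"

text \<open>Entry \<open>(0, j)\<close> of the exponential of \<open>x\<close> times
  \<open>h\<close>, kept as a complex power series so that it can be differentiated
  termwise.\<close>

definition hop_flow :: "(nat \<Rightarrow> nat \<Rightarrow> real) \<Rightarrow> nat \<Rightarrow> nat \<Rightarrow> complex \<Rightarrow> complex" where
  "hop_flow h L j x = (\<Sum>k. (of_real (hop_pow h L k j) / fact k) * x ^ k)"

lemma hop_pow_bound:
  "(\<Sum>j<L. \<bar>hop_pow h L k j\<bar>) \<le> (\<Sum>i<L. \<Sum>j<L. \<bar>h i j\<bar>) ^ k"
proof (induction k)
  case 0
  have "(\<Sum>j<L. \<bar>hop_pow h L 0 j\<bar>) = (\<Sum>j<L. if j = 0 then 1 else 0)"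
    by (intro sum.cong refl) auto
  then show ?case by (simp add: sum.delta)
next
  case (Suc k)
  let ?R = "\<Sum>i<L. \<Sum>j<L. \<bar>h i j\<bar>"
  have "(\<Sum>j<L. \<bar>hop_pow h L (Suc k) j\<bar>) \<le> (\<Sum>j<L. \<Sum>i<L. \<bar>hop_pow h L k i\<bar> * \<bar>h i j\<bar>)"
    by (intro sum_mono) (auto simp: abs_mult intro: order_trans[OF sum_abs])
  also have "\<dots> = (\<Sum>i<L. \<bar>hop_pow h L k i\<bar> * (\<Sum>j<L. \<bar>h i j\<bar>))"
    by (subst sum.swap) (simp add: sum_distrib_left)
  also have "\<dots> \<le> (\<Sum>i<L. \<bar>hop_pow h L k i\<bar> * ?R)"
    by (intro sum_mono mult_left_mono member_le_sum[where f = "\<lambda>i. \<Sum>j<L. \<bar>h i j\<bar>"]) (auto intro: sum_nonneg)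
  also have "\<dots> = (\<Sum>i<L. \<bar>hop_pow h L k i\<bar>) * ?R" by (simp add: sum_distrib_right)
  also have "\<dots> \<le> ?R ^ k * ?R" by (intro mult_right_mono Suc sum_nonneg) auto
  finally show ?case by (simp add: mult.commute)
qed

lemma hop_flow_summable:
  assumes j: "j < L"
  shows "summable (\<lambda>k. (of_real (hop_pow h L k j) / fact k) * x ^ k :: complex)"
proof (rule summable_comparison_test')
  let ?R = "\<Sum>i<L. \<Sum>j<L. \<bar>h i j\<bar>"
  show "summable (\<lambda>k. inverse (fact k) * (?R * cmod x) ^ k)" by (rule summable_exp)
  fix k :: nat assume "0 \<le> k"
  have "\<bar>hop_pow h L k j\<bar> \<le> (\<Sum>j<L. \<bar>hop_pow h L k j\<bar>)" using j by (intro member_le_sum) auto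
  also have "\<dots> \<le> ?R ^ k" by (rule hop_pow_bound)
  finally have "\<bar>hop_pow h L k j\<bar> * cmod x ^ k / fact k \<le> ?R ^ k * cmod x ^ k / fact k"
    by (intro divide_right_mono mult_right_mono) auto
  then show "norm ((of_real (hop_pow h L k j) / fact k) * x ^ k) \<le> inverse (fact k) * (?R * cmod x) ^ k"
    by (simp add: norm_mult norm_divide norm_power power_mult_distrib field_simps)
qed

lemma hop_flow_deriv:
  assumes j: "j < L"
  shows "(hop_flow h L j has_field_derivative (\<Sum>i<L. of_real (h i j) * hop_flow h L i x)) (at x)"
proof -
  define c where "c k = of_real (hop_pow h L k j) / (fact k :: complex)" for k
  have "(hop_flow h L j has_field_derivative (\<Sum>k. diffs c k * x ^ k)) (at x)"
    unfolding hop_flow_def[abs_def] c_def[symmetric]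
    by (rule termdiffs_strong_converges_everywhere) (unfold c_def, rule hop_flow_summable[OF j])
  also have "(\<lambda>k. diffs c k * x ^ k) = (\<lambda>k. \<Sum>i<L. of_real (h i j) * ((of_real (hop_pow h L k i) / fact k) * x ^ k))"
  proof
    fix k
    have "diffs c k = of_real (hop_pow h L (Suc k) j) / fact k"
      by (simp add: diffs_def c_def fact_Suc field_simps del: hop_pow.simps of_nat_Suc)
    then show "diffs c k * x ^ k = (\<Sum>i<L. of_real (h i j) * ((of_real (hop_pow h L k i) / fact k) * x ^ k))"
      by (simp add: sum_distrib_left sum_distrib_right sum_divide_distrib mult_ac)
  qed
  also have "(\<Sum>k. \<Sum>i<L. of_real (h i j) * ((of_real (hop_pow h L k i) / fact k) * x ^ k))
     = (\<Sum>i<L. \<Sum>k. of_real (h i j) * ((of_real (hop_pow h L k i) / fact k) * x ^ k))"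
    by (intro suminf_sum summable_mult hop_flow_summable) auto
  also have "\<dots> = (\<Sum>i<L. of_real (h i j) * hop_flow h L i x)"
    unfolding hop_flow_def by (intro sum.cong refl suminf_mult hop_flow_summable) auto
  finally show ?thesis .
qed

lemma hop_flow_ode:
  assumes j: "j < L"
  shows "((\<lambda>t. hop_flow h L j (- \<i> * of_real t)) has_vector_derivative
     (- \<i> * (\<Sum>i<L. of_real (h i j) * hop_flow h L i (- \<i> * of_real t)))) (at t)"
proof -
  have "((\<lambda>z. hop_flow h L j (- \<i> * z)) has_field_derivative
      (\<Sum>i<L. of_real (h i j) * hop_flow h L i (- \<i> * of_real t)) * (- \<i>)) (at (of_real t))"
    by (rule DERIV_chain2[OF hop_flow_deriv[OF j]]) (auto intro!: derivative_eq_intros)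
  from has_vector_derivative_real_field[OF this] show ?thesis by (simp add: mult_ac)
qed

lemma hop_flow_0: "hop_flow h L j 0 = of_bool (j = 0)"
  unfolding hop_flow_def using powser_zero[of "\<lambda>k. of_real (hop_pow h L k j) / (fact k :: complex)"] by simp

context
  fixes \<mu> \<nu> :: "int \<Rightarrow> real" and L :: nat
  assumes L: "0 < L"
begin

private abbreviation "H \<equiv> xy_hamiltonian \<mu> \<nu> 0 (int L - 1)"

lemma H_carrier: "H \<in> carrier_mat (2 ^ L) (2 ^ L)" "c \<cdot>\<^sub>m H \<in> carrier_mat (2 ^ L) (2 ^ L)"
  by (auto simp: spin_dim_nat[OF L])

lemma pow_vacuum_row:
  assumes "p < 2 ^ L"
  shows "((c \<cdot>\<^sub>m H) ^\<^sub>m k) $$ (0, p) = (if p = 0 then (- c * of_real (\<Sum>j<L. \<nu> (int j))) ^ k else 0)"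
  using assms
proof (induction k arbitrary: p)
  case 0
  then show ?case using H_carrier(2)[of c] by (simp add: spin_dim_nat[OF L])
next
  case (Suc k)
  have "((c \<cdot>\<^sub>m H) ^\<^sub>m Suc k) $$ (0, p) = (\<Sum>s<2 ^ L. ((c \<cdot>\<^sub>m H) ^\<^sub>m k) $$ (0, s) * (c \<cdot>\<^sub>m H) $$ (s, p))"
    by (rule pow_mat_Suc_entry[OF H_carrier(2)]) (use Suc.prems in auto)
  also have "\<dots> = (\<Sum>s<(2::nat) ^ L. if s = 0 then (- c * of_real (\<Sum>j<L. \<nu> (int j))) ^ k * (c \<cdot>\<^sub>m H) $$ (0, p) else 0)"
    by (intro sum.cong refl) (simp add: Suc.IH)
  also have "\<dots> = (- c * of_real (\<Sum>j<L. \<nu> (int j))) ^ k * (c \<cdot>\<^sub>m H) $$ (0, p)"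
    by (simp add: sum.delta)
  also have "(c \<cdot>\<^sub>m H) $$ (0, p) = c * H $$ (0, p)"
    using Suc.prems by (intro index_smult_mat(1)) (simp_all add: spin_dim_nat[OF L])
  also have "H $$ (0, p) = (if p = 0 then - of_real (\<Sum>j<L. \<nu> (int j)) else 0)"
    by (rule xy_hamiltonian_vacuum[OF L Suc.prems])
  finally show ?case by simp
qed

text \<open>Row 1 is row \<open>2 ^ 0\<close>, the flip at site 0. In each product only one-flip
  intermediate states survive, by the conservation of flips, so the large matrix power reduces to
  the small one.\<close>

lemma pow_one_flip_row:
  assumes "j < L"
  shows "((c \<cdot>\<^sub>m H) ^\<^sub>m k) $$ (1, 2 ^ j) = c ^ k * of_real (hop_pow (hop \<mu> \<nu> L) L k j)"
  using assms
proof (induction k arbitrary: j)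
  case 0
  have "(2::nat) ^ j < 2 ^ L" using 0 by simp
  moreover have "Suc 0 = 2 ^ j \<longleftrightarrow> j = 0" by (cases j) auto
  ultimately show ?case using one_less_two_power[OF L] by (auto simp: one_mat_def spin_dim_nat[OF L])
next
  case (Suc k)
  let ?M = "c \<cdot>\<^sub>m H"
  have j: "(2::nat) ^ j < 2 ^ L" using Suc.prems by simp
  note 1 = one_less_two_power[OF L]
  have M: "?M $$ (p, 2 ^ j) = c * H $$ (p, 2 ^ j)" if "p < 2 ^ L" for p
    using that j by (intro index_smult_mat(1)) (simp_all add: spin_dim_nat[OF L])
  have "(?M ^\<^sub>m Suc k) $$ (1, 2 ^ j) = (\<Sum>p<2 ^ L. (?M ^\<^sub>m k) $$ (1, p) * ?M $$ (p, 2 ^ j))"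
    by (rule pow_mat_Suc_entry[OF H_carrier(2) 1 j])
  also have "\<dots> = (\<Sum>p\<in>(\<lambda>i. 2 ^ i) ` {..<L}. (?M ^\<^sub>m k) $$ (1, p) * ?M $$ (p, 2 ^ j))"
  proof (rule sum.mono_neutral_right)
    have "H $$ (p, 2 ^ j) = 0" if "p < 2 ^ L" "p \<notin> (\<lambda>i. 2 ^ i) ` {..<L}" for p
      using xy_hamiltonian_one_flip(1)[OF Suc.prems that(1)] that(2) by auto
    then show "\<forall>p\<in>{..<2 ^ L} - (\<lambda>i. 2 ^ i) ` {..<L}. (?M ^\<^sub>m k) $$ (1, p) * ?M $$ (p, 2 ^ j) = 0"
      by (auto simp: M)
  qed auto
  also have "\<dots> = (\<Sum>i<L. (?M ^\<^sub>m k) $$ (1, 2 ^ i) * ?M $$ (2 ^ i, 2 ^ j))"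
    by (subst sum.reindex) (auto simp: inj_on_def)
  also have "\<dots> = (\<Sum>i<L. c ^ Suc k * of_real (hop_pow (hop \<mu> \<nu> L) L k i * hop \<mu> \<nu> L i j))"
  proof (intro sum.cong refl)
    fix i assume "i \<in> {..<L}"
    then have i: "i < L" by simp
    then show "(?M ^\<^sub>m k) $$ (1, 2 ^ i) * ?M $$ (2 ^ i, 2 ^ j) = c ^ Suc k * of_real (hop_pow (hop \<mu> \<nu> L) L k i * hop \<mu> \<nu> L i j)"
      by (simp add: Suc.IH[OF i, unfolded One_nat_def] M xy_hamiltonian_one_flip(2)[OF Suc.prems i])
  qed
  finally show ?case by (simp add: sum_distrib_left)
qed

lemma exp_entry:
  assumes "r < 2 ^ L" "s < 2 ^ L"
  shows "mat_exp (c \<cdot>\<^sub>m H) $$ (r, s) = (\<Sum>k. ((c \<cdot>\<^sub>m H) ^\<^sub>m k) $$ (r, s) / fact k)"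
  using assms by (simp add: mat_exp_def spin_dim_nat[OF L])

lemma exp_vacuum_row:
  assumes "p < 2 ^ L"
  shows "mat_exp (c \<cdot>\<^sub>m H) $$ (0, p) = (if p = 0 then exp (- c * of_real (\<Sum>j<L. \<nu> (int j))) else 0)"
proof (cases "p = 0")
  case True
  have 0: "(0::nat) < 2 ^ L" by simp
  show ?thesis
    unfolding True exp_entry[OF 0 0] pow_vacuum_row[OF 0] exp_def by (simp add: scaleR_conv_of_real field_simps)
next
  case False
  have 0: "(0::nat) < 2 ^ L" by simp
  show ?thesis using False unfolding exp_entry[OF 0 assms] pow_vacuum_row[OF assms] by simp
qed

lemma exp_one_flip_row:
  assumes j: "j < L"
  shows "mat_exp (c \<cdot>\<^sub>m H) $$ (1, 2 ^ j) = hop_flow (hop \<mu> \<nu> L) L j c"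
proof -
  have "(2::nat) ^ j < 2 ^ L" using j by simp
  then show ?thesis
    unfolding hop_flow_def using one_less_two_power[OF L] by (simp add: exp_entry pow_one_flip_row[OF j, unfolded One_nat_def] mult.commute)
qed

end

section \<open>Ladder operators and operator norms\<close>

text \<open>The names refer to the number of flips: \<open>lower_mat\<close> takes digit 1 to digit
  0 and \<open>raise_mat\<close> does the reverse.\<close>

definition lower_mat :: "complex mat" where "lower_mat = mat_of_rows_list 2 [[0, 1], [0, 0]]"
definition raise_mat :: "complex mat" where "raise_mat = mat_of_rows_list 2 [[0, 0], [1, 0]]"

lemma ladder_entries:
  "lower_mat $$ (of_bool p, of_bool q) = of_bool (\<not> p \<and> q)"
  "raise_mat $$ (of_bool p, of_bool q) = of_bool (p \<and> \<not> q)"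
  by (cases p; cases q; simp add: lower_mat_def raise_mat_def mat_of_rows_list_def)+

lemma ladder_carrier: "lower_mat \<in> carrier_mat 2 2" "raise_mat \<in> carrier_mat 2 2"
  by (auto simp: lower_mat_def raise_mat_def mat_of_rows_list_def numeral_2_eq_2 intro!: carrier_matI)

lemma spin_site_observable:
  assumes "A \<in> carrier_mat 2 2"
  shows "spin_site m n j A \<in> spin_observables m n {j}"
  unfolding spin_observables_def
proof (intro CollectI exI conjI)
  show "spin_site m n j A = mat_fsum (spin_dim m n)
      (\<lambda>k. spin_tensor m n (\<lambda>i. if i \<in> {j} then (\<lambda>_ _. A) k i else 1\<^sub>m 2)) {..<1::nat}"
    by (intro eq_matI) (auto simp: mat_fsum_def spin_site_def spin_tensor_def)
qed (use assms in auto)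

text \<open>The supremum in \<open>l2_op_norm\<close> majorises its members only once they are known
  to be bounded; row sums of moduli provide a bound.\<close>

lemma l2_op_norm_bdd:
  "bdd_above ((\<lambda>v. l2_vec_norm (M *\<^sub>v v)) ` {v \<in> carrier_vec (dim_col M). l2_vec_norm v \<le> 1})"
proof (rule bdd_aboveI2)
  fix v :: "complex Matrix.vec" assume "v \<in> {v \<in> carrier_vec (dim_col M). l2_vec_norm v \<le> 1}"
  then have d: "dim_vec v = dim_col M" and n: "l2_vec_norm v \<le> 1" by auto
  have v1: "cmod (v $ s) \<le> 1" if "s < dim_col M" for s
  proof -
    have "(cmod (v $ s))\<^sup>2 \<le> (\<Sum>i<dim_vec v. (cmod (v $ i))\<^sup>2)"
      using that d by (intro member_le_sum) auto
    also have "\<dots> \<le> 1" using n by (simp add: l2_vec_norm_def)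
    finally show ?thesis by (simp add: abs_square_le_1)
  qed
  have "cmod ((M *\<^sub>v v) $ r) \<le> (\<Sum>s<dim_col M. cmod (M $$ (r, s)))" if r: "r < dim_row M" for r
  proof -
    have "(M *\<^sub>v v) $ r = (\<Sum>s<dim_col M. M $$ (r, s) * v $ s)"
      using r d by (simp add: scalar_prod_def atLeast0LessThan)
    then have "cmod ((M *\<^sub>v v) $ r) \<le> (\<Sum>s<dim_col M. cmod (M $$ (r, s)) * cmod (v $ s))"
      using norm_sum[of "\<lambda>s. M $$ (r, s) * v $ s" "{..<dim_col M}"] by (simp add: norm_mult)
    also have "\<dots> \<le> (\<Sum>s<dim_col M. cmod (M $$ (r, s)) * 1)"
      by (intro sum_mono mult_left_mono v1) auto
    finally show ?thesis by simp
  qed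
  then show "l2_vec_norm (M *\<^sub>v v) \<le> sqrt (\<Sum>r<dim_row M. (\<Sum>s<dim_col M. cmod (M $$ (r, s)))\<^sup>2)"
    unfolding l2_vec_norm_def by (auto intro!: sum_mono power_mono)
qed

lemma entry_le_l2_op_norm:
  assumes r: "r < dim_row M" and s: "s < dim_col M"
  shows "cmod (M $$ (r, s)) \<le> l2_op_norm M"
proof -
  let ?e = "unit_vec (dim_col M) s :: complex Matrix.vec"
  have "(\<Sum>i<dim_col M. (cmod (?e $ i))\<^sup>2) = (\<Sum>i<dim_col M. if i = s then 1 else 0)"
    by (intro sum.cong refl) (auto simp: s)
  then have "l2_vec_norm ?e \<le> 1" using s by (simp add: l2_vec_norm_def)
  then have "l2_vec_norm (M *\<^sub>v ?e) \<le> l2_op_norm M"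
    unfolding l2_op_norm_def by (intro cSUP_upper l2_op_norm_bdd) auto
  moreover have "cmod (M $$ (r, s)) \<le> l2_vec_norm (M *\<^sub>v ?e)"
  proof -
    have "(M *\<^sub>v ?e) $ r = M $$ (r, s)" using r s by simp
    then have "(cmod (M $$ (r, s)))\<^sup>2 \<le> (\<Sum>i<dim_vec (M *\<^sub>v ?e). (cmod ((M *\<^sub>v ?e) $ i))\<^sup>2)"
      using r member_le_sum[of r "{..<dim_vec (M *\<^sub>v ?e)}" "\<lambda>i. (cmod ((M *\<^sub>v ?e) $ i))\<^sup>2"] by auto
    then show ?thesis unfolding l2_vec_norm_def by (rule real_le_rsqrt)
  qed
  ultimately show ?thesis by linarith
qed

text \<open>Such a matrix picks coordinates of the vector without repetition and puts 0 elsewhere,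
  so it cannot increase the norm.\<close>

lemma l2_op_norm_partial_perm:
  assumes d: "dim_row M = d" "dim_col M = d" "0 < d"
    and M: "\<And>r s. r < d \<Longrightarrow> s < d \<Longrightarrow> M $$ (r, s) = of_bool (P r \<and> s = f r)"
    and f: "\<And>r. r < d \<Longrightarrow> P r \<Longrightarrow> f r < d" and inj: "inj_on f {r \<in> {..<d}. P r}"
  shows "0 \<le> l2_op_norm M" "l2_op_norm M \<le> 1"
proof -
  show "0 \<le> l2_op_norm M" using entry_le_l2_op_norm[of 0 M 0] d norm_ge_zero order_trans by metis
  have "l2_vec_norm (M *\<^sub>v v) \<le> 1" if "v \<in> carrier_vec (dim_col M)" "l2_vec_norm v \<le> 1" for v
  proof -
    have dv: "dim_vec v = d" using that d by auto
    have e: "(M *\<^sub>v v) $ r = (if P r then v $ f r else 0)" if r: "r < d" for r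
    proof -
      have "(M *\<^sub>v v) $ r = (\<Sum>s<d. M $$ (r, s) * v $ s)"
        using r d dv by (simp add: scalar_prod_def atLeast0LessThan)
      also have "\<dots> = (\<Sum>s<d. if s = f r then (if P r then v $ s else 0) else 0)"
        using r by (intro sum.cong refl) (auto simp: M)
      finally show ?thesis using f[OF r] by (auto simp: sum.delta)
    qed
    have "(\<Sum>r<d. (cmod ((M *\<^sub>v v) $ r))\<^sup>2) = (\<Sum>r<d. if P r then (cmod (v $ f r))\<^sup>2 else 0)"
      by (intro sum.cong refl) (auto simp: e)
    also have "\<dots> = (\<Sum>r\<in>{r \<in> {..<d}. P r}. (cmod (v $ f r))\<^sup>2)"
      by (rule sum.inter_filter[symmetric]) simp
    also have "\<dots> = (\<Sum>s\<in>f ` {r \<in> {..<d}. P r}. (cmod (v $ s))\<^sup>2)"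
      by (subst sum.reindex[OF inj]) simp
    also have "\<dots> \<le> (\<Sum>s<d. (cmod (v $ s))\<^sup>2)"
      using f by (intro sum_mono2) auto
    finally have "l2_vec_norm (M *\<^sub>v v) \<le> l2_vec_norm v"
      unfolding l2_vec_norm_def using d dv by simp
    then show ?thesis using that by linarith
  qed
  moreover have "0\<^sub>v (dim_col M) \<in> {v \<in> carrier_vec (dim_col M). l2_vec_norm v \<le> 1}"
    by (simp add: l2_vec_norm_def)
  ultimately show "l2_op_norm M \<le> 1"
    unfolding l2_op_norm_def by (intro cSUP_least) blast+
qed

lemma ladder_norm:
  assumes j: "j < L"
  shows "0 \<le> l2_op_norm (spin_site 0 (int L - 1) (int j) lower_mat)"
    "l2_op_norm (spin_site 0 (int L - 1) (int j) lower_mat) \<le> 1"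
    "0 \<le> l2_op_norm (spin_site 0 (int L - 1) (int j) raise_mat)"
    "l2_op_norm (spin_site 0 (int L - 1) (int j) raise_mat) \<le> 1"
proof -
  have L: "0 < L" using j by simp
  have sb: "bit (set_bit j r) i \<longleftrightarrow> i = j \<or> bit r i" and ub: "bit (unset_bit j r) i \<longleftrightarrow> i \<noteq> j \<and> bit r i" for r i :: nat
    by (auto simp: bit_set_bit_iff bit_unset_bit_iff)
  have lt: "set_bit j r < 2 ^ L" "unset_bit j r < 2 ^ L" if "r < 2 ^ L" for r :: nat
    using that j unfolding nat_less_exp_iff_bit sb ub by auto
  have l: "spin_site 0 (int L - 1) (int j) lower_mat $$ (r, s) = of_bool (\<not> bit r j \<and> s = set_bit j r)"
    and ra: "spin_site 0 (int L - 1) (int j) raise_mat $$ (r, s) = of_bool (bit r j \<and> s = unset_bit j r)"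
    if r: "r < 2 ^ L" and s: "s < 2 ^ L" for r s
    unfolding spin_site_entry[OF r s j] ladder_entries nat_eq_iff_bits[OF s lt(1)[OF r]]
      nat_eq_iff_bits[OF s lt(2)[OF r]] sb ub using j by auto
  have inj1: "inj_on (set_bit j) {r \<in> {..<(2::nat) ^ L}. \<not> bit r j}"
  proof (rule inj_onI)
    fix x y :: nat
    assume xy: "x \<in> {r \<in> {..<2 ^ L}. \<not> bit r j}" "y \<in> {r \<in> {..<2 ^ L}. \<not> bit r j}" "set_bit j x = set_bit j y"
    have "bit x i = bit y i" for i using sb[of x i] sb[of y i] xy by (cases "i = j") auto
    then show "x = y" by (intro bit_eqI) auto
  qed
  have inj2: "inj_on (unset_bit j) {r \<in> {..<(2::nat) ^ L}. bit r j}"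
  proof (rule inj_onI)
    fix x y :: nat
    assume xy: "x \<in> {r \<in> {..<2 ^ L}. bit r j}" "y \<in> {r \<in> {..<2 ^ L}. bit r j}" "unset_bit j x = unset_bit j y"
    have "bit x i = bit y i" for i using ub[of x i] ub[of y i] xy by (cases "i = j") auto
    then show "x = y" by (intro bit_eqI) auto
  qed
  show "0 \<le> l2_op_norm (spin_site 0 (int L - 1) (int j) lower_mat)"
    "l2_op_norm (spin_site 0 (int L - 1) (int j) lower_mat) \<le> 1"
    by (rule l2_op_norm_partial_perm[where d = "2 ^ L", OF _ _ _ l _ inj1]; simp add: spin_dim_nat[OF L] lt)+
  show "0 \<le> l2_op_norm (spin_site 0 (int L - 1) (int j) raise_mat)"
    "l2_op_norm (spin_site 0 (int L - 1) (int j) raise_mat) \<le> 1"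
    by (rule l2_op_norm_partial_perm[where d = "2 ^ L", OF _ _ _ ra _ inj2]; simp add: spin_dim_nat[OF L] lt)+
qed

text \<open>Row 0 of \<open>B\<close> vanishes, which removes one product of the commutator; in the
  other, each factor admits one intermediate state only.\<close>

lemma commutator_vacuum_entry:
  fixes U V A B :: "complex mat"
  assumes c: "U \<in> carrier_mat d d" "V \<in> carrier_mat d d" "A \<in> carrier_mat d d" "B \<in> carrier_mat d d"
    and lt: "0 < d" "p < d" "q < d"
    and U: "\<And>s. s < d \<Longrightarrow> s \<noteq> 0 \<Longrightarrow> U $$ (0, s) = 0"
    and A: "\<And>s. s < d \<Longrightarrow> A $$ (0, s) = of_bool (s = p)"
    and B: "\<And>s. s < d \<Longrightarrow> B $$ (0, s) = 0" "\<And>s. s < d \<Longrightarrow> B $$ (s, 0) = of_bool (s = q)"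
  shows "mat_commutator (U * A * V) B $$ (0, 0) = U $$ (0, 0) * V $$ (p, q)"
proof -
  have UA: "(U * A) $$ (0, s) = U $$ (0, 0) * of_bool (s = p)" if "s < d" for s
    using c lt that by (subst index_mult_single[where d = d and ?p0.0 = 0]) (auto simp: U A)
  have UAV: "(U * A * V) $$ (0, s) = U $$ (0, 0) * V $$ (p, s)" if "s < d" for s
    using c lt that by (subst index_mult_single[where d = d and ?p0.0 = p]) (auto simp: UA simp del: index_mult_mat(1) assoc_mult_mat)
  have "q \<noteq> 0" using B(1)[of 0] B(2)[of 0] lt by auto
  then have 1: "(U * A * V * B) $$ (0, 0) = U $$ (0, 0) * V $$ (p, q)"
    using c lt by (subst index_mult_single[where d = d and ?p0.0 = q]) (auto simp: UAV B simp del: index_mult_mat(1) assoc_mult_mat)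
  have 2: "(B * (U * A * V)) $$ (0, 0) = 0"
    using c lt by (subst index_mult_single[where d = d and ?p0.0 = 0]) (auto simp: B(1) simp del: index_mult_mat(1) assoc_mult_mat)
  show ?thesis
    unfolding mat_commutator_def using c lt 1 2 by (subst index_minus_mat(1)) (auto simp del: index_mult_mat(1) assoc_mult_mat assoc_mult_mat)
qed

lemma lieb_robinson_one_particle:
  assumes LR: "lieb_robinson_bound \<mu> \<nu> C c v" and L: "2 \<le> L" and C: "0 < C"
  shows "cmod (hop_flow (hop \<mu> \<nu> L) L (L - 1) (- \<i> * of_real t)) \<le> C * exp (- c * (real (L - 1) - v * \<bar>t\<bar>))"
proof -
  have L0: "0 < L" and L1: "L - 1 < L" using L by auto
  let ?n = "int L - 1"
  have n: "?n = int (L - 1)" using L by simp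
  let ?H = "xy_hamiltonian \<mu> \<nu> 0 ?n"
  \<comment> \<open>\<open>A\<close> removes a flip at site 0 and \<open>B\<close> creates one at
    the last site. As \<open>2 \<le> L\<close>, the supports are disjoint, at distance
    \<open>L - 1\<close>.\<close>
  define A where "A = spin_site 0 ?n (int 0) lower_mat"
  define B where "B = spin_site 0 ?n (int (L - 1)) raise_mat"
  define U where "U = mat_exp ((\<i> * complex_of_real t) \<cdot>\<^sub>m ?H)"
  define V where "V = mat_exp ((- \<i> * complex_of_real t) \<cdot>\<^sub>m ?H)"
  have cA: "A \<in> carrier_mat (2 ^ L) (2 ^ L)" and cB: "B \<in> carrier_mat (2 ^ L) (2 ^ L)"
    and cU: "U \<in> carrier_mat (2 ^ L) (2 ^ L)" and cV: "V \<in> carrier_mat (2 ^ L) (2 ^ L)"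
    by (auto simp: A_def B_def U_def V_def mat_exp_def spin_dim_nat[OF L0])
  have lt: "(0::nat) < 2 ^ L" "(2::nat) ^ 0 < 2 ^ L" "(2::nat) ^ (L - 1) < 2 ^ L"
    using L0 L1 one_less_two_power[OF L0] by simp_all
  have entry: "mat_commutator (xy_evolution \<mu> \<nu> 0 ?n t A) B $$ (0, 0) = U $$ (0, 0) * V $$ (2 ^ 0, 2 ^ (L - 1))"
    unfolding xy_evolution_def U_def[symmetric] V_def[symmetric]
  proof (rule commutator_vacuum_entry[OF cU cV cA cB lt])
    fix s :: nat assume s: "s < 2 ^ L"
    show "U $$ (0, s) = 0" if "s \<noteq> 0" using that unfolding U_def exp_vacuum_row[OF L0 s] by simp
    show "A $$ (0, s) = of_bool (s = 2 ^ 0)"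
      unfolding A_def spin_site_entry[OF lt(1) s L0] ladder_entries nat_eq_iff_bits[OF s lt(2)] bit_exp_iff using L0 by auto
    show "B $$ (0, s) = 0"
      unfolding B_def spin_site_entry[OF lt(1) s L1] ladder_entries by simp
    show "B $$ (s, 0) = of_bool (s = 2 ^ (L - 1))"
      unfolding B_def spin_site_entry[OF s lt(1) L1] ladder_entries nat_eq_iff_bits[OF s lt(3)] bit_exp_iff using L1 by auto
  qed
  have "cmod (U $$ (0, 0)) = 1"
    unfolding U_def exp_vacuum_row[OF L0 lt(1)] by (simp add: norm_exp_eq_Re)
  moreover have "V $$ (2 ^ 0, 2 ^ (L - 1)) = hop_flow (hop \<mu> \<nu> L) L (L - 1) (- \<i> * of_real t)"
    unfolding V_def using exp_one_flip_row[OF L0 L1] by simp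
  ultimately have "cmod (hop_flow (hop \<mu> \<nu> L) L (L - 1) (- \<i> * of_real t))
      = cmod (mat_commutator (xy_evolution \<mu> \<nu> 0 ?n t A) B $$ (0, 0))"
    unfolding entry by (simp add: norm_mult)
  also have "\<dots> \<le> l2_op_norm (mat_commutator (xy_evolution \<mu> \<nu> 0 ?n t A) B)"
    unfolding mat_commutator_def xy_evolution_def U_def[symmetric] V_def[symmetric] using cU cV cA cB
    by (intro entry_le_l2_op_norm) auto
  also have "\<dots> \<le> C * l2_op_norm A * l2_op_norm B * exp (- c * (real_of_int (site_dist {int 0} {int (L - 1)}) - v * \<bar>t\<bar>))"
  proof -
    have obs: "A \<in> spin_observables 0 ?n {int 0}" "B \<in> spin_observables 0 ?n {int (L - 1)}"
      unfolding A_def B_def by (intro spin_site_observable ladder_carrier)+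
    have "0 \<le> ?n" "{int 0} \<subseteq> {0..?n}" "{int (L - 1)} \<subseteq> {0..?n}" "{int 0} \<inter> {int (L - 1)} = {}"
      using L by auto
    then show ?thesis
      using LR[unfolded lieb_robinson_bound_def, rule_format, of 0 ?n "{int 0}" "{int (L - 1)}" A B t] obs by simp
  qed
  also have "site_dist {int 0} {int (L - 1)} = int (L - 1)" by (simp add: site_dist_def)
  also have "C * l2_op_norm A * l2_op_norm B * exp (- c * (real_of_int (int (L - 1)) - v * \<bar>t\<bar>))
      \<le> C * 1 * 1 * exp (- c * (real_of_int (int (L - 1)) - v * \<bar>t\<bar>))"
    unfolding A_def B_def using ladder_norm[OF L0] ladder_norm[OF L1] C
    by (intro mult_right_mono mult_mono) auto
  finally show ?thesis by simp
qed

section \<open>The lower bound for the velocity\<close>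

text \<open>\<open>hop\<close> is minus the Jacobi matrix minus the sum of the \<open>\<nu>\<close>
  values, so a Jacobi solution at \<open>z\<close> satisfies the eigenvalue equation at all sites
  but the last, where the missing neighbour leaves the Dirichlet value at \<open>L\<close> as the
  defect.\<close>

lemma hop_jsol:
  fixes \<mu> \<nu> :: "int \<Rightarrow> real" and L :: nat and z :: complex
  defines "a \<equiv> \<lambda>k. 2 * \<mu> (int k)" and "b \<equiv> \<lambda>k. - 2 * \<nu> (int k)"
  assumes i: "i < L" and nz: "\<And>k. a k \<noteq> 0"
  shows "(\<Sum>j<L. of_real (hop \<mu> \<nu> L i j) * fst (jsol a b z (1, 0) j))
    = (- of_real (\<Sum>j<L. \<nu> (int j)) - z) * fst (jsol a b z (1, 0) i)
      - (if i = L - 1 then - of_real (a (L - 1)) * fst (jsol a b z (1, 0) L) else 0)"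
proof -
  define e0 where "e0 = (\<Sum>j<L. \<nu> (int j))"
  define u where "u j = fst (jsol a b z (1, 0) j)" for j
  define y where "y j = snd (jsol a b z (1, 0) j)" for j
  have rec: "of_real (a i) * u (Suc i) = (z - of_real (b i)) * u i - y i" for i
    using nz[of i] by (simp add: u_def y_def)
  have ySuc: "y (Suc m) = of_real (a m) * u m" for m by (simp add: u_def y_def)
  have y0: "y 0 = 0" by (simp add: y_def)
  have s1: "(\<Sum>j<L. if i = Suc j then of_real (a j) * u j else 0) = y i"
  proof (cases i)
    case (Suc m)
    have "(\<Sum>j<L. if i = Suc j then of_real (a j) * u j else 0) = (\<Sum>j<L. if j = m then of_real (a j) * u j else 0)"
      by (intro sum.cong refl) (auto simp: Suc)
    then show ?thesis using i by (simp add: Suc ySuc)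
  qed (simp add: y0)
  have s2: "(\<Sum>j<L. if j = Suc i then of_real (a i) * u j else 0) = (if i = L - 1 then 0 else of_real (a i) * u (Suc i))"
    using i by auto
  have "(\<Sum>j<L. of_real (hop \<mu> \<nu> L i j) * u j)
     = (\<Sum>j<L. - (if i = Suc j then of_real (a j) * u j else 0) - (if j = Suc i then of_real (a i) * u j else 0)
          + (if j = i then of_real (- b i - e0) * u i else 0))"
    by (intro sum.cong refl) (auto simp: hop_def a_def b_def e0_def)
  also have "\<dots> = - y i - (if i = L - 1 then 0 else of_real (a i) * u (Suc i)) + of_real (- b i - e0) * u i"
    using i by (simp add: sum.distrib sum_subtractf sum_negf s1 s2)
  also have "\<dots> = (- of_real e0 - z) * u i - (if i = L - 1 then - of_real (a (L - 1)) * u L else 0)"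
  proof (cases "i = L - 1")
    case True
    then have "L = Suc i" using i by simp
    then show ?thesis using rec[of i] by (simp add: algebra_simps)
  next
    case False
    then show ?thesis using rec[of i] by (simp add: algebra_simps)
  qed
  finally show ?thesis by (simp add: u_def e0_def)
qed

text \<open>The energy is taken below the real axis because the flow is governed by minus the Jacobi
  matrix: the corresponding \<open>w\<close> then has imaginary part \<open>\<epsilon>\<close>, as
  \<open>flow_amplitude_bound\<close> requires.\<close>

lemma dirichlet_lower_bound:
  fixes \<mu> \<nu> :: "int \<Rightarrow> real" and L :: nat and E :: real
  defines "a \<equiv> \<lambda>k. 2 * \<mu> (int k)" and "b \<equiv> \<lambda>k. - 2 * \<nu> (int k)"
  assumes adm: "jac_adm G a b" and LR: "lieb_robinson_bound \<mu> \<nu> C c v" and L: "2 \<le> L"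
    and C: "0 < C" and v: "0 < v" and eps: "0 < \<epsilon>" "\<epsilon> < c * v"
  shows "1 \<le> G * cmod (fst (jsol a b (Complex E (- \<epsilon>)) (1, 0) L)) * (C / (c * v - \<epsilon>) + 1 / \<epsilon>) * exp (- (\<epsilon> * (L - 1) / v))"
proof -
  define z where "z = Complex E (- \<epsilon>)"
  define u where "u j = fst (jsol a b z (1, 0) j)" for j
  have nz: "\<And>k. a k \<noteq> 0" using jac_admD(2)[OF adm] by (metis less_irrefl)
  have LL: "0 < L" "L - 1 < L" "0 < real (L - 1)" using L by auto
  let ?\<kappa> = "- of_real (a (L - 1)) * u L"
  have "1 \<le> cmod ?\<kappa> * (C / (c * v - \<epsilon>) + 1 / \<epsilon>) * exp (- (\<epsilon> * real (L - 1) / v))"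
  proof (rule flow_amplitude_bound[OF LL(1) _ _ _ _ _ _ eps v LL(3) C,
      where h = "hop \<mu> \<nu> L" and \<psi> = "\<lambda>j t. hop_flow (hop \<mu> \<nu> L) L j (- \<i> * of_real t)" and u = u
        and w = "- of_real (\<Sum>j<L. \<nu> (int j)) - z"])
    show "hop \<mu> \<nu> L i j = hop \<mu> \<nu> L j i" for i j by (simp add: hop_def)
    show "(\<Sum>j<L. of_real (hop \<mu> \<nu> L i j) * u j)
       = (- of_real (\<Sum>j<L. \<nu> (int j)) - z) * u i - (if i = L - 1 then ?\<kappa> else 0)" if "i < L" for i
      unfolding u_def a_def b_def by (rule hop_jsol[OF that]) (use nz in \<open>simp add: a_def\<close>)
    show "cmod (hop_flow (hop \<mu> \<nu> L) L (L - 1) (- \<i> * of_real t)) \<le> C * exp (- c * (real (L - 1) - v * t))"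
      if "0 \<le> t" for t
      using lieb_robinson_one_particle[OF LR L C, of t] that by simp
    show "((\<lambda>t. hop_flow (hop \<mu> \<nu> L) L j (- \<i> * of_real t)) has_vector_derivative
      (- \<i> * (\<Sum>i<L. of_real (hop \<mu> \<nu> L i j) * hop_flow (hop \<mu> \<nu> L) L i (- \<i> * of_real t)))) (at t)"
      if "j < L" for j t using that by (rule hop_flow_ode)
  qed (auto simp: hop_flow_0 u_def z_def)
  also have "\<dots> \<le> G * cmod (u L) * (C / (c * v - \<epsilon>) + 1 / \<epsilon>) * exp (- (\<epsilon> * real (L - 1) / v))"
    using jac_admD(2,4)[OF adm, of "L - 1"] C eps
    by (intro mult_right_mono) (auto simp: norm_mult intro: mult_right_mono)
  finally show ?thesis by (simp add: u_def z_def)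
qed

text \<open>\<open>1 / P\<close> bounds the Dirichlet polynomial from below at height
  \<open>- \<epsilon>\<close>, \<open>M\<close> bounds it from above on \<open>S\<close>. Moving
  down from a real energy multiplies the factor of each real zero by \<open>s i\<close>, and the
  logarithms of the \<open>s i\<close> are the kernels averaged before.\<close>

lemma dirichlet_average:
  fixes L :: nat
  assumes nz: "\<And>k. a k \<noteq> 0" and L: "0 < L" and eps: "0 < \<epsilon>" and P: "0 < P" and M: "0 < M"
    and low: "\<And>E. 1 \<le> P * cmod (fst (jsol a b (Complex E (- \<epsilon>)) (1, 0) L))"
    and S: "S \<in> fmeasurable lborel" and up: "\<And>E. E \<in> S \<Longrightarrow> cmod (fst (jsol a b (of_real E) (1, 0) L)) \<le> M"
  shows "(- ln P - ln M) * measure lborel S \<le> L * (pi * \<epsilon>)"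
proof -
  obtain p where p: "\<And>z. poly p z = fst (jsol a b z (1, 0) L)" "degree p = L"
    using jsol_poly_cos[where a = a and b = b and k = L, OF nz] by blast
  obtain k x where k: "0 < k" and F: "\<And>z. cmod (poly p z) = k * (\<Prod>i<L. cmod (z - of_real (x i)))"
    using poly_real_factorization[of p] dirichlet_root_real[where a = a, OF nz L] p L by metis
  show ?thesis
  proof (rule log_kernel_average[OF S _ eps, of "x ` {..<L}"])
    fix E assume E: "E \<in> S" and N: "E \<notin> x ` {..<L}"
    have ne: "0 < \<bar>E - x i\<bar>" if "i < L" for i using N that by auto
    define s where "s i = sqrt (1 + \<epsilon>\<^sup>2 / (E - x i)\<^sup>2)" for i
    have s: "0 < s i" for i unfolding s_def by (simp add: add_pos_nonneg)
    have f: "cmod (Complex E (- \<epsilon>) - of_real (x i)) = \<bar>E - x i\<bar> * s i" if "i < L" for i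
    proof -
      have "cmod (Complex E (- \<epsilon>) - of_real (x i)) = sqrt ((E - x i)\<^sup>2 + \<epsilon>\<^sup>2)" by (simp add: cmod_def)
      also have "(E - x i)\<^sup>2 + \<epsilon>\<^sup>2 = (E - x i)\<^sup>2 * (1 + \<epsilon>\<^sup>2 / (E - x i)\<^sup>2)"
        using ne[OF that] by (simp add: algebra_simps)
      finally show ?thesis by (simp add: real_sqrt_mult s_def)
    qed
    let ?u = "\<lambda>z. fst (jsol a b z (1, 0) L)"
    have u: "cmod (?u z) = k * (\<Prod>i<L. cmod (z - of_real (x i)))" for z
      using F[of z] by (simp add: p)
    have pos: "0 < cmod (?u (of_real E))"
      unfolding u using k ne by (intro mult_pos_pos prod_pos) (auto simp flip: of_real_diff)
    have "cmod (?u (Complex E (- \<epsilon>))) = k * (\<Prod>i<L. \<bar>E - x i\<bar> * s i)"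
      unfolding u by (intro arg_cong2[where f = "(*)"] prod.cong refl) (simp add: f)
    also have "\<dots> = cmod (?u (of_real E)) * (\<Prod>i<L. s i)"
      unfolding u by (simp add: prod.distrib flip: of_real_diff)
    finally have eq: "cmod (?u (Complex E (- \<epsilon>))) = cmod (?u (of_real E)) * (\<Prod>i<L. s i)" .
    have sp: "0 < (\<Prod>i<L. s i)" using s by (intro prod_pos) auto
    have ln3: "ln (P * (M * Q)) = ln P + (ln M + ln Q)" if "0 < Q" for Q
      using P M that by (simp add: ln_mult)
    have "1 \<le> P * (cmod (?u (of_real E)) * (\<Prod>i<L. s i))" using low[of E] unfolding eq .
    also have "\<dots> \<le> P * (M * (\<Prod>i<L. s i))"
      using up[OF E] P sp by (intro mult_left_mono mult_right_mono) auto
    finally have "0 \<le> ln (P * (M * (\<Prod>i<L. s i)))" by simp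
    also have "\<dots> = ln P + (ln M + ln (\<Prod>i<L. s i))"
      by (rule ln3[OF sp])
    also have "ln (\<Prod>i<L. s i) = (\<Sum>i<L. ln (s i))" by (intro ln_prod) (use s less_irrefl in \<open>auto, metis\<close>)
    also have "\<dots> = (\<Sum>i<L. ln (1 + \<epsilon>\<^sup>2 / (E - x i)\<^sup>2) / 2)"
      by (intro sum.cong refl) (simp add: s_def ln_sqrt add_pos_nonneg)
    finally show "- ln P - ln M \<le> (\<Sum>i<L. ln (1 + \<epsilon>\<^sup>2 / (E - x i)\<^sup>2) / 2)" by simp
  qed simp
qed

text \<open>After division by \<open>X K ^ 20\<close> the constant and the logarithm disappear in
  the limit, which leaves \<open>z0 * (\<epsilon> / v) \<le> pi * \<epsilon>\<close>.\<close>

lemma velocity_limit: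
  fixes X :: "nat \<Rightarrow> real"
  assumes X: "filterlim X at_top sequentially" and z0: "0 < z0" and eps: "0 < \<epsilon>" and v: "0 < v"
    and le: "\<And>K. N \<le> K \<Longrightarrow> (\<epsilon> * (X K ^ 20 - 1) / v - c1 - 24 * ln (X K)) * z0 \<le> X K ^ 20 * (pi * \<epsilon>)"
  shows "z0 / pi \<le> v"
proof -
  have l1: "((\<lambda>x::real. 1 / x ^ 20) \<longlongrightarrow> 0) at_top" by real_asymp
  have l2: "((\<lambda>x::real. ln x / x ^ 20) \<longlongrightarrow> 0) at_top" by real_asymp
  have "(\<lambda>K. z0 * (\<epsilon> / v - (\<epsilon> / v) * (1 / X K ^ 20) - c1 * (1 / X K ^ 20) - 24 * (ln (X K) / X K ^ 20)))
      \<longlonglongrightarrow> z0 * (\<epsilon> / v - (\<epsilon> / v) * 0 - c1 * 0 - 24 * 0)"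
    by (intro tendsto_intros filterlim_compose[OF l1 X] filterlim_compose[OF l2 X])
  moreover have "eventually (\<lambda>K. z0 * (\<epsilon> / v - (\<epsilon> / v) * (1 / X K ^ 20) - c1 * (1 / X K ^ 20) - 24 * (ln (X K) / X K ^ 20)) \<le> pi * \<epsilon>) sequentially"
    using eventually_ge_at_top[of N] filterlim_at_top_dense[THEN iffD1, OF X, rule_format, of 0]
  proof eventually_elim
    case (elim K)
    have p: "0 < X K ^ 20" using elim(2) by simp
    have "z0 * (\<epsilon> / v - (\<epsilon> / v) * (1 / X K ^ 20) - c1 * (1 / X K ^ 20) - 24 * (ln (X K) / X K ^ 20))
       = ((\<epsilon> * (X K ^ 20 - 1) / v - c1 - 24 * ln (X K)) * z0) / X K ^ 20"
      using p v elim(2) by (simp add: field_simps)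
    also have "\<dots> \<le> pi * \<epsilon>" using le[OF elim(1)] p by (simp add: divide_le_eq mult_ac)
    finally show ?case .
  qed
  ultimately have "z0 * (\<epsilon> / v - (\<epsilon> / v) * 0 - c1 * 0 - 24 * 0) \<le> pi * \<epsilon>"
    by (intro tendsto_upperbound) auto
  then have "z0 \<le> pi * v" using eps v by (simp add: field_simps)
  then show ?thesis by (simp add: field_simps)
qed

section \<open>Selection of approximants by period\<close>

lemma linf_diff_le:
  assumes "in_linf x" "in_linf y"
  shows "\<bar>x j - y j\<bar> \<le> linf_norm (\<lambda>j. x j - y j)"
proof -
  obtain Mx My where M: "\<And>j. \<bar>x j\<bar> \<le> Mx" "\<And>j. \<bar>y j\<bar> \<le> My"
    using assms by (auto simp: in_linf_def bdd_above_def)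
  have "bdd_above (range (\<lambda>j. \<bar>x j - y j\<bar>))"
  proof (rule bdd_aboveI2)
    fix j show "\<bar>x j - y j\<bar> \<le> Mx + My" using M[of j] by linarith
  qed
  then show ?thesis unfolding linf_norm_def by (intro cSUP_upper) auto
qed

lemma linf_le: "in_linf x \<Longrightarrow> \<bar>x j\<bar> \<le> linf_norm x"
  unfolding in_linf_def linf_norm_def by (intro cSUP_upper) auto

text \<open>A uniform limit of \<open>q0\<close>-periodic sequences is \<open>q0\<close>-periodic,
  and a subsequence with this period is enough.\<close>

lemma periodic_of_frequent:
  assumes inf: "infinite {n. q n = q0}" and per: "\<And>n. 1 \<le> n \<Longrightarrow> periodic_seq (q n) (x' n)"
    and lim: "d \<longlonglongrightarrow> (0::real)" and d: "\<And>n j. 1 \<le> n \<Longrightarrow> \<bar>x j - x' n j\<bar> \<le> d n"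
  shows "periodic_seq q0 x"
  unfolding periodic_seq_def
proof
  fix j
  have "\<bar>x (j + int q0) - x j\<bar> \<le> 2 * e" if e: "0 < e" for e
  proof -
    obtain n0 where n0: "\<And>n. n0 \<le> n \<Longrightarrow> d n < e"
      using order_tendstoD(2)[OF lim e] by (auto simp: eventually_sequentially)
    obtain n where n: "max 1 n0 \<le> n" "q n = q0"
      using inf unfolding infinite_nat_iff_unbounded_le by blast
    have "x' n (j + int q0) = x' n j" using per[of n] n by (simp add: periodic_seq_def)
    then show ?thesis using d[of n "j + int q0"] d[of n j] n0[of n] n by simp
  qed
  then have "\<bar>x (j + int q0) - x j\<bar> \<le> e" if "0 < e" for e using that[THEN half_gt_zero] by fastforce
  then have "\<bar>x (j + int q0) - x j\<bar> \<le> 0" by (rule field_le_epsilon) simp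
  then show "x (j + int q0) = x j" by simp
qed

text \<open>The periods may fail to be monotone or unbounded. For a given bound \<open>K\<close> on the period, take the last
  approximant of period at most \<open>K\<close>; if there are infinitely many of these, the limit itself is periodic.\<close>

lemma approximants_by_period:
  fixes q :: "nat \<Rightarrow> nat" and \<mu>' \<nu>' :: "nat \<Rightarrow> int \<Rightarrow> real"
  assumes eta: "0 < \<eta>" and q: "\<And>n. 1 \<le> n \<Longrightarrow> 0 < q n"
    and linf: "in_linf \<mu>" "in_linf \<nu>" "\<And>n. 1 \<le> n \<Longrightarrow> in_linf (\<mu>' n)" "\<And>n. 1 \<le> n \<Longrightarrow> in_linf (\<nu>' n)"
    and per: "\<And>n. 1 \<le> n \<Longrightarrow> periodic_seq (q n) (\<mu>' n)" "\<And>n. 1 \<le> n \<Longrightarrow> periodic_seq (q n) (\<nu>' n)"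
    and lim: "(\<lambda>n. exp (\<eta> * real (q (n + 1))) * linf_norm (\<lambda>j. \<mu> j - \<mu>' n j)) \<longlonglongrightarrow> 0"
       "(\<lambda>n. exp (\<eta> * real (q (n + 1))) * linf_norm (\<lambda>j. \<nu> j - \<nu>' n j)) \<longlonglongrightarrow> 0"
  shows "\<exists>N\<ge>1. \<forall>K\<ge>N. \<exists>p x y. 0 < p \<and> p \<le> K \<and> periodic_seq p x \<and> periodic_seq p y
     \<and> (\<forall>j. \<bar>\<mu> j - x j\<bar> \<le> exp (- \<eta> * Suc K)) \<and> (\<forall>j. \<bar>\<nu> j - y j\<bar> \<le> exp (- \<eta> * Suc K))"
proof -
  define dm where "dm n = exp (\<eta> * real (q (n + 1))) * linf_norm (\<lambda>j. \<mu> j - \<mu>' n j)" for n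
  define dn where "dn n = exp (\<eta> * real (q (n + 1))) * linf_norm (\<lambda>j. \<nu> j - \<nu>' n j)" for n
  have m: "\<bar>\<mu> j - \<mu>' n j\<bar> \<le> exp (- \<eta> * real (q (n + 1))) * dm n" if "1 \<le> n" for n j
    using linf_diff_le[OF linf(1) linf(3)[OF that], of j] by (simp add: dm_def mult.assoc[symmetric] flip: exp_add)
  have n: "\<bar>\<nu> j - \<nu>' n j\<bar> \<le> exp (- \<eta> * real (q (n + 1))) * dn n" if "1 \<le> n" for n j
    using linf_diff_le[OF linf(2) linf(4)[OF that], of j] by (simp add: dn_def mult.assoc[symmetric] flip: exp_add)
  have e1: "exp (- \<eta> * real k) \<le> 1" for k using eta by simp
  have shrink: "t \<le> d" if "t \<le> e * d" "0 \<le> t" "0 < e" "e \<le> 1" for t e d :: real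
  proof -
    have "0 \<le> d" using that mult_pos_neg[of e d] by (intro leI notI) linarith
    then have "e * d \<le> 1 * d" using that by (intro mult_right_mono) auto
    then show ?thesis using that by simp
  qed
  have m': "\<bar>\<mu> j - \<mu>' n j\<bar> \<le> dm n" if "1 \<le> n" for n j
    by (rule shrink[OF m[OF that] _ _ e1]) simp_all
  have n': "\<bar>\<nu> j - \<nu>' n j\<bar> \<le> dn n" if "1 \<le> n" for n j
    by (rule shrink[OF n[OF that] _ _ e1]) simp_all
  show ?thesis
  proof (cases "\<exists>Q. infinite {n. q n \<le> Q}")
    case True
    then obtain Q where Q: "infinite {n. q n \<le> Q}" by blast
    \<comment> \<open>Only finitely many values do not exceed \<open>Q\<close>, so by the pigeonhole
      principle one period occurs infinitely often.\<close>
    have "finite (q ` {n. q n \<le> Q})" by (rule finite_subset[of _ "{..Q}"]) auto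
    then obtain n1 where n1: "n1 \<in> {n. q n \<le> Q}" "infinite {n \<in> {n. q n \<le> Q}. q n = q n1}"
      using pigeonhole_infinite[OF Q] by blast
    define q0 where "q0 = q n1"
    have inf: "infinite {n. q n = q0}"
      using n1(2) by (rule contrapos_nn) (auto simp: q0_def elim: finite_subset[rotated])
    have "periodic_seq q0 \<mu>" "periodic_seq q0 \<nu>"
      using periodic_of_frequent[OF inf per(1) lim(1)[folded dm_def] m']
        periodic_of_frequent[OF inf per(2) lim(2)[folded dn_def] n'] by auto
    moreover have "0 < q0"
    proof -
      obtain k where "1 \<le> k" "q k = q0" using inf unfolding infinite_nat_iff_unbounded_le by blast
      then show ?thesis using q by force
    qed
    \<comment> \<open>From \<open>q0\<close> on, \<open>\<mu>\<close> and \<open>\<nu>\<close> are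
      their own approximants, with error 0.\<close>
    ultimately show ?thesis
      by (intro exI[where x = q0] conjI allI impI, simp) (rule exI[of _ \<mu>], rule exI[of _ \<nu>], simp)
  next
    case False
    then have fin: "finite {n. q n \<le> Q}" for Q by blast
    have "eventually (\<lambda>n. dm n < 1 \<and> dn n < 1) sequentially"
      using order_tendstoD(2)[OF lim(1)[folded dm_def], of 1] order_tendstoD(2)[OF lim(2)[folded dn_def], of 1]
      by (auto intro: eventually_conj)
    then obtain n0 where n0: "\<And>n. n0 \<le> n \<Longrightarrow> dm n < 1 \<and> dn n < 1" by (auto simp: eventually_sequentially)
    define n1 where "n1 = max 1 n0"
    show ?thesis
    proof (rule exI[of _ "max 1 (q n1)"], intro conjI allI impI)
      fix K assume K: "max 1 (q n1) \<le> K"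
      define S where "S = {n. n1 \<le> n \<and> q n \<le> K}"
      have S: "finite S" "n1 \<in> S" using K by (auto simp: S_def intro: finite_subset[OF _ fin[of K]])
      \<comment> \<open>The next index \<open>k + 1\<close> has period at least
        \<open>Suc K\<close>. The hypothesis weights the error of index \<open>k\<close> with
        exactly that next period, so the error is at most
        \<open>exp (- \<eta> * Suc K)\<close>.\<close>
      define k where "k = Max S"
      have k: "k \<in> S" unfolding k_def using S by (intro Max_in) auto
      have "k + 1 \<notin> S" using Max_ge[OF S(1), of "k + 1"] by (auto simp: k_def)
      then have qk: "Suc K \<le> q (k + 1)" using k by (auto simp: S_def)
      have k1: "1 \<le> k" "n0 \<le> k" using k by (auto simp: S_def n1_def)
      have "exp (- \<eta> * real (q (k + 1))) \<le> exp (- \<eta> * Suc K)" using qk eta by simp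
      then have e: "exp (- \<eta> * real (q (k + 1))) * d \<le> exp (- \<eta> * Suc K)" if "d < 1" for d
      proof -
        have "exp (- \<eta> * real (q (k + 1))) * d \<le> exp (- \<eta> * real (q (k + 1))) * 1"
          using that by (intro mult_left_mono) auto
        then show ?thesis using \<open>exp (- \<eta> * real (q (k + 1))) \<le> exp (- \<eta> * Suc K)\<close> by linarith
      qed
      have "q k \<le> K" using k by (simp add: S_def)
      moreover have "\<bar>\<mu> j - \<mu>' k j\<bar> \<le> exp (- \<eta> * Suc K)" "\<bar>\<nu> j - \<nu>' k j\<bar> \<le> exp (- \<eta> * Suc K)" for j
        using order_trans[OF m[OF k1(1)] e] order_trans[OF n[OF k1(1)] e] n0[OF k1(2)] by auto
      ultimately show "\<exists>p x y. 0 < p \<and> p \<le> K \<and> periodic_seq p x \<and> periodic_seq p y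
         \<and> (\<forall>j. \<bar>\<mu> j - x j\<bar> \<le> exp (- \<eta> * Suc K)) \<and> (\<forall>j. \<bar>\<nu> j - y j\<bar> \<le> exp (- \<eta> * Suc K))"
        using q[OF k1(1)] per[OF k1(1)] by blast
    qed simp
  qed
qed

text \<open>The bound involves only \<open>A\<close> and \<open>N\<close>: the constants
  \<open>C\<close> and \<open>c\<close> enter through \<open>\<epsilon>\<close> and
  \<open>Kc\<close>, and both drop out as the length \<open>X K ^ 20\<close> of the chain tends to
  infinity.\<close>

lemma velocity_lower_bound:
  fixes \<mu> \<nu> :: "int \<Rightarrow> real" and G :: nat
  defines "A \<equiv> 20 * (real G)\<^sup>2"
  assumes G: "1 \<le> G" and mu: "\<And>j. 1 / G \<le> \<mu> j" "\<And>j. 2 * \<mu> j + 1 \<le> G" and nu: "\<And>j. 2 * \<bar>\<nu> j\<bar> + 1 \<le> G"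
    and approx: "\<And>K. N \<le> K \<Longrightarrow> \<exists>p x y. 0 < p \<and> p \<le> K \<and> periodic_seq p x \<and> periodic_seq p y
     \<and> (\<forall>j. \<bar>\<mu> j - x j\<bar> \<le> 1 / A ^ (68 * Suc K)) \<and> (\<forall>j. \<bar>\<nu> j - y j\<bar> \<le> 1 / A ^ (68 * Suc K))"
    and LR: "0 < C" "0 < c" "0 < v" "lieb_robinson_bound \<mu> \<nu> C c v"
  shows "1 / (2 * A ^ (2 * N)) / pi \<le> v"
proof -
  have G1: "1 \<le> real G" using G by simp
  have A: "20 \<le> A" using twenty_le_step_bound[OF G1] by (simp add: A_def)
  define \<delta> where "\<delta> K = 1 / A ^ (68 * Suc K)" for K
  have dmono: "\<delta> (Suc K) \<le> \<delta> K" for K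
    unfolding \<delta>_def using A by (intro divide_left_mono power_increasing mult_pos_pos) auto
  have d0: "0 \<le> \<delta> K" for K using A by (simp add: \<delta>_def)
  \<comment> \<open>The hypotheses leave a margin of \<open>1 / G\<close> below \<open>a0\<close>,
    and of 1 above \<open>a0\<close> and \<open>\<bar>b0\<bar>\<close>. The error
    \<open>2 * \<delta> K\<close> fits into both, so the approximants are admissible with the same
    \<open>G\<close>.\<close>
  have dG: "2 * \<delta> K \<le> 1 / G" "2 * \<delta> K \<le> 1" for K
  proof -
    have "A \<le> A ^ (68 * Suc K)" using A by (intro self_le_power) auto
    then have "\<delta> K \<le> 1 / A" unfolding \<delta>_def using A by (intro divide_left_mono) auto
    moreover have "1 / A \<le> 1 / (2 * G)"
    proof -
      have "real G \<le> real G * real G" using G1 by simp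
      then have "2 * real G \<le> A" using G1 unfolding A_def power2_eq_square by linarith
      then show ?thesis using G1 by (intro divide_left_mono) auto
    qed
    ultimately show 1: "2 * \<delta> K \<le> 1 / G" by simp
    have "1 / real G \<le> 1" using G1 by simp
    then show "2 * \<delta> K \<le> 1" using 1 by linarith
  qed
  define good where "good K p x y \<longleftrightarrow> 0 < p \<and> p \<le> K \<and> periodic_seq p x \<and> periodic_seq p y
     \<and> (\<forall>j. \<bar>\<mu> j - x j\<bar> \<le> \<delta> K) \<and> (\<forall>j. \<bar>\<nu> j - y j\<bar> \<le> \<delta> K)" for K p x y
  have "\<exists>p x y. good K p x y" if "N \<le> K" for K
    using approx[OF that] unfolding good_def \<delta>_def .
  then obtain p x y where g: "\<And>K. N \<le> K \<Longrightarrow> good K (p K) (x K) (y K)" by metis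
  define a where "a K k = 2 * x K (int k)" for K k
  define b where "b K k = - 2 * y K (int k)" for K k
  define a0 where "a0 k = 2 * \<mu> (int k)" for k
  define b0 where "b0 k = - 2 * \<nu> (int k)" for k
  have da: "\<bar>a K k - a0 k\<bar> \<le> 2 * \<delta> K" and db: "\<bar>b K k - b0 k\<bar> \<le> 2 * \<delta> K" if "N \<le> K" for K k
  proof -
    have "\<bar>\<mu> (int k) - x K (int k)\<bar> \<le> \<delta> K" "\<bar>\<nu> (int k) - y K (int k)\<bar> \<le> \<delta> K"
      using g[OF that] by (auto simp: good_def)
    then show "\<bar>a K k - a0 k\<bar> \<le> 2 * \<delta> K" "\<bar>b K k - b0 k\<bar> \<le> 2 * \<delta> K"
      by (auto simp: a_def a0_def b_def b0_def)
  qed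
  have a0: "2 / G \<le> a0 k" "a0 k + 1 \<le> G" "\<bar>b0 k\<bar> + 1 \<le> G" for k
    using mu[of "int k"] nu[of "int k"] by (simp_all add: a0_def b0_def abs_mult)
  have G2: "2 / real G = 1 / real G + 1 / real G" by simp
  have Gp: "0 < 1 / real G" using G1 by simp
  have adm0: "jac_adm G a0 b0" unfolding jac_adm_def
  proof (intro conjI allI)
    fix k show "1 / real G \<le> a0 k" "a0 k \<le> G" "\<bar>b0 k\<bar> \<le> G" using a0[of k] G2 Gp by linarith+
  qed (rule G1)
  have adm: "jac_adm G (a K) (b K)" if "N \<le> K" for K unfolding jac_adm_def
  proof (intro conjI allI)
    fix k
    show "1 / real G \<le> a K k" "a K k \<le> G" "\<bar>b K k\<bar> \<le> G"
      using a0[of k] G2 Gp da[OF that, of k] db[OF that, of k] dG[of K] by linarith+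
  qed (rule G1)
  have per: "jac_per (p K) (a K) (b K)" and pK: "0 < p K \<and> p K \<le> K" if "N \<le> K" for K
    using g[OF that] by (auto simp: good_def jac_per_def periodic_seq_def a_def b_def)
  define z0 where "z0 = 1 / (2 * A ^ (2 * N))"
  have z0: "0 < z0" using A by (simp add: z0_def)
  have meas: "z0 \<le> measure lborel (spec_set G (a K) (b K) (p K))" if "N \<le> K" for K
    unfolding z0_def A_def
  proof (rule spec_set_chain[OF adm per pK _ _ that])
    fix K k assume K: "N \<le> K"
    \<comment> \<open>Consecutive approximants are compared through the limit, each contributing at
      most \<open>2 * \<delta> K\<close>; hence the numerator 4.\<close>
    have e: "4 / (20 * (real G)\<^sup>2) ^ (68 * Suc K) = 4 * \<delta> K" by (simp add: \<delta>_def A_def)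
    show "\<bar>a K k - a (Suc K) k\<bar> \<le> 4 / (20 * (real G)\<^sup>2) ^ (68 * Suc K)"
      "\<bar>b K k - b (Suc K) k\<bar> \<le> 4 / (20 * (real G)\<^sup>2) ^ (68 * Suc K)"
      unfolding e using da[of K k] da[of "Suc K" k] db[of K k] db[of "Suc K" k] dmono[of K] K by linarith+
  qed auto
  \<comment> \<open>Any value strictly between 0 and \<open>c * v\<close> would serve.\<close>
  define \<epsilon> where "\<epsilon> = c * v / 2"
  have eps: "0 < \<epsilon>" "\<epsilon> < c * v" using LR by (auto simp: \<epsilon>_def)
  define Kc where "Kc = G * (C / (c * v - \<epsilon>) + 1 / \<epsilon>)"
  have Kc: "0 < Kc" unfolding Kc_def using G1 LR eps by (intro mult_pos_pos add_pos_pos) auto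
  \<comment> \<open>A natural number, since its power 20 is the length of a chain.\<close>
  define X where "X K = (20 * G\<^sup>2) ^ Suc K" for K
  have XA: "real (X K) = A ^ Suc K" for K by (simp add: X_def A_def)
  have nz: "\<And>k. a0 k \<noteq> 0" using jac_admD(2)[OF adm0] by (metis less_irrefl)
  have "(\<epsilon> * (real (X K) ^ 20 - 1) / v - ln Kc - 24 * ln (real (X K))) * z0 \<le> real (X K) ^ 20 * (pi * \<epsilon>)"
    if K: "N \<le> K" for K
  proof -
    define L where "L = X K ^ 20"
    have X20: "20 \<le> real (X K)"
    proof -
      have "A \<le> A ^ Suc K" using A by (intro self_le_power) auto
      then show ?thesis using A XA[of K] by linarith
    qed
    have XL: "X K \<le> L" unfolding L_def using X20 by (intro self_le_power) auto
    then have L: "2 \<le> L" "0 < L" using X20 by linarith+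
    let ?S = "spec_set G (a K) (b K) (p K)"
    have nzK: "\<And>k. a K k \<noteq> 0" using jac_admD(2)[OF adm[OF K]] by (metis less_irrefl)
    have pK': "0 < p K" "p K \<le> Suc K" using pK[OF K] by auto
    have S: "?S \<in> fmeasurable lborel" using spec_set_fmeasurable[where a = "a K", OF nzK pK'(1)] .
    define P where "P = Kc * exp (- (\<epsilon> * (L - 1) / v))"
    have P: "0 < P" using Kc by (simp add: P_def)
    have M: "0 < real (X K) ^ 24" using X20 by simp
    have X68: "4 * \<delta> K = 4 / real (X K) ^ 68"
      unfolding XA \<delta>_def power_mult[symmetric] by (simp add: mult.commute)
    have ineq: "(- ln P - ln (real (X K) ^ 24)) * measure lborel ?S \<le> L * (pi * \<epsilon>)"
    proof (rule dirichlet_average[where a = a0 and b = b0, OF nz L(2) eps(1) P M _ S])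
      show "1 \<le> P * cmod (fst (jsol a0 b0 (Complex E (- \<epsilon>)) (1, 0) L))" for E
        using dirichlet_lower_bound[OF adm0[unfolded a0_def[abs_def] b0_def[abs_def]] LR(4) L(1) LR(1,3) eps, of E]
        by (simp add: P_def Kc_def a0_def[abs_def] b0_def[abs_def] mult_ac)
      fix E assume E: "E \<in> ?S"
      have "nrm1 (jsol a0 b0 (of_real E) (1, 0) L) \<le> real (X K) ^ 24 * nrm1 (1, 0)"
      proof (rule elliptic_persistence[OF adm[OF K] adm0 per[OF K] pK' _ _ _ E])
        show "real (X K) = (20 * (real G)\<^sup>2) ^ Suc K" by (simp add: XA A_def)
        show "\<bar>a K k - a0 k\<bar> \<le> 4 / real (X K) ^ 68" "\<bar>b K k - b0 k\<bar> \<le> 4 / real (X K) ^ 68" for k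
          unfolding X68[symmetric] using da[OF K, of k] db[OF K, of k] d0[of K] by linarith+
      qed (simp add: L_def)
      moreover have "cmod (fst (jsol a0 b0 (of_real E) (1, 0) L)) \<le> nrm1 (jsol a0 b0 (of_real E) (1, 0) L)"
        by (simp add: nrm1_def)
      moreover have "nrm1 (1, 0) = 1" by (simp add: nrm1_def)
      ultimately show "cmod (fst (jsol a0 b0 (of_real E) (1, 0) L)) \<le> real (X K) ^ 24" by simp
    qed
    let ?Y = "\<epsilon> * (real (X K) ^ 20 - 1) / v - ln Kc - 24 * ln (real (X K))"
    have "real (L - 1) = real (X K) ^ 20 - 1" using L by (simp add: of_nat_diff L_def)
    then have Y: "- ln P - ln (real (X K) ^ 24) = ?Y"
      using Kc X20 by (simp add: P_def ln_mult ln_realpow)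
    \<comment> \<open>The measure is known only from below, so it can be replaced by
      \<open>z0\<close> when \<open>?Y\<close> is nonnegative; otherwise the inequality is
      trivial.\<close>
    show "?Y * z0 \<le> real (X K) ^ 20 * (pi * \<epsilon>)"
    proof (cases "0 \<le> ?Y")
      case True
      then have "?Y * z0 \<le> ?Y * measure lborel ?S" by (intro mult_left_mono meas K)
      also have "\<dots> \<le> L * (pi * \<epsilon>)" using ineq unfolding Y .
      finally show ?thesis by (simp add: L_def)
    next
      case False
      then have "?Y * z0 \<le> 0" using z0 by (simp add: mult_nonpos_nonneg)
      also have "0 \<le> real (X K) ^ 20 * (pi * \<epsilon>)" using eps by simp
      finally show ?thesis .
    qed
  qed
  moreover have "filterlim (\<lambda>K. real (X K)) at_top sequentially"
  proof -
    have "filterlim (\<lambda>K. A ^ Suc K) at_top sequentially"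
    proof (rule filterlim_at_top_mono[OF filterlim_real_sequentially], intro always_eventually allI)
      fix K
      have "real K \<le> 2 ^ K" by (metis less_exp less_imp_le of_nat_le_iff of_nat_numeral of_nat_power)
      also have "\<dots> \<le> A ^ K" using A by (intro power_mono) auto
      also have "\<dots> \<le> A ^ Suc K" using A by (intro power_increasing) auto
      finally show "real K \<le> A ^ Suc K" .
    qed
    then show ?thesis by (simp only: XA)
  qed
  ultimately have "z0 / pi \<le> v" using velocity_limit[of "\<lambda>K. real (X K)" z0 \<epsilon> v N "ln Kc"] z0 eps LR by blast
  then show ?thesis by (simp add: z0_def)
qed

theorem theorem1p5:
  shows "\<exists>\<eta> :: real \<Rightarrow> real \<Rightarrow> real \<Rightarrow> real.
    \<forall>\<mu> \<nu> :: int \<Rightarrow> real.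
      in_linf \<mu> \<longrightarrow> in_linf \<nu> \<longrightarrow> (INF j. \<mu> j) > 0 \<longrightarrow>
      (let \<eta>\<^sub>0 = \<eta> (linf_norm \<mu>) (linf_norm (\<lambda>j. inverse (\<mu> j))) (linf_norm \<nu>)
       in \<eta>\<^sub>0 > 0 \<and>
          ((\<exists>(q :: nat \<Rightarrow> nat) (\<mu>' :: nat \<Rightarrow> int \<Rightarrow> real) (\<nu>' :: nat \<Rightarrow> int \<Rightarrow> real).
              (\<forall>n\<ge>1. q n > 0 \<and> in_linf (\<mu>' n) \<and> in_linf (\<nu>' n) \<and>
                 periodic_seq (q n) (\<mu>' n) \<and> periodic_seq (q n) (\<nu>' n)) \<and>
              (\<lambda>n. exp (\<eta>\<^sub>0 * real (q (n + 1))) * linf_norm (\<lambda>j. \<mu> j - \<mu>' n j)) \<longlonglongrightarrow> 0 \<and>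
              (\<lambda>n. exp (\<eta>\<^sub>0 * real (q (n + 1))) * linf_norm (\<lambda>j. \<nu> j - \<nu>' n j)) \<longlonglongrightarrow> 0)
           \<longrightarrow> (\<exists>v\<^sub>0 > 0. \<forall>C c v :: real.
                 C > 0 \<longrightarrow> c > 0 \<longrightarrow> v > 0 \<longrightarrow> lieb_robinson_bound \<mu> \<nu> C c v \<longrightarrow> v \<ge> v\<^sub>0)))"
proof -
  \<comment> \<open>One integer, computed from the three norms alone, that dominates
    \<open>2 * \<mu> j + 1\<close>, \<open>2 * \<bar>\<nu> j\<bar> + 1\<close> and
    \<open>inverse (\<mu> j)\<close>.\<close>
  define g where "g m1 m2 n1 = nat \<lceil>2 * m1 + 2 * n1 + m2\<rceil> + 1" for m1 m2 n1 :: real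
  \<comment> \<open>With this value \<open>exp (- \<eta>\<^sub>0 * Suc K)\<close> is the error
    \<open>1 / A ^ (68 * Suc K)\<close> that the chain of approximants tolerates.\<close>
  define \<eta> where "\<eta> m1 m2 n1 = 68 * ln (20 * (real (g m1 m2 n1))\<^sup>2)" for m1 m2 n1
  show ?thesis
  proof (rule exI[of _ \<eta>], intro allI impI, unfold Let_def, intro conjI impI)
    fix \<mu> \<nu> :: "int \<Rightarrow> real"
    assume mu: "in_linf \<mu>" and nu: "in_linf \<nu>" and inf: "0 < (INF j. \<mu> j)"
    define m1 m2 n1 where "m1 = linf_norm \<mu>" and "m2 = linf_norm (\<lambda>j. inverse (\<mu> j))" and "n1 = linf_norm \<nu>"
    define G where "G = g m1 m2 n1"
    define A where "A = 20 * (real G)\<^sup>2"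
    have G1: "1 \<le> G" by (simp add: G_def g_def)
    have A: "20 \<le> A" using twenty_le_step_bound[of "real G"] G1 by (simp add: A_def)
    have Gge: "2 * m1 + 2 * n1 + m2 + 1 \<le> G"
      using of_nat_ceiling[of "2 * m1 + 2 * n1 + m2"] by (simp add: G_def g_def)
    have eta: "\<eta> m1 m2 n1 = 68 * ln A" by (simp add: \<eta>_def A_def G_def)
    show pos: "0 < \<eta> (linf_norm \<mu>) (linf_norm (\<lambda>j. inverse (\<mu> j))) (linf_norm \<nu>)"
      using A eta by (simp add: m1_def m2_def n1_def)
    have bdd: "bdd_below (range \<mu>)"
    proof -
      have "- linf_norm \<mu> \<le> \<mu> j" for j using linf_le[OF mu, of j] by linarith
      then show ?thesis by (rule bdd_belowI2)
    qed
    have mu_ge: "(INF j. \<mu> j) \<le> \<mu> j" for j using bdd by (rule cINF_lower) simp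
    have mu_pos: "0 < \<mu> j" for j using mu_ge[of j] inf by linarith
    \<comment> \<open>The positive infimum bounds the inverses, which makes the supremum
      \<open>m2\<close> an upper bound for them.\<close>
    have inv: "in_linf (\<lambda>j. inverse (\<mu> j))" unfolding in_linf_def
    proof (rule bdd_aboveI2)
      fix j show "\<bar>inverse (\<mu> j)\<bar> \<le> inverse (INF j. \<mu> j)"
        using mu_pos[of j] mu_ge[of j] inf by (simp add: le_imp_inverse_le)
    qed
    have m1: "\<mu> j \<le> m1" for j using linf_le[OF mu, of j] by (simp add: m1_def)
    have n1: "\<bar>\<nu> j\<bar> \<le> n1" for j using linf_le[OF nu, of j] by (simp add: n1_def)
    have m2: "inverse (\<mu> j) \<le> m2" for j using abs_le_D1[OF linf_le[OF inv, of j]] by (simp add: m2_def)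
    have nonneg: "0 \<le> m1" "0 \<le> n1" "0 \<le> m2"
      using m1[of 0] mu_pos[of 0] n1[of 0] m2[of 0] by (auto intro: order_trans[of _ "inverse (\<mu> 0)"])
    have mu1: "1 / G \<le> \<mu> j" for j
    proof -
      have "inverse (\<mu> j) \<le> G" using m2[of j] Gge nonneg by linarith
      then show ?thesis using mu_pos[of j] G1 by (simp add: field_simps)
    qed
    have mu2: "2 * \<mu> j + 1 \<le> G" for j using m1[of j] Gge nonneg by linarith
    have nu1: "2 * \<bar>\<nu> j\<bar> + 1 \<le> G" for j using n1[of j] Gge nonneg by linarith
    assume "\<exists>(q :: nat \<Rightarrow> nat) (\<mu>' :: nat \<Rightarrow> int \<Rightarrow> real) (\<nu>' :: nat \<Rightarrow> int \<Rightarrow> real).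
              (\<forall>n\<ge>1. q n > 0 \<and> in_linf (\<mu>' n) \<and> in_linf (\<nu>' n) \<and>
                 periodic_seq (q n) (\<mu>' n) \<and> periodic_seq (q n) (\<nu>' n)) \<and>
              (\<lambda>n. exp (\<eta> (linf_norm \<mu>) (linf_norm (\<lambda>j. inverse (\<mu> j))) (linf_norm \<nu>) * real (q (n + 1))) * linf_norm (\<lambda>j. \<mu> j - \<mu>' n j)) \<longlonglongrightarrow> 0 \<and>
              (\<lambda>n. exp (\<eta> (linf_norm \<mu>) (linf_norm (\<lambda>j. inverse (\<mu> j))) (linf_norm \<nu>) * real (q (n + 1))) * linf_norm (\<lambda>j. \<nu> j - \<nu>' n j)) \<longlonglongrightarrow> 0"
    then obtain q \<mu>' \<nu>' where q: "\<And>n. 1 \<le> n \<Longrightarrow> 0 < q n \<and> in_linf (\<mu>' n) \<and> in_linf (\<nu>' n) \<and>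
                 periodic_seq (q n) (\<mu>' n) \<and> periodic_seq (q n) (\<nu>' n)"
      and lim: "(\<lambda>n. exp (\<eta> (linf_norm \<mu>) (linf_norm (\<lambda>j. inverse (\<mu> j))) (linf_norm \<nu>) * real (q (n + 1))) * linf_norm (\<lambda>j. \<mu> j - \<mu>' n j)) \<longlonglongrightarrow> 0"
        "(\<lambda>n. exp (\<eta> (linf_norm \<mu>) (linf_norm (\<lambda>j. inverse (\<mu> j))) (linf_norm \<nu>) * real (q (n + 1))) * linf_norm (\<lambda>j. \<nu> j - \<nu>' n j)) \<longlonglongrightarrow> 0"
      by blast
    have expA: "exp (- (68 * ln A) * Suc K) = 1 / A ^ (68 * Suc K)" for K
    proof -
      have "exp (real (68 * Suc K) * ln A) = A ^ (68 * Suc K)" using A by (subst exp_of_nat_mult) simp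
      moreover have "- (68 * ln A) * Suc K = - (real (68 * Suc K) * ln A)" by simp
      ultimately show ?thesis by (simp only: exp_minus inverse_eq_divide)
    qed
    have "\<exists>N\<ge>1. \<forall>K\<ge>N. \<exists>p x y. 0 < p \<and> p \<le> K \<and> periodic_seq p x \<and> periodic_seq p y
     \<and> (\<forall>j. \<bar>\<mu> j - x j\<bar> \<le> exp (- (68 * ln A) * Suc K)) \<and> (\<forall>j. \<bar>\<nu> j - y j\<bar> \<le> exp (- (68 * ln A) * Suc K))"
      by (rule approximants_by_period[of _ q \<mu> \<nu> \<mu>' \<nu>'])
         (use pos lim q mu nu in \<open>auto simp: eta m1_def[symmetric] m2_def[symmetric] n1_def[symmetric]\<close>)
    then obtain N where N: "\<And>K. N \<le> K \<Longrightarrow> \<exists>p x y. 0 < p \<and> p \<le> K \<and> periodic_seq p x \<and> periodic_seq p y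
     \<and> (\<forall>j. \<bar>\<mu> j - x j\<bar> \<le> 1 / A ^ (68 * Suc K)) \<and> (\<forall>j. \<bar>\<nu> j - y j\<bar> \<le> 1 / A ^ (68 * Suc K))"
      unfolding expA by blast
    show "\<exists>v\<^sub>0 > 0. \<forall>C c v :: real. C > 0 \<longrightarrow> c > 0 \<longrightarrow> v > 0 \<longrightarrow> lieb_robinson_bound \<mu> \<nu> C c v \<longrightarrow> v \<ge> v\<^sub>0"
    proof (intro exI[of _ "1 / (2 * A ^ (2 * N)) / pi"] conjI allI impI)
      show "0 < 1 / (2 * A ^ (2 * N)) / pi" using A by simp
      fix C c v :: real
      assume "0 < C" "0 < c" "0 < v" "lieb_robinson_bound \<mu> \<nu> C c v"
      then show "1 / (2 * A ^ (2 * N)) / pi \<le> v"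
        unfolding A_def using velocity_lower_bound[OF G1 mu1 mu2 nu1 N[unfolded A_def]] by blast
    qed
  qed
qed

end
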